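(* Let $E: y^2 = 4x^3 - g_2x - g_3$ be an elliptic curve with $g_2,g_3\in\mathbb{R}$, and let $\psi:\mathbb{N}\to\mathbb{R}_{>0}$ be non-decreasing. If $\sum_{n=1}^\infty \psi(n)^{-1}$ diverges, then for all points $P\in E(\mathbb{R})$ outside a set of Lebesgue measure zero, there exist infinitely many positive integers $n$ such that $$x(nP) > \psi(n)^2 \quad\text{and}\quad y(nP)>\psi(n)^3.$$ If $\sum_{n=1}^\infty \psi(n)^{-1}$ converges, then the set of points $P\in E(\mathbb{R})$ for which there exist infinitely many such $n$ has Lebesgue measure zero.
   Context: $E(\mathbb{R})$ is the group of real points of $E$ (with the point at infinity); $x(Q),y(Q)$ are the coordinates of a point $Q$. Lebesgue measure on $E(\mathbb{R})$ refers to the one-dimensional Lebesgue measure on this real curve (e.g. transported via the real-analytic parameterization $z\mapsto(\wp(z),\wp'(z))$ by the Weierstrass $\wp$-function of the period lattice of $E$). *)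

theory Defs
  imports "HOL-Analysis.Analysis" "HOL-Algebra.Group"
begin

datatype ec_point = Infty | Aff real real

definition ec_rhs :: "real \<Rightarrow> real \<Rightarrow> real \<Rightarrow> real"
  where "ec_rhs g2 g3 x = 4 * x ^ 3 - g2 * x - g3"

definition ec_points :: "real \<Rightarrow> real \<Rightarrow> ec_point set"
  where "ec_points g2 g3 = insert Infty {Aff x y | x y. y\<^sup>2 = ec_rhs g2 g3 x}"

text \<open>
  Chord-tangent law. Substituting a line of slope \<open>l\<close> into \<open>y\<^sup>2 = 4 x\<^sup>3 - g2 x - g3\<close> shows that
  the abscissae of its three intersection points with the curve add up to \<open>l\<^sup>2 / 4\<close>; the sum
  is the reflection of the third one. The case \<open>x1 = x2\<close>, \<open>y1 = - y2\<close> includes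
  doubling a point with \<open>y1 = 0\<close>.
\<close>

definition ec_third :: "real \<Rightarrow> real \<Rightarrow> real \<Rightarrow> real \<Rightarrow> ec_point"
  where "ec_third l x1 y1 x2 =
    (let x3 = l\<^sup>2 / 4 - x1 - x2 in Aff x3 (- (y1 + l * (x3 - x1))))"

fun ec_add :: "real \<Rightarrow> ec_point \<Rightarrow> ec_point \<Rightarrow> ec_point" where
  "ec_add g2 Infty Q = Q"
| "ec_add g2 P Infty = P"
| "ec_add g2 (Aff x1 y1) (Aff x2 y2) =
    (if x1 \<noteq> x2 then ec_third ((y2 - y1) / (x2 - x1)) x1 y1 x2
     else if y1 = - y2 then Infty
     else ec_third ((12 * x1\<^sup>2 - g2) / (2 * y1)) x1 y1 x2)"

definition ec_group :: "real \<Rightarrow> real \<Rightarrow> ec_point monoid"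
  where "ec_group g2 g3 = \<lparr>carrier = ec_points g2 g3, mult = ec_add g2, one = Infty\<rparr>"

definition elliptic_curve :: "real \<Rightarrow> real \<Rightarrow> bool"
  where "elliptic_curve g2 g3 \<longleftrightarrow> g2 ^ 3 - 27 * g3\<^sup>2 \<noteq> 0"

definition ec_borel :: "real \<Rightarrow> real \<Rightarrow> ec_point measure"
  where "ec_borel g2 g3 =
    restrict_space (sigma UNIV {A. {p. Aff (fst p) (snd p) \<in> A} \<in> sets borel}) (ec_points g2 g3)"

text \<open>
  The parameterization \<open>z \<mapsto> (\<wp>(z), \<wp>'(z))\<close> satisfies \<open>dx = \<wp>'(z) dz = y dz\<close>, so it transports
  the Lebesgue measure \<open>dz\<close> to \<open>|dx / y|\<close> on each of the two graphs
  \<open>y = s * sqrt (4 x\<^sup>3 - g2 x - g3)\<close>, \<open>s = 1\<close> or \<open>s = -1\<close>. What these graphs miss is the point at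
  infinity and the at most three points with \<open>y = 0\<close>, which carry no mass. As for
  \<^term>\<open>lebesgue\<close>, the measure is completed.
\<close>

definition ec_branch :: "real \<Rightarrow> real \<Rightarrow> real \<times> real \<Rightarrow> ec_point"
  where "ec_branch g2 g3 = (\<lambda>(s, x). Aff x (s * sqrt (ec_rhs g2 g3 x)))"

definition ec_chart_measure :: "real \<Rightarrow> real \<Rightarrow> (real \<times> real) measure"
  where "ec_chart_measure g2 g3 =
    density
      (restrict_space (count_space {1, -1} \<Otimes>\<^sub>M lborel) {(s, x). s \<in> {1, -1} \<and> 0 < ec_rhs g2 g3 x})
      (\<lambda>(s, x). ennreal (1 / sqrt (ec_rhs g2 g3 x)))"

definition ec_lborel :: "real \<Rightarrow> real \<Rightarrow> ec_point measure"
  where "ec_lborel g2 g3 = distr (ec_chart_measure g2 g3) (ec_borel g2 g3) (ec_branch g2 g3)"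

definition ec_lebesgue :: "real \<Rightarrow> real \<Rightarrow> ec_point measure"
  where "ec_lebesgue g2 g3 = completion (ec_lborel g2 g3)"

lemma ec_third_closed:
  fixes x1 y1 x2 l g2 g3 :: real
  assumes "\<And>x. ec_rhs g2 g3 x - (y1 + l * (x - x1))\<^sup>2 = 4 * (x - x1) * (x - x2) * (x - x3)"
    and "x3 = l\<^sup>2 / 4 - x1 - x2"
  shows "ec_third l x1 y1 x2 \<in> ec_points g2 g3"
proof -
  have "(- (y1 + l * (x3 - x1)))\<^sup>2 = ec_rhs g2 g3 x3"
    using assms(1)[of x3] by (simp only: power2_minus) simp
  then show ?thesis
    unfolding ec_third_def ec_points_def Let_def assms(2)[symmetric] by blast
qed

lemma ec_add_closed:
  assumes "P \<in> ec_points g2 g3" "Q \<in> ec_points g2 g3"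
  shows "ec_add g2 P Q \<in> ec_points g2 g3"
proof (cases P; cases Q)
  fix x1 y1 x2 y2 assume PQ: "P = Aff x1 y1" "Q = Aff x2 y2"
  have e: "y1\<^sup>2 = ec_rhs g2 g3 x1" "y2\<^sup>2 = ec_rhs g2 g3 x2"
    using assms PQ by (auto simp: ec_points_def)
  show ?thesis
  proof (cases "x1 = x2")
    case False
    define l where "l = (y2 - y1) / (x2 - x1)"
    have y2: "y2 = y1 + l * (x2 - x1)" using False by (simp add: l_def)
    define x3 where "x3 = l\<^sup>2 / 4 - x1 - x2"
    have "ec_rhs g2 g3 x - (y1 + l * (x - x1))\<^sup>2 = 4 * (x - x1) * (x - x2) * (x - x3)" for x
    proof -
      have "(x2 - x1) * (ec_rhs g2 g3 x - (y1 + l * (x - x1))\<^sup>2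
              - 4 * (x - x1) * (x - x2) * (x - x3)) = 0"
        using e unfolding y2 ec_rhs_def x3_def by algebra
      then show ?thesis using False by simp
    qed
    from ec_third_closed[OF this x3_def] show ?thesis
      using False PQ by (simp add: l_def)
  next
    case True
    show ?thesis
    proof (cases "y1 = - y2")
      case True
      then show ?thesis using PQ \<open>x1 = x2\<close> by (simp add: ec_points_def)
    next
      case False
      have y: "y2 = y1" "y1 \<noteq> 0"
        using e True False power2_eq_iff[of y1 y2] by auto
      define l where "l = (12 * x1\<^sup>2 - g2) / (2 * y1)"
      have l: "2 * y1 * l = 12 * x1\<^sup>2 - g2" using y by (simp add: l_def)
      define x3 where "x3 = l\<^sup>2 / 4 - x1 - x2"
      have "ec_rhs g2 g3 x - (y1 + l * (x - x1))\<^sup>2 = 4 * (x - x1) * (x - x2) * (x - x3)" for x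
        using e(1) l unfolding ec_rhs_def x3_def True[symmetric] by algebra
      from ec_third_closed[OF this x3_def] show ?thesis
        using False True PQ by (simp add: l_def)
    qed
  qed
qed (use assms in auto)

lemma space_ec_lebesgue: "space (ec_lebesgue g2 g3) = carrier (ec_group g2 g3)"
  by (simp add: ec_lebesgue_def ec_lborel_def ec_borel_def ec_group_def space_restrict_space)

lemma sets_ec_borel:
  "sets (ec_borel g2 g3) =
    (\<inter>) (ec_points g2 g3) ` {A. {p. Aff (fst p) (snd p) \<in> A} \<in> sets borel}"
proof -
  have "sigma_algebra UNIV {A. {p. Aff (fst p) (snd p) \<in> A} \<in> sets (borel :: (real \<times> real) measure)}"
    unfolding sigma_algebra_iff2
  proof (intro conjI allI impI ballI; clarsimp?)
    fix s assume "{p. Aff (fst p) (snd p) \<in> s} \<in> sets (borel :: (real \<times> real) measure)"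
    then have "- {p. Aff (fst p) (snd p) \<in> s} \<in> sets (borel :: (real \<times> real) measure)" by auto
    then show "{p. Aff (fst p) (snd p) \<notin> s} \<in> sets (borel :: (real \<times> real) measure)"
      by (simp add: Collect_neg_eq)
  next
    fix A :: "nat \<Rightarrow> ec_point set"
    assume "range A \<subseteq> {A. {p. Aff (fst p) (snd p) \<in> A} \<in> sets (borel :: (real \<times> real) measure)}"
    then have "(\<Union>i. {p. Aff (fst p) (snd p) \<in> A i}) \<in> sets (borel :: (real \<times> real) measure)"
      by (intro sets.countable_UN) auto
    also have "(\<Union>i. {p. Aff (fst p) (snd p) \<in> A i}) = {p. \<exists>i. Aff (fst p) (snd p) \<in> A i}" by auto
    finally show "{p. \<exists>i. Aff (fst p) (snd p) \<in> A i} \<in> sets (borel :: (real \<times> real) measure)" .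
  qed
  then show ?thesis
    unfolding ec_borel_def sets_restrict_space
    by (subst sets_measure_of) (auto simp: sigma_algebra.sigma_sets_eq)
qed

lemma measurable_ec_branch [measurable]:
  "ec_branch g2 g3 \<in> measurable (ec_chart_measure g2 g3) (ec_borel g2 g3)"
proof (rule measurableI)
  let ?M = "count_space {1, -1} \<Otimes>\<^sub>M lborel :: (real \<times> real) measure"
  let ?S = "{(s::real, x). s \<in> {1, -1} \<and> 0 < ec_rhs g2 g3 x}"
  have space: "space (ec_chart_measure g2 g3) = ?S"
    by (auto simp: ec_chart_measure_def space_restrict_space space_pair_measure)
  show "ec_branch g2 g3 p \<in> space (ec_borel g2 g3)" if "p \<in> space (ec_chart_measure g2 g3)" for p
    using that unfolding space
    by (auto simp: ec_branch_def ec_borel_def space_restrict_space ec_points_def power_mult_distrib)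
  fix A assume "A \<in> sets (ec_borel g2 g3)"
  then obtain B where B: "A = ec_points g2 g3 \<inter> B" "{p. Aff (fst p) (snd p) \<in> B} \<in> sets borel"
    by (auto simp: sets_ec_borel)
  have fst: "fst \<in> borel_measurable ?M"
    by (rule measurable_compose[OF measurable_fst]) simp
  have snd: "snd \<in> borel_measurable ?M"
    using measurable_snd[of "count_space {1, -1 :: real}" "lborel :: real measure"] by simp
  have f: "(\<lambda>p. (snd p, fst p * sqrt (ec_rhs g2 g3 (snd p)))) \<in> borel_measurable ?M"
    unfolding ec_rhs_def using fst snd by measurable
  have "ec_branch g2 g3 -` A \<inter> ?S =
      ?S \<inter> ((\<lambda>p. (snd p, fst p * sqrt (ec_rhs g2 g3 (snd p)))) -` {p. Aff (fst p) (snd p) \<in> B} \<inter> space ?M)"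
    by (auto simp: B(1) ec_branch_def ec_points_def power_mult_distrib space_pair_measure)
  then show "ec_branch g2 g3 -` A \<inter> space (ec_chart_measure g2 g3) \<in> sets (ec_chart_measure g2 g3)"
    unfolding space using measurable_sets[OF f B(2)]
    by (auto simp: ec_chart_measure_def sets_restrict_space)
qed

lemma emeasure_ec_lborel:
  assumes A: "A \<in> sets (ec_borel g2 g3)"
  shows "emeasure (ec_lborel g2 g3) A =
    (\<Sum>s\<in>{1, -1}. \<integral>\<^sup>+x\<in>{x. 0 < ec_rhs g2 g3 x \<and> Aff x (s * sqrt (ec_rhs g2 g3 x)) \<in> A}.
       ennreal (1 / sqrt (ec_rhs g2 g3 x)) \<partial>lborel)"
proof -
  let ?M = "count_space {1, -1} \<Otimes>\<^sub>M lborel :: (real \<times> real) measure"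
  let ?S = "{(s::real, x). s \<in> {1, -1} \<and> 0 < ec_rhs g2 g3 x}"
  let ?h = "\<lambda>p. ennreal (1 / sqrt (ec_rhs g2 g3 (snd p)))"
  have snd: "snd \<in> borel_measurable ?M"
    using measurable_snd[of "count_space {1, -1 :: real}" "lborel :: real measure"] by simp
  have h: "?h \<in> borel_measurable ?M" unfolding ec_rhs_def using snd by measurable
  have "{p \<in> space ?M. 0 < ec_rhs g2 g3 (snd p)} \<in> sets ?M"
    unfolding ec_rhs_def using snd by measurable
  also have "{p \<in> space ?M. 0 < ec_rhs g2 g3 (snd p)} = ?S"
    by (auto simp: space_pair_measure)
  finally have S: "?S \<in> sets ?M" .
  let ?R = "restrict_space ?M ?S"
  have hR: "(\<lambda>(s, x). ennreal (1 / sqrt (ec_rhs g2 g3 x))) \<in> borel_measurable ?R"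
    using measurable_restrict_space1[OF h] by (simp add: case_prod_beta')
  let ?V = "ec_branch g2 g3 -` A \<inter> ?S"
  have space: "space (ec_chart_measure g2 g3) = ?S"
    by (auto simp: ec_chart_measure_def space_restrict_space space_pair_measure)
  have V: "?V \<in> sets (ec_chart_measure g2 g3)"
    using measurable_sets[OF measurable_ec_branch A] by (simp add: space)
  then have VR: "?V \<in> sets ?R" by (simp add: ec_chart_measure_def)
  then have VM: "?V \<in> sets ?M" using S by (simp add: sets_restrict_space_iff)
  have "emeasure (ec_lborel g2 g3) A = emeasure (ec_chart_measure g2 g3) ?V"
    unfolding ec_lborel_def using A by (simp add: emeasure_distr[OF measurable_ec_branch] space)
  also have "\<dots> = (\<integral>\<^sup>+p. ?h p * indicator ?V p \<partial>?R)"
    unfolding ec_chart_measure_def by (subst emeasure_density[OF hR VR]) (simp add: case_prod_beta')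
  also have "\<dots> = (\<integral>\<^sup>+p. ?h p * indicator ?V p \<partial>?M)"
    using S by (subst nn_integral_restrict_space) (auto intro!: nn_integral_cong simp: indicator_def)
  also have "\<dots> = (\<integral>\<^sup>+s. \<integral>\<^sup>+x. ?h (s, x) * indicator ?V (s, x) \<partial>lborel \<partial>count_space {1, -1})"
    by (intro lborel.nn_integral_fst[symmetric] borel_measurable_times_ennreal
          h borel_measurable_indicator VM)
  also have "\<dots> = (\<Sum>s\<in>{1, -1}. \<integral>\<^sup>+x. ?h (s, x) * indicator ?V (s, x) \<partial>lborel)"
    by (subst nn_integral_count_space_finite) auto
  also have "\<dots> = (\<Sum>s\<in>{1, -1}. \<integral>\<^sup>+x\<in>{x. 0 < ec_rhs g2 g3 x \<and> Aff x (s * sqrt (ec_rhs g2 g3 x)) \<in> A}.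
       ennreal (1 / sqrt (ec_rhs g2 g3 x)) \<partial>lborel)"
    by (intro sum.cong refl nn_integral_cong) (auto simp: indicator_def ec_branch_def)
  finally show ?thesis .
qed

end

theory Submission
  imports Defs
begin

text \<open>
  The identity component of the curve is parametrized by a homomorphism \<open>pt\<close> from the reals with
  period \<open>\<omega>\<close>: it inverts the elliptic integral of \<open>dx / y\<close>, and it is additive because the sum of
  \<open>pt t\<close> and \<open>pt (c - t)\<close>, computed by the chord formula, has derivative \<open>0\<close> in \<open>t\<close> and tends to
  \<open>pt c\<close> as \<open>t\<close> tends to \<open>0\<close>. Near \<open>0\<close> one has \<open>x \<sim> 1 / z\<^sup>2\<close> and \<open>y \<sim> - 2 / z\<^sup>3\<close>, so the inequalities
  for \<open>n P\<close> say, up to constants, that \<open>n z\<close> lies within \<open>1 / \<psi> n\<close> to the left of a multiple of \<open>\<omega>\<close>.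
  The theorem is therefore a one-sided Khinchin theorem on the circle. If the curve has a second
  component, its points are translates of \<open>pt z\<close> by a 2-torsion point; their even multiples are those
  of \<open>pt z\<close>, and by monotonicity the even \<open>n\<close> already carry the divergence.

  For the divergence half of Khinchin's theorem, let \<open>N\<close> run through the powers of \<open>2\<close> and place short
  intervals to the right of the fractions with denominator in \<open>(N / 16, N]\<close>. Distinct such fractions
  are \<open>1 / N\<^sup>2\<close> apart, and Dirichlet's approximation theorem yields a positive proportion of the maximal
  number of them in every interval. Hence the unions of these intervals are pairwise quasi-independent,
  and a second moment estimate shows that those beyond any given \<open>N\<close> together cover a fixed
  proportion of every interval, hence almost everything.
\<close>

section \<open>Khinchin's theorem\<close>

text \<open>Full measure comes from uniformity: the proportion that the second moment yields is the
  same for every interval, and an open set filling a fixed proportion of every interval has a null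
  complement. One-sidedness is forced by the inequality for y, since y is negative just to the right
  of a period. It costs nothing, because Dirichlet's theorem serves only to count fractions, and the
  short intervals can then be attached to either side of them. The angle in the parametrization
  removes the singularities of dx / y at infinity and at (e, 0), so that the identity component
  becomes a single smooth circle. On the oval the obstacle is that \<open>pt\<close> does not reach
  its points. There n (P + T) = n P + n T, with T of order two, is proved by induction through
  collinear triples, and the countably many parameters with a multiple at a period, where
  coordinates are lost, are discarded. Odd multiples of an oval point stay on the oval, where x is
  bounded; in the convergent case \<psi> tends to infinity, so they account for only finitely many
  n.\<close>

lemma measure_UN_ge_second_moment:
  fixes A :: "'i \<Rightarrow> 'a set" and t :: real
  assumes X: "finite X" and A: "\<And>x. x \<in> X \<Longrightarrow> A x \<in> fmeasurable M"
  shows "2 * t * (\<Sum>x\<in>X. measure M (A x)) - t\<^sup>2 * (\<Sum>x\<in>X. \<Sum>y\<in>X. measure M (A x \<inter> A y))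
    \<le> measure M (\<Union>x\<in>X. A x)"
proof -
  define f where "f w = (\<Sum>x\<in>X. indicator (A x) w :: real)" for w
  have ind: "integrable M (indicator S :: 'a \<Rightarrow> real)" "(\<integral>w. indicator S w \<partial>M) = measure M S"
    if "S \<in> fmeasurable M" for S
    using that by (auto simp: fmeasurable_def)
  have AA: "A x \<inter> A y \<in> fmeasurable M" if "x \<in> X" "y \<in> X" for x y
    using A that by (simp add: fmeasurable.Int)
  have U: "(\<Union>x\<in>X. A x) \<in> fmeasurable M"
    using A X by (intro fmeasurable.finite_UN) auto
  have f2: "f w ^ 2 = (\<Sum>x\<in>X. \<Sum>y\<in>X. indicator (A x \<inter> A y) w)" for w
    by (simp add: f_def power2_eq_square sum_product indicator_inter_arith)
  have I1: "integrable M f" "integral\<^sup>L M f = (\<Sum>x\<in>X. measure M (A x))"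
    unfolding f_def using A ind by (simp_all add: Bochner_Integration.integral_sum)
  have I2: "integrable M (\<lambda>w. f w ^ 2)"
      "(\<integral>w. f w ^ 2 \<partial>M) = (\<Sum>x\<in>X. \<Sum>y\<in>X. measure M (A x \<inter> A y))"
    unfolding f2 using AA ind by (simp_all add: Bochner_Integration.integral_sum)
  \<comment> \<open>On the union the left side is at most 1 by expanding
    \<open>0 \<le> (1 - t * f w)\<^sup>2\<close>; off the union the counting function
    \<open>f\<close> vanishes. Optimizing \<open>t\<close> after integration gives the Chung-Erdos
    inequality.\<close>
  have "2 * t * f w - t\<^sup>2 * f w ^ 2 \<le> indicator (\<Union>x\<in>X. A x) w" for w
  proof (cases "w \<in> (\<Union>x\<in>X. A x)")
    case True
    have "0 \<le> (1 - t * f w)\<^sup>2" by simp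
    then show ?thesis using True by (simp add: power2_eq_square algebra_simps)
  next
    case False
    then have "f w = 0" by (auto simp: f_def)
    then show ?thesis using False by simp
  qed
  then have "(\<integral>w. 2 * t * f w - t\<^sup>2 * f w ^ 2 \<partial>M) \<le> (\<integral>w. indicator (\<Union>x\<in>X. A x) w \<partial>M)"
    using I1 I2 ind(1)[OF U] by (intro integral_mono) auto
  then show ?thesis using I1 I2 ind[OF U] by simp
qed

lemma card_separated_le:
  fixes F :: "real set"
  assumes F: "F \<subseteq> {a..b}" and d: "0 < d" and ab: "a \<le> b"
    and sep: "\<And>v w. v \<in> F \<Longrightarrow> w \<in> F \<Longrightarrow> v \<noteq> w \<Longrightarrow> d \<le> \<bar>v - w\<bar>"
  shows "finite F" "real (card F) \<le> (b - a) / d + 1"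
proof -
  let ?g = "\<lambda>v. \<lfloor>(v - a) / d\<rfloor>"
  have inj: "inj_on ?g F"
  proof (rule inj_onI, rule ccontr)
    fix v w assume vw: "v \<in> F" "w \<in> F" "?g v = ?g w" "v \<noteq> w"
    then have "\<bar>(v - a) / d - (w - a) / d\<bar> < 1"
      by linarith
    also have "(v - a) / d - (w - a) / d = (v - w) / d" by (simp add: diff_divide_distrib)
    finally have "\<bar>v - w\<bar> < d" using d by (simp add: abs_divide)
    with sep vw show False by fastforce
  qed
  have sub: "?g ` F \<subseteq> {0..\<lfloor>(b - a) / d\<rfloor>}"
    using F d by (fastforce intro!: floor_mono divide_right_mono divide_nonneg_pos)
  show "finite F"
    using inj sub finite_imageD finite_subset by blast
  have "card F = card (?g ` F)" using inj by (simp add: card_image)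
  also have "\<dots> \<le> card {0..\<lfloor>(b - a) / d\<rfloor>}" using sub by (intro card_mono) auto
  also have "\<dots> = nat (\<lfloor>(b - a) / d\<rfloor> + 1)" by simp
  finally have c: "card F \<le> nat (\<lfloor>(b - a) / d\<rfloor> + 1)" .
  have "0 \<le> (b - a) / d" using d ab by simp
  then show "real (card F) \<le> (b - a) / d + 1"
    using c by linarith
qed

section \<open>Separation and number of fractions with bounded denominator\<close>

lemma fractions_separated:
  fixes p q p' q' :: int and N :: real
  assumes "0 < q" "of_int q \<le> N" "0 < q'" "of_int q' \<le> N"
    and ne: "(of_int p / of_int q :: real) \<noteq> of_int p' / of_int q'"
  shows "1 / N\<^sup>2 \<le> \<bar>of_int p / of_int q - of_int p' / of_int q'\<bar>"
proof -
  have "p * q' - p' * q \<noteq> 0"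
  proof
    assume "p * q' - p' * q = 0"
    then have "real_of_int (p * q') = real_of_int (p' * q)" by simp
    then show False using ne assms by (simp add: field_simps)
  qed
  then have "1 \<le> \<bar>real_of_int (p * q' - p' * q)\<bar>" by linarith
  moreover have "real_of_int q * real_of_int q' \<le> N\<^sup>2"
    using assms by (simp add: power2_eq_square mult_mono)
  moreover have "of_int p / of_int q - of_int p' / of_int q'
      = real_of_int (p * q' - p' * q) / (of_int q * of_int q')"
    using assms by (simp add: field_simps)
  ultimately show ?thesis
    using assms by (simp add: abs_mult frac_le)
qed

text \<open>A set of values: a number with several representations counts once, which is what the
  separation \<open>1 / N\<^sup>2\<close> requires. The lower bound keeps the denominator comparable
  with \<open>N\<close>, so Dirichlet's radius \<open>1 / (q N)\<close> is at most
  \<open>16 / N\<^sup>2\<close>, and denominators from late blocks exceed any given bound.\<close>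

definition block_fractions :: "nat \<Rightarrow> real set" where
  "block_fractions N = {of_int p / of_int q | p q. real N / 16 < of_int q \<and> 0 < q \<and> q \<le> int N}"

lemma block_fractions_separated:
  assumes "v \<in> block_fractions N" "w \<in> block_fractions N" "v \<noteq> w"
  shows "1 / (real N)\<^sup>2 \<le> \<bar>v - w\<bar>"
proof -
  obtain p q where v: "v = of_int p / of_int q" "0 < q" "q \<le> int N"
    using assms(1) by (auto simp: block_fractions_def)
  obtain p' q' where w: "w = of_int p' / of_int q'" "0 < q'" "q' \<le> int N"
    using assms(2) by (auto simp: block_fractions_def)
  have "real_of_int q \<le> real N" "real_of_int q' \<le> real N"
    using v(3) w(3) by linarith+
  then show ?thesis unfolding v(1) w(1)
    using v w assms(3) by (intro fractions_separated) auto
qed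

lemma card_block_fractions_le:
  assumes "0 < N" "a \<le> b"
  shows "finite (block_fractions N \<inter> {a..b})"
    "real (card (block_fractions N \<inter> {a..b})) \<le> (b - a) * (real N)\<^sup>2 + 1"
proof -
  have d: "0 < 1 / (real N)\<^sup>2" using assms by simp
  note * = card_separated_le[OF Int_lower2 d assms(2), of "block_fractions N"]
  show "finite (block_fractions N \<inter> {a..b})"
    by (rule *) (auto intro: block_fractions_separated)
  have "real (card (block_fractions N \<inter> {a..b})) \<le> (b - a) / (1 / (real N)\<^sup>2) + 1"
    by (rule *) (auto intro: block_fractions_separated)
  then show "real (card (block_fractions N \<inter> {a..b})) \<le> (b - a) * (real N)\<^sup>2 + 1" by simp
qed

text \<open>The sum enters only after division by \<open>N\<close>, so any bound of smaller order
  than \<open>N\<close> serves in place of the logarithm.\<close>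

lemma sum_inverse_le_sqrt: "(\<Sum>q=1..N. 1 / real q) \<le> 2 * sqrt (real N)"
proof (induction N)
  case (Suc N)
  have "sqrt (real (Suc N)) * (sqrt (real (Suc N)) - sqrt (real N)) * 2 \<ge> 1"
  proof -
    have "2 * (sqrt (real (Suc N)) * sqrt (real N)) \<le> real (Suc N) + real N"
      using arith_geo_mean_sqrt[of "real (Suc N)" "real N"] by (simp add: real_sqrt_mult)
    then show ?thesis by (simp add: algebra_simps)
  qed
  moreover have "sqrt (real (Suc N)) \<le> real (Suc N)"
    by (intro real_le_lsqrt) (auto simp: power2_eq_square)
  moreover have "0 \<le> sqrt (real (Suc N)) - sqrt (real N)" by simp
  ultimately have "1 \<le> real (Suc N) * (sqrt (real (Suc N)) - sqrt (real N)) * 2"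
    by (smt (verit, best) mult_right_mono)
  then have "1 / real (Suc N) \<le> 2 * sqrt (real (Suc N)) - 2 * sqrt (real N)"
    by (simp add: field_simps)
  with Suc show ?case by simp
qed simp

text \<open>
  The points of the interval whose Dirichlet approximation has denominator at most \<open>N / 16\<close> have small
  measure, so the fractions with larger denominator must account for the rest.
\<close>

lemma card_block_fractions_ge:
  assumes "a < b"
  shows "\<forall>\<^sub>F N in sequentially. (b - a) * (real N)\<^sup>2 / 128 \<le> real (card (block_fractions N \<inter> {a..b}))"
proof -
  define L where "L = b - a"
  have L: "0 < L" using assms by (simp add: L_def)
  have "(\<lambda>N. 1 / real N) \<longlonglongrightarrow> 0" by (rule lim_1_over_n)
  then have e1: "\<forall>\<^sub>F N in sequentially. 1 / real N < L / 4"
    using L by (intro order_tendstoD) auto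
  have "(\<lambda>N. 4 / sqrt (real N)) \<longlonglongrightarrow> 0"
    by (intro real_tendsto_divide_at_top[OF tendsto_const]
        filterlim_compose[OF sqrt_at_top filterlim_real_sequentially])
  then have e2: "\<forall>\<^sub>F N in sequentially. 4 / sqrt (real N) < L / 8"
    using L by (intro order_tendstoD) auto
  show ?thesis
    using e1 e2 eventually_gt_at_top[of 0]
  proof eventually_elim
    case (elim N)
    define F where "F = block_fractions N \<inter> {a..b}"
    define Fs where "Fs q = (\<lambda>p. of_int p / real q) ` {p::int. of_int p / real q \<in> {a..b}}" for q
    \<comment> \<open>Shrinking by \<open>L/4\<close> at both ends keeps the Dirichlet approximation
      of a point of \<open>I\<close>, which is at distance at most \<open>1 / N < L / 4\<close>,
      inside \<open>{a..b}\<close>.\<close>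
    define I where "I = {a + L/4..b - L/4}"
    define n where "n = N div 16"
    have finF: "finite F" using card_block_fractions_le assms elim by (simp add: F_def)
    have Fs: "finite (Fs q)" "real (card (Fs q)) \<le> L * real q + 1" if "1 \<le> q" for q
    proof -
      have *: "1 / real q \<le> \<bar>v - w\<bar>" if "v \<in> Fs q" "w \<in> Fs q" "v \<noteq> w" for v w
      proof -
        obtain i j where ij: "v = of_int i / real q" "w = of_int j / real q"
          using \<open>v \<in> Fs q\<close> \<open>w \<in> Fs q\<close> by (auto simp: Fs_def)
        then have "i \<noteq> j" using \<open>v \<noteq> w\<close> by auto
        then have "1 \<le> \<bar>real_of_int i - of_int j\<bar>" by linarith
        then have "1 / real q \<le> \<bar>real_of_int i - of_int j\<bar> / real q" by (simp add: divide_right_mono)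
        then show ?thesis by (simp add: ij abs_divide flip: diff_divide_distrib)
      qed
      have sub: "Fs q \<subseteq> {a..b}" by (auto simp: Fs_def)
      have "0 < 1 / real q" "a \<le> b" using \<open>1 \<le> q\<close> assms by auto
      from card_separated_le[OF sub this *]
      show "finite (Fs q)" "real (card (Fs q)) \<le> L * real q + 1"
        by (auto simp: L_def)
    qed
    \<comment> \<open>\<open>U\<close> collects the approximations with \<open>q > N / 16\<close>,
      using the largest radius that such a \<open>q\<close> allows; \<open>V\<close> collects those
      with \<open>q \<le> N / 16\<close>, with their own radius \<open>1 / (q N)\<close>.\<close>
    define U where "U = (\<Union>v\<in>F. {v - 16 / (real N)\<^sup>2 .. v + 16 / (real N)\<^sup>2})"
    define V where "V = (\<Union>q\<in>{1..n}. \<Union>v\<in>Fs q. {v - 1 / (real q * real N) .. v + 1 / (real q * real N)})"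
    have "I \<subseteq> U \<union> V"
    proof
      fix \<alpha> assume \<alpha>: "\<alpha> \<in> I"
      obtain p q where pq: "0 < q" "q \<le> int N" "\<bar>of_int q * \<alpha> - of_int p\<bar> < 1 / real N"
        using Dirichlet_approx[of N \<alpha>] elim by metis
      define v where "v = of_int p / real_of_int q"
      have "\<bar>\<alpha> - v\<bar> = \<bar>of_int q * \<alpha> - of_int p\<bar> / of_int q"
      proof -
        have "\<alpha> - v = (of_int q * \<alpha> - of_int p) / of_int q"
          using pq by (simp add: v_def field_simps)
        then show ?thesis using pq by simp
      qed
      also have "\<dots> \<le> 1 / real N / of_int q" using pq by (intro divide_right_mono) auto
      finally have d: "\<bar>\<alpha> - v\<bar> \<le> 1 / (of_int q * real N)" by (simp add: field_simps)
      have "1 / (of_int q * real N) \<le> 1 / real N" using pq elim by (simp add: field_simps)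
      then have vab: "v \<in> {a..b}" using d \<alpha> elim by (auto simp: I_def)
      show "\<alpha> \<in> U \<union> V"
      proof (cases "real N / 16 < of_int q")
        case True
        have "1 / (of_int q * real N) \<le> 16 / (real N)\<^sup>2"
          using True pq elim by (simp add: field_simps power2_eq_square)
        moreover have "v \<in> F"
          unfolding F_def block_fractions_def v_def using True pq vab[unfolded v_def] by blast
        ultimately have "\<alpha> \<in> U" using d by (auto simp: U_def intro!: bexI[of _ v])
        then show ?thesis by simp
      next
        case False
        define q' where "q' = nat q"
        have q': "q = int q'" using pq by (simp add: q'_def)
        have "16 * q' \<le> N" using False q' by simp
        then have "q' \<in> {1..n}" using pq q' unfolding n_def by auto
        moreover have "v \<in> Fs q'" using vab by (auto simp: Fs_def v_def q')
        ultimately have "\<alpha> \<in> V" unfolding V_def using d q' by (intro UN_I[of q'] UN_I[of v]) auto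
        then show ?thesis by simp
      qed
    qed
    moreover have ivl: "{u..v} \<in> lmeasurable" for u v :: real
      using lmeasurable_cbox[of u v] by simp
    have UFs: "(\<Union>v\<in>Fs q. {v - \<rho> .. v + \<rho>}) \<in> lmeasurable" if "q \<in> {1..n}" for q \<rho>
      using that by (intro fmeasurable.finite_UN Fs(1) ivl) auto
    have UV: "U \<in> lmeasurable" "V \<in> lmeasurable"
      unfolding U_def V_def by (intro fmeasurable.finite_UN finF UFs ivl finite_atLeastAtMost; assumption)+
    ultimately have "measure lebesgue I \<le> measure lebesgue (U \<union> V)"
      by (intro measure_mono_fmeasurable fmeasurable.Un fmeasurableD[OF ivl]) (auto simp: I_def)
    also have "\<dots> \<le> measure lebesgue U + measure lebesgue V"
      using UV by (intro measure_Un_le) auto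
    finally have mI: "measure lebesgue I \<le> measure lebesgue U + measure lebesgue V" .
    then have m: "L / 2 \<le> measure lebesgue U + measure lebesgue V"
    proof -
      have "b - a = L" by (simp add: L_def)
      then have "measure lebesgue I = L / 2" using L by (simp add: I_def)
      then show ?thesis using mI by simp
    qed
    have "measure lebesgue U \<le> (\<Sum>v\<in>F. measure lebesgue {v - 16 / (real N)\<^sup>2 .. v + 16 / (real N)\<^sup>2})"
      unfolding U_def using finF by (intro measure_UNION_le) auto
    also have "\<dots> = real (card F) * (32 / (real N)\<^sup>2)" by simp
    finally have mU: "measure lebesgue U \<le> real (card F) * (32 / (real N)\<^sup>2)" .
    have "measure lebesgue V \<le> (\<Sum>q\<in>{1..n}. measure lebesgue (\<Union>v\<in>Fs q. {v - 1 / (real q * real N) .. v + 1 / (real q * real N)}))"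
      unfolding V_def by (intro measure_UNION_le fmeasurableD UFs finite_atLeastAtMost)
    also have "\<dots> \<le> (\<Sum>q\<in>{1..n}. 2 * L / real N + 2 / real N * (1 / real q))"
    proof (rule sum_mono)
      fix q assume q: "q \<in> {1..n}"
      have "measure lebesgue (\<Union>v\<in>Fs q. {v - 1 / (real q * real N) .. v + 1 / (real q * real N)})
         \<le> (\<Sum>v\<in>Fs q. measure lebesgue {v - 1 / (real q * real N) .. v + 1 / (real q * real N)})"
        using Fs q by (intro measure_UNION_le) auto
      also have "\<dots> = real (card (Fs q)) * (2 / (real q * real N))" by simp
      also have "\<dots> \<le> (L * real q + 1) * (2 / (real q * real N))"
        using Fs(2)[of q] q by (intro mult_right_mono) auto
      also have "\<dots> = 2 * L / real N + 2 / real N * (1 / real q)"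
        using q elim by (simp add: field_simps)
      finally show "measure lebesgue (\<Union>v\<in>Fs q. {v - 1 / (real q * real N) .. v + 1 / (real q * real N)})
         \<le> 2 * L / real N + 2 / real N * (1 / real q)" .
    qed
    also have "\<dots> = real n * (2 * L / real N) + 2 / real N * (\<Sum>q=1..n. 1 / real q)"
      by (simp add: sum.distrib sum_distrib_left)
    \<comment> \<open>This is where 16 is chosen: the first summand becomes \<open>L / 8\<close>,
      and the second is eventually below \<open>L / 8\<close>. So \<open>V\<close> covers at most
      half of \<open>I\<close>, leaving \<open>L / 4\<close> to \<open>U\<close>, whose intervals
      have length \<open>32 / N\<^sup>2\<close>; hence the constant 128 = 4 * 32.\<close>
    also have "\<dots> \<le> real N / 16 * (2 * L / real N) + 2 / real N * (2 * sqrt (real N))"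
    proof (intro add_mono mult_left_mono mult_right_mono)
      show "real n \<le> real N / 16" unfolding n_def by linarith
      have "(\<Sum>q=1..n. 1 / real q) \<le> 2 * sqrt (real n)" by (rule sum_inverse_le_sqrt)
      also have "\<dots> \<le> 2 * sqrt (real N)" by (simp add: n_def)
      finally show "(\<Sum>q=1..n. 1 / real q) \<le> 2 * sqrt (real N)" .
    qed (use L in auto)
    also have "2 / real N * (2 * sqrt (real N)) = 4 / sqrt (real N)"
      using elim by (simp add: field_simps)
    finally have mV: "measure lebesgue V \<le> L / 8 + L / 8" using elim by simp
    have "L / 4 \<le> real (card F) * (32 / (real N)\<^sup>2)" using m mU mV by simp
    then show ?case using elim by (simp add: field_simps F_def L_def)
  qed
qed

text \<open>If a bounded part \<open>C\<close> of the complement had positive measure, it could be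
  covered by non-overlapping intervals of total length at most |C| + e. Each of them is filled by
  \<open>C\<close> to a proportion of at most 1 - c, so |C| \<le> (1 - c) (|C| + e), which fails for
  e = c |C| / 2.\<close>

lemma negligible_if_uniform_density:
  fixes U :: "real set"
  assumes U: "open U" and c: "0 < c"
    and dens: "\<And>a b. a < b \<Longrightarrow> c * (b - a) \<le> measure lebesgue (U \<inter> {a..b})"
  shows "negligible (- U)"
proof -
  have "negligible (- U \<inter> cbox u v)" for u v
  proof (cases "u < v")
    case False
    then have "- U \<inter> cbox u v \<subseteq> {u}" by auto
    then show ?thesis using negligible_subset negligible_sing by blast
  next
    case uv: True
    define C where "C = - U \<inter> cbox u v"
    have Cm: "C \<in> lmeasurable"
      unfolding C_def using U by (intro lmeasurable_compact closed_Int_compact compact_cbox) auto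
    show ?thesis
    proof (rule ccontr)
      assume "\<not> ?thesis"
      then have pos: "0 < measure lebesgue C"
        using Cm by (metis C_def negligible_iff_measure0 zero_less_measure_iff)
      have c1: "c \<le> 1"
      proof -
        have "c * (1 - 0) \<le> measure lebesgue (U \<inter> {0..1})" by (rule dens) simp
        also have "\<dots> \<le> measure lebesgue {0..1::real}"
          using U by (intro measure_mono_fmeasurable) auto
        finally show ?thesis by simp
      qed
      define e where "e = c * measure lebesgue C / 2"
      have e: "0 < e" using pos c by (simp add: e_def)
      have Csub: "C \<subseteq> cbox u v" by (simp add: C_def)
      have "\<exists>D. countable D \<and> (\<forall>K\<in>D. \<exists>c d. K = cbox c d \<and> K \<noteq> {}) \<and>
          pairwise (\<lambda>A B. interior A \<inter> interior B = {}) D \<and> C \<subseteq> \<Union>D \<and> \<Union>D \<in> lmeasurable \<and>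
          measure lebesgue (\<Union>D) \<le> measure lebesgue C + e"
      proof (rule measurable_outer_intervals_bounded[OF Cm Csub e])
        fix D assume D: "countable D"
          "\<And>K. K \<in> D \<Longrightarrow> K \<subseteq> cbox u v \<and> K \<noteq> {} \<and> (\<exists>c d. K = cbox c d)"
          "pairwise (\<lambda>A B. interior A \<inter> interior B = {}) D"
          "C \<subseteq> \<Union>D" "\<Union>D \<in> lmeasurable" "measure lebesgue (\<Union>D) \<le> measure lebesgue C + e"
        show ?thesis
          by (intro exI[of _ D] conjI ballI D) (use D(2) in blast)
      qed
      then obtain D where D: "countable D" "\<And>K. K \<in> D \<Longrightarrow> \<exists>c d. K = cbox c d \<and> K \<noteq> {}"
          "pairwise (\<lambda>A B. interior A \<inter> interior B = {}) D"
          "C \<subseteq> \<Union>D" "\<Union>D \<in> lmeasurable" "measure lebesgue (\<Union>D) \<le> measure lebesgue C + e"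
        by metis
      \<comment> \<open>The covering intervals may share boundary points. Passing to the interiors
        makes them disjoint, so that countable additivity applies, and loses only a null
        set.\<close>
      have disj: "disjoint_family_on interior D"
        using D(3) by (auto simp: disjoint_family_on_def pairwise_def)
      have disj': "disjoint_family_on (\<lambda>K. C \<inter> interior K) D"
        using disj by (auto simp: disjoint_family_on_def)
      have neg: "negligible (\<Union>K\<in>D. frontier K)"
      proof (rule negligible_countable_Union)
        show "countable (frontier ` D)" using D(1) by simp
        show "negligible S" if S: "S \<in> frontier ` D" for S
        proof -
          obtain K where K: "K \<in> D" "S = frontier K" using S by blast
          then have "convex K" using D(2) convex_box(1) by metis
          then show ?thesis using K(2) negligible_convex_frontier by simp
        qed
      qed
      have Cs: "C \<in> sets lebesgue" using Cm by blast
      have UCs: "(\<Union>K\<in>D. C \<inter> interior K) \<in> sets lebesgue"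
        using D(1) Cs by (intro sets.countable_UN'') auto
      have "emeasure lebesgue C \<le> emeasure lebesgue ((\<Union>K\<in>D. C \<inter> interior K) \<union> (\<Union>K\<in>D. frontier K))"
      proof (rule emeasure_mono)
        show "C \<subseteq> (\<Union>K\<in>D. C \<inter> interior K) \<union> (\<Union>K\<in>D. frontier K)"
        proof
          fix x assume x: "x \<in> C"
          then obtain K where "K \<in> D" "x \<in> K" using D(4) by blast
          then show "x \<in> (\<Union>K\<in>D. C \<inter> interior K) \<union> (\<Union>K\<in>D. frontier K)"
            using x closure_subset[of K] by (auto simp: frontier_def)
        qed
        show "(\<Union>K\<in>D. C \<inter> interior K) \<union> (\<Union>K\<in>D. frontier K) \<in> sets lebesgue"
          by (intro sets.Un UCs negligible_imp_sets[OF neg])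
      qed
      also have "\<dots> = emeasure lebesgue (\<Union>K\<in>D. C \<inter> interior K)"
        using neg by (intro emeasure_Un_null_set UCs) (simp add: negligible_iff_null_sets)
      also have "\<dots> = (\<integral>\<^sup>+K. emeasure lebesgue (C \<inter> interior K) \<partial>count_space D)"
        using D(1) disj' Cs by (intro emeasure_UN_countable) auto
      also have "\<dots> \<le> (\<integral>\<^sup>+K. ennreal (1 - c) * emeasure lebesgue (interior K) \<partial>count_space D)"
      proof (rule nn_integral_mono)
        fix K assume "K \<in> space (count_space D)"
        then have "K \<in> D" by simp
        from D(2)[OF this] obtain a b where K: "K = cbox a b" "K \<noteq> {}" by metis
        show "emeasure lebesgue (C \<inter> interior K) \<le> ennreal (1 - c) * emeasure lebesgue (interior K)"
        proof (cases "a < b")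
          case False
          then show ?thesis using K by (simp add: interior_cbox)
        next
          case True
          have "emeasure lebesgue (C \<inter> interior K) \<le> emeasure lebesgue ({a..b} - U)"
            using U K by (intro emeasure_mono) (auto simp: C_def interior_cbox)
          also have "\<dots> = ennreal (measure lebesgue ({a..b} - U))"
            using U by (intro emeasure_eq_measure2 fmeasurableI2[OF lmeasurable_cbox[of a b]]) auto
          also have "measure lebesgue ({a..b} - U) = (b - a) - measure lebesgue (U \<inter> {a..b})"
          proof -
            have "measure lebesgue ({a..b} - (U \<inter> {a..b})) = measure lebesgue {a..b} - measure lebesgue (U \<inter> {a..b})"
              using U by (intro measurable_measure_Diff) auto
            moreover have "{a..b} - (U \<inter> {a..b}) = {a..b} - U" by auto
            ultimately show ?thesis using True by simp
          qed
          also have "ennreal ((b - a) - measure lebesgue (U \<inter> {a..b})) \<le> ennreal ((1 - c) * (b - a))"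
            using dens[OF True] by (intro ennreal_leI) (simp add: algebra_simps)
          also have "\<dots> = ennreal (1 - c) * emeasure lebesgue (interior K)"
            using True K c1 by (simp add: interior_cbox ennreal_mult)
          finally show ?thesis .
        qed
      qed
      also have "\<dots> = ennreal (1 - c) * (\<integral>\<^sup>+K. emeasure lebesgue (interior K) \<partial>count_space D)"
        by (rule nn_integral_cmult) auto
      also have "(\<integral>\<^sup>+K. emeasure lebesgue (interior K) \<partial>count_space D) = emeasure lebesgue (\<Union>K\<in>D. interior K)"
        using D(1) disj by (intro emeasure_UN_countable[symmetric]) auto
      also have "ennreal (1 - c) * emeasure lebesgue (\<Union>K\<in>D. interior K) \<le> ennreal (1 - c) * emeasure lebesgue (\<Union>D)"
        using D(5) interior_subset by (intro mult_left_mono emeasure_mono) auto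
      also have "\<dots> = ennreal ((1 - c) * measure lebesgue (\<Union>D))"
        using D(5) c1 by (simp add: emeasure_eq_measure2 ennreal_mult)
      finally have "ennreal (measure lebesgue C) \<le> ennreal ((1 - c) * measure lebesgue (\<Union>D))"
        using Cm by (simp add: emeasure_eq_measure2)
      then have "measure lebesgue C \<le> (1 - c) * measure lebesgue (\<Union>D)"
        using c1 by (simp add: ennreal_le_iff)
      also have "\<dots> \<le> (1 - c) * (measure lebesgue C + e)"
        using D(6) c1 by (intro mult_left_mono) auto
      finally have "c * measure lebesgue C \<le> e - c * e" by (simp add: algebra_simps)
      moreover have "0 < c * e" using c e by simp
      moreover have "2 * e = c * measure lebesgue C" by (simp add: e_def)
      ultimately show False using e by linarith
    qed
  qed
  then show ?thesis
    by (subst negligible_on_intervals) auto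
qed

section \<open>Quasi-independence of the blocks and the divergence half\<close>

lemma sum_powers_four_le: "(\<Sum>j\<le>k. 4 ^ j) \<le> (2::real) * 4 ^ k"
proof (induction k)
  case (Suc k)
  have "(0::real) \<le> 4 ^ k" by simp
  with Suc show ?case unfolding sum.atMost_Suc power_Suc by linarith
qed simp

text \<open>Only the blocks from \<open>m'\<close> up to the first partial sum \<open>S\<close> of
  \<open>r\<close> that reaches 1 are used. As \<open>r k \<le> 1\<close>, \<open>S\<close> lies in
  [1, 2], so the first moment is at least L / 128 and the second at most 40 L, independently of
  where the blocks start. The quotient (L / 128)^2 / (40 L) is L / 655360. Here L is half the length
  of \<open>{a..b}\<close>: left endpoints are taken from the left half, so the intervals do not
  leave \<open>{a..b}\<close>.\<close>

lemma measure_block_intervals_ge: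
  fixes r :: "nat \<Rightarrow> real"
  assumes r0: "\<And>k. 0 < r k" and r1: "\<And>k. r k \<le> 1" and div: "\<not> summable r" and ab: "a < b"
  shows "(b - a) / 1310720 \<le>
    measure lebesgue ((\<Union>k\<in>{m..}. \<Union>v\<in>block_fractions (2 ^ k). {v<..<v + r k / 4 ^ k}) \<inter> {a..b})"
proof -
  define L where "L = (b - a) / 2"
  have L: "0 < L" using ab by (simp add: L_def)
  define F where "F k = block_fractions (2 ^ k) \<inter> {a..a + L}" for k
  define \<rho> where "\<rho> k = r k / 4 ^ k" for k
  have four: "(real (2 ^ k))\<^sup>2 = 4 ^ k" for k
    by (simp add: power2_eq_square flip: power_mult_distrib)
  have \<rho>0: "0 < \<rho> k" for k using r0[of k] by (simp add: \<rho>_def)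
  have \<rho>4: "\<rho> k * 4 ^ k = r k" for k by (simp add: \<rho>_def)
  have finF: "finite (F k)" and card_le: "real (card (F k)) \<le> L * 4 ^ k + 1" for k
    using card_block_fractions_le[of "2 ^ k" a "a + L"] L unfolding F_def four by auto
  obtain N0 where N0: "\<And>N. N \<ge> N0 \<Longrightarrow>
      L * (real N)\<^sup>2 / 128 \<le> real (card (block_fractions N \<inter> {a..a + L}))"
    using card_block_fractions_ge[of a "a + L"] L unfolding eventually_sequentially by auto
  obtain k1 :: nat where k1: "1 / L < k1" using reals_Archimedean2 by blast
  \<comment> \<open>From \<open>m'\<close> on the lower bound for the number of fractions holds and
    \<open>1 \<le> L * 4 ^ k\<close>. The latter absorbs the \<open>+ 1\<close> of the upper bound
    into a factor 2 and gives \<open>\<rho> k \<le> L\<close>.\<close>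
  define m' where "m' = max m (max N0 k1)"
  have big: "k < 2 ^ k" for k :: nat by (rule less_exp)
  have card_ge: "L * 4 ^ k / 128 \<le> real (card (F k))" if "m' \<le> k" for k
  proof -
    have "N0 \<le> k" using that by (simp add: m'_def)
    then have "N0 \<le> 2 ^ k" using big[of k] by linarith
    from N0[OF this] show ?thesis unfolding F_def four by simp
  qed
  have L4: "1 \<le> L * 4 ^ k" if "m' \<le> k" for k
  proof -
    have "1 / L < real k" using k1 that by (simp add: m'_def)
    also have "real k < 2 ^ k" using big[of k] by (metis of_nat_less_iff of_nat_numeral of_nat_power)
    also have "(2::real) ^ k \<le> 4 ^ k" by (intro power_mono) auto
    finally show ?thesis using L by (simp add: field_simps)
  qed
  have "\<exists>n. 1 \<le> sum r {m'..<n}"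
  proof (rule ccontr)
    assume "\<nexists>n. 1 \<le> sum r {m'..<n}"
    then have less: "sum r {m'..<n} < 1" for n by (meson not_le)
    have "summable (\<lambda>k. r (k + m'))"
    proof (rule summableI_nonneg_bounded)
      show "sum (\<lambda>k. r (k + m')) {..<n} \<le> 1" for n
        using less[of "n + m'"] sum.shift_bounds_nat_ivl[of r 0 m' n] by (simp add: lessThan_atLeast0)
    qed (use r0 less_imp_le in blast)
    then show False using div summable_iff_shift by blast
  qed
  then have n: "1 \<le> sum r {m'..<LEAST n. 1 \<le> sum r {m'..<n}}" by (rule LeastI_ex)
  define n where "n = (LEAST n. 1 \<le> sum r {m'..<n})"
  note n = n[folded n_def]
  have min: "sum r {m'..<i} < 1" if "i < n" for i
    using not_less_Least[OF that[unfolded n_def]] by simp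
  define S where "S = sum r {m'..<n}"
  have S1: "1 \<le> S" using n by (simp add: S_def)
  have S2: "S \<le> 2"
  proof -
    have "m' < n" using n by (cases "m' < n") auto
    then obtain i where i: "n = Suc i" "m' \<le> i" by (metis less_Suc_eq_le not0_implies_Suc not_less_zero)
    then have "S = sum r {m'..<i} + r i" by (simp add: S_def)
    then show ?thesis using min[of i] r1[of i] i by simp
  qed
  define X where "X = Sigma {m'..<n} F"
  define A where "A x = {snd x<..<snd x + \<rho> (fst x)}" for x :: "nat \<times> real"
  have finX: "finite X" using finF by (simp add: X_def)
  have sumX: "(\<Sum>x\<in>X. f (fst x) (snd x)) = (\<Sum>k\<in>{m'..<n}. \<Sum>v\<in>F k. f k v)" for f :: "nat \<Rightarrow> real \<Rightarrow> real"
    unfolding X_def using finF by (subst sum.Sigma) (auto simp: case_prod_beta)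
  have Am: "A x \<in> lmeasurable" for x
    using lmeasurable_box[of "snd x" "snd x + \<rho> (fst x)"] by (simp add: A_def)
  have mA: "measure lebesgue {v<..<v + \<rho> k} = \<rho> k" for v k
    using \<rho>0[of k] by simp
  have mean: "L / 128 \<le> (\<Sum>x\<in>X. measure lebesgue (A x))"
  proof -
    have "L / 128 \<le> L / 128 * S" using L S1 by simp
    also have "\<dots> = (\<Sum>k\<in>{m'..<n}. L * 4 ^ k / 128 * \<rho> k)"
      unfolding S_def sum_distrib_left by (intro sum.cong) (auto simp: \<rho>_def)
    also have "\<dots> \<le> (\<Sum>k\<in>{m'..<n}. real (card (F k)) * \<rho> k)"
      using card_ge \<rho>0 less_imp_le by (intro sum_mono mult_right_mono) auto
    also have "\<dots> = (\<Sum>k\<in>{m'..<n}. \<Sum>v\<in>F k. measure lebesgue {v<..<v + \<rho> k})"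
      unfolding mA by simp
    also have "\<dots> = (\<Sum>x\<in>X. measure lebesgue (A x))"
      unfolding A_def by (rule sumX[symmetric])
    finally show ?thesis .
  qed
  define T where "T j k = (\<Sum>v\<in>F j. \<Sum>w\<in>F k. measure lebesgue ({v<..<v + \<rho> j} \<inter> {w<..<w + \<rho> k}))" for j k
  have T_sym: "T j k = T k j" for j k
    unfolding T_def by (subst sum.swap) (simp add: Int_commute)
  \<comment> \<open>An interval of length \<open>\<rho> j\<close> meets at most
    \<open>\<rho> j * 4 ^ k + 2\<close> intervals of the finer block, by separation. The first term
    produces the product \<open>r j * r k\<close> expected of independent events; the 2, due to the
    ends, produces an error that decays geometrically in \<open>k - j\<close> and therefore sums to
    a multiple of \<open>S\<close>.\<close>
  have T_le: "T j k \<le> 2 * L * (r j * r k + 2 * (4 ^ j / 4 ^ k * r k))" if "m' \<le> j" "j \<le> k" for j k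
  proof -
    have inner: "(\<Sum>w\<in>F k. measure lebesgue ({v<..<v + \<rho> j} \<inter> {w<..<w + \<rho> k})) \<le> (\<rho> j * 4 ^ k + 2) * \<rho> k"
      for v
    proof -
      define W where "W = block_fractions (2 ^ k) \<inter> {v - \<rho> k..v + \<rho> j}"
      have W: "finite W" "real (card W) \<le> (\<rho> j + \<rho> k) * 4 ^ k + 1"
        using card_block_fractions_le[of "2 ^ k" "v - \<rho> k" "v + \<rho> j"] \<rho>0[of j] \<rho>0[of k]
        unfolding W_def four by auto
      have "(\<Sum>w\<in>F k. measure lebesgue ({v<..<v + \<rho> j} \<inter> {w<..<w + \<rho> k}))
          = (\<Sum>w\<in>F k \<inter> W. measure lebesgue ({v<..<v + \<rho> j} \<inter> {w<..<w + \<rho> k}))"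
      proof (rule sum.mono_neutral_right)
        show "\<forall>w\<in>F k - F k \<inter> W. measure lebesgue ({v<..<v + \<rho> j} \<inter> {w<..<w + \<rho> k}) = 0"
        proof
          fix w assume "w \<in> F k - F k \<inter> W"
          then have "{v<..<v + \<rho> j} \<inter> {w<..<w + \<rho> k} = {}" by (auto simp: W_def F_def)
          then show "measure lebesgue ({v<..<v + \<rho> j} \<inter> {w<..<w + \<rho> k}) = 0" by simp
        qed
      qed (use finF in auto)
      also have "\<dots> \<le> (\<Sum>w\<in>F k \<inter> W. \<rho> k)"
      proof (rule sum_mono)
        fix w
        have "measure lebesgue ({v<..<v + \<rho> j} \<inter> {w<..<w + \<rho> k}) \<le> measure lebesgue {w<..<w + \<rho> k}"
          using Am[of "(k, w)"] by (intro measure_mono_fmeasurable) (auto simp: A_def)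
        then show "measure lebesgue ({v<..<v + \<rho> j} \<inter> {w<..<w + \<rho> k}) \<le> \<rho> k" unfolding mA .
      qed
      also have "\<dots> = real (card (F k \<inter> W)) * \<rho> k" by simp
      also have "\<dots> \<le> real (card W) * \<rho> k"
        using W(1) \<rho>0[of k] by (intro mult_right_mono) (auto intro: card_mono)
      also have "\<dots> \<le> ((\<rho> j + \<rho> k) * 4 ^ k + 1) * \<rho> k"
        using W(2) \<rho>0[of k] by (intro mult_right_mono) auto
      also have "\<dots> \<le> (\<rho> j * 4 ^ k + 2) * \<rho> k"
        using \<rho>0[of k] \<rho>4[of k] r1[of k] by (intro mult_right_mono) (auto simp: distrib_right)
      finally show ?thesis .
    qed
    have "T j k \<le> (\<Sum>v\<in>F j. (\<rho> j * 4 ^ k + 2) * \<rho> k)"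
      unfolding T_def by (intro sum_mono inner)
    also have "\<dots> = real (card (F j)) * ((\<rho> j * 4 ^ k + 2) * \<rho> k)" by simp
    also have "\<dots> \<le> (2 * L * 4 ^ j) * ((\<rho> j * 4 ^ k + 2) * \<rho> k)"
      using card_le[of j] L4[of j] that \<rho>0[of j] \<rho>0[of k] by (intro mult_right_mono) auto
    also have "\<dots> = 2 * L * (r j * r k + 2 * (4 ^ j / 4 ^ k * r k))"
      by (simp add: \<rho>_def field_simps)
    finally show ?thesis .
  qed
  define B where "B j k = (if j \<le> k then 4 ^ j / 4 ^ k * r k else 0)" for j k
  have B0: "0 \<le> B j k" for j k using r0[of k] by (simp add: B_def)
  have T_le': "T j k \<le> 2 * L * (r j * r k + 2 * B j k + 2 * B k j)" if "m' \<le> j" "m' \<le> k" for j k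
  proof (cases "j \<le> k")
    case True
    have "T j k \<le> 2 * L * (r j * r k + 2 * B j k)" using T_le[of j k] that True by (simp add: B_def)
    also have "\<dots> \<le> 2 * L * (r j * r k + 2 * B j k + 2 * B k j)"
      using L B0[of k j] by (intro mult_left_mono) auto
    finally show ?thesis .
  next
    case False
    have "T j k \<le> 2 * L * (r k * r j + 2 * B k j)" using T_le[of k j] that False by (simp add: B_def T_sym)
    also have "\<dots> \<le> 2 * L * (r j * r k + 2 * B j k + 2 * B k j)"
      using L B0[of j k] by (intro mult_left_mono) auto
    finally show ?thesis .
  qed
  have B_sum: "(\<Sum>j\<in>{m'..<n}. B j k) \<le> 2 * r k" for k
  proof -
    have "(\<Sum>j\<in>{m'..<n}. B j k) = (\<Sum>j\<in>{m'..<n} \<inter> {..k}. B j k)"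
      by (intro sum.mono_neutral_right) (auto simp: B_def)
    also have "\<dots> \<le> (\<Sum>j\<le>k. B j k)" using B0 by (intro sum_mono2) auto
    also have "\<dots> = (\<Sum>j\<le>k. 4 ^ j) / 4 ^ k * r k"
      by (simp add: B_def sum_distrib_right sum_divide_distrib)
    also have "\<dots> \<le> 2 * r k"
      using sum_powers_four_le[of k] r0[of k] by (intro mult_right_mono) (auto simp: field_simps)
    finally show ?thesis .
  qed
  have BB: "(\<Sum>j\<in>{m'..<n}. \<Sum>k\<in>{m'..<n}. B k j) \<le> 2 * S"
    unfolding S_def sum_distrib_left using B_sum by (intro sum_mono) auto
  have second: "(\<Sum>x\<in>X. \<Sum>y\<in>X. measure lebesgue (A x \<inter> A y)) \<le> 40 * L"
  proof -
    have "(\<Sum>x\<in>X. \<Sum>y\<in>X. measure lebesgue (A x \<inter> A y))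
        = (\<Sum>j\<in>{m'..<n}. \<Sum>v\<in>F j. \<Sum>k\<in>{m'..<n}. \<Sum>w\<in>F k.
            measure lebesgue ({v<..<v + \<rho> j} \<inter> {w<..<w + \<rho> k}))"
      unfolding A_def
      using sumX[of "\<lambda>j v. \<Sum>y\<in>X. measure lebesgue ({v<..<v + \<rho> j} \<inter> {snd y<..<snd y + \<rho> (fst y)})"]
        sumX[of "\<lambda>k w. measure lebesgue ({v<..<v + \<rho> j} \<inter> {w<..<w + \<rho> k})" for j v]
      by (simp only:)
    also have "\<dots> = (\<Sum>j\<in>{m'..<n}. \<Sum>k\<in>{m'..<n}. T j k)"
      unfolding T_def by (intro sum.cong refl sum.swap)
    also have "\<dots> \<le> (\<Sum>j\<in>{m'..<n}. \<Sum>k\<in>{m'..<n}. 2 * L * (r j * r k + 2 * B j k + 2 * B k j))"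
      by (intro sum_mono T_le') auto
    also have "\<dots> = 2 * L * (S * S + 2 * (\<Sum>j\<in>{m'..<n}. \<Sum>k\<in>{m'..<n}. B j k)
        + 2 * (\<Sum>j\<in>{m'..<n}. \<Sum>k\<in>{m'..<n}. B k j))"
      by (simp add: S_def sum_product sum.distrib flip: sum_distrib_left)
    also have "(\<Sum>j\<in>{m'..<n}. \<Sum>k\<in>{m'..<n}. B j k) = (\<Sum>j\<in>{m'..<n}. \<Sum>k\<in>{m'..<n}. B k j)"
      by (rule sum.swap)
    also have "2 * L * (S * S + 2 * (\<Sum>j\<in>{m'..<n}. \<Sum>k\<in>{m'..<n}. B k j) + 2 * (\<Sum>j\<in>{m'..<n}. \<Sum>k\<in>{m'..<n}. B k j))
        \<le> 2 * L * (2 * 2 + 2 * (2 * 2) + 2 * (2 * 2))"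
      using L BB S1 S2 by (intro mult_left_mono add_mono mult_mono) auto
    finally show ?thesis by simp
  qed
  \<comment> \<open>The optimal parameter, the quotient of the bounds \<open>L / 128\<close> and
    \<open>40 * L\<close> for the two moments.\<close>
  define t :: real where "t = 1 / 5120"
  have "L / 655360 = 2 * t * (L / 128) - t\<^sup>2 * (40 * L)"
    by (simp add: t_def power2_eq_square)
  also have "\<dots> \<le> 2 * t * (\<Sum>x\<in>X. measure lebesgue (A x))
      - t\<^sup>2 * (\<Sum>x\<in>X. \<Sum>y\<in>X. measure lebesgue (A x \<inter> A y))"
    using mean second by (intro diff_mono mult_left_mono) (auto simp: t_def)
  also have "\<dots> \<le> measure lebesgue (\<Union>x\<in>X. A x)"
    by (rule measure_UN_ge_second_moment[OF finX Am])
  also have "\<dots> \<le> measure lebesgue ((\<Union>k\<in>{m..}. \<Union>v\<in>block_fractions (2 ^ k). {v<..<v + r k / 4 ^ k}) \<inter> {a..b})"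
  proof (rule measure_mono_fmeasurable)
    show "(\<Union>x\<in>X. A x) \<subseteq> (\<Union>k\<in>{m..}. \<Union>v\<in>block_fractions (2 ^ k). {v<..<v + r k / 4 ^ k}) \<inter> {a..b}"
    proof
      fix y assume "y \<in> (\<Union>x\<in>X. A x)"
      then obtain k v where kv: "m' \<le> k" "v \<in> F k" "v < y" "y < v + \<rho> k"
        by (auto simp: X_def A_def)
      have "\<rho> k * 4 ^ k \<le> L * 4 ^ k" using L4[OF kv(1)] r1[of k] \<rho>4[of k] by simp
      then have "\<rho> k \<le> L" by simp
      moreover have "b = a + 2 * L" by (simp add: L_def field_simps)
      ultimately have "y \<in> {a..b}" using kv by (auto simp: F_def)
      moreover have "m \<le> k" "v \<in> block_fractions (2 ^ k)" using kv by (auto simp: m'_def F_def)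
      ultimately show "y \<in> (\<Union>k\<in>{m..}. \<Union>v\<in>block_fractions (2 ^ k). {v<..<v + r k / 4 ^ k}) \<inter> {a..b}"
        using kv by (auto simp: \<rho>_def)
    qed
    show "(\<Union>x\<in>X. A x) \<in> sets lebesgue" by (intro sets.finite_UN finX fmeasurableD Am)
    have "open (\<Union>k\<in>{m..}. \<Union>v\<in>block_fractions (2 ^ k). {v<..<v + r k / 4 ^ k})"
      by (intro open_UN ballI open_greaterThanLessThan)
    then show "(\<Union>k\<in>{m..}. \<Union>v\<in>block_fractions (2 ^ k). {v<..<v + r k / 4 ^ k}) \<inter> {a..b} \<in> lmeasurable"
      by (intro fmeasurableI2[OF lmeasurable_cbox[of a b]]) auto
  qed
  finally show ?thesis by (simp add: L_def)
qed

text \<open>For a denominator q at most 2^k, monotonicity gives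
  \<open>\<delta> (2 ^ k) \<le> \<delta> q\<close>. So a point within \<open>r k / 4 ^ k\<close> to
  the right of p / q satisfies the inequality for q as soon as
  \<open>r k \<le> 2 ^ k * \<delta> (2 ^ k)\<close>. Cauchy condensation carries the divergence over
  to \<open>r\<close>; the cap at 1 is what the second moment estimate asks for.\<close>

lemma khinchin_one_sided:
  fixes \<delta> :: "nat \<Rightarrow> real"
  assumes pos: "\<And>n. 1 \<le> n \<Longrightarrow> 0 < \<delta> n" and mono: "\<And>m n. 1 \<le> m \<Longrightarrow> m \<le> n \<Longrightarrow> \<delta> n \<le> \<delta> m"
    and div: "\<not> summable (\<lambda>n. \<delta> (Suc n))"
  shows "negligible {\<alpha>::real. finite {q::nat. 1 \<le> q \<and> (\<exists>p::int. 0 < real q * \<alpha> - of_int p \<and> real q * \<alpha> - of_int p < \<delta> q)}}"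
proof -
  define r where "r k = min (2 ^ k * \<delta> (2 ^ k)) 1" for k
  have r0: "0 < r k" and r1: "r k \<le> 1" for k using pos[of "2 ^ k"] by (auto simp: r_def)
  have div_r: "\<not> summable r"
  proof
    assume r: "summable r"
    \<comment> \<open>If \<open>r\<close> were summable, it would tend to 0, the cap would
      eventually be inactive, and condensation would apply to \<delta> itself.\<close>
    then have "r \<longlonglongrightarrow> 0" by (rule summable_LIMSEQ_zero)
    then have "\<forall>\<^sub>F k in sequentially. r k < 1" by (rule order_tendstoD) simp
    then have ev: "\<forall>\<^sub>F k in sequentially. r k = 2 ^ k * \<delta> (2 ^ k)"
      by eventually_elim (auto simp: r_def)
    \<comment> \<open>Nothing is known about \<open>\<delta> 0\<close>, so it is replaced by
      \<open>\<delta> 1\<close>.\<close>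
    define \<delta>' where "\<delta>' n = \<delta> (max 1 n)" for n
    have "summable (\<lambda>k. 2 ^ k * \<delta>' (2 ^ k))"
      using r summable_cong[OF ev] by (simp add: \<delta>'_def max_def)
    moreover have "summable \<delta>' \<longleftrightarrow> summable (\<lambda>k. 2 ^ k * \<delta>' (2 ^ k))"
      using pos mono by (intro condensation_test) (auto simp: \<delta>'_def less_imp_le)
    ultimately have "summable (\<lambda>n. \<delta>' (Suc n))" by (simp add: summable_Suc_iff)
    then show False using div by (simp add: \<delta>'_def)
  qed
  define U where "U m = (\<Union>k\<in>{m..}. \<Union>v\<in>block_fractions (2 ^ k). {v<..<v + r k / 4 ^ k})" for m
  have "negligible (- U m)" for m
  proof (rule negligible_if_uniform_density)
    show "open (U m)" unfolding U_def by (intro open_UN ballI open_greaterThanLessThan)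
    show "1 / 1310720 * (b - a) \<le> measure lebesgue (U m \<inter> {a..b})" if "a < b" for a b
      using measure_block_intervals_ge[OF r0 r1 div_r that] by (simp add: U_def)
  qed simp
  then have "negligible (\<Union>m. - U m)" by (intro negligible_countable_Union) auto
  moreover have "{\<alpha>::real. finite {q::nat. 1 \<le> q \<and> (\<exists>p::int. 0 < real q * \<alpha> - of_int p \<and> real q * \<alpha> - of_int p < \<delta> q)}} \<subseteq> (\<Union>m. - U m)"
  proof (rule subsetI, rule ccontr)
    fix \<alpha> :: real
    let ?Q = "{q::nat. 1 \<le> q \<and> (\<exists>p::int. 0 < real q * \<alpha> - of_int p \<and> real q * \<alpha> - of_int p < \<delta> q)}"
    assume fin: "\<alpha> \<in> {\<alpha>::real. finite {q::nat. 1 \<le> q \<and> (\<exists>p::int. 0 < real q * \<alpha> - of_int p \<and> real q * \<alpha> - of_int p < \<delta> q)}}"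
    assume "\<alpha> \<notin> (\<Union>m. - U m)"
    then have all: "\<alpha> \<in> U m" for m by auto
    have "\<exists>q\<ge>m. q \<in> ?Q" for m
    proof -
      \<comment> \<open>The shift by 4 compensates the factor 16: denominators in block
        \<open>k\<close> exceed \<open>2 ^ k / 16 \<ge> 2 ^ m > m\<close>.\<close>
      obtain k v where k: "m + 4 \<le> k" and v: "v \<in> block_fractions (2 ^ k)" "v < \<alpha>" "\<alpha> < v + r k / 4 ^ k"
        using all[of "m + 4"] by (auto simp: U_def)
      then obtain p q' where pq: "v = of_int p / of_int q'" "real (2 ^ k) / 16 < of_int q'" "0 < q'" "q' \<le> int (2 ^ k)"
        by (auto simp: block_fractions_def)
      define q where "q = nat q'"
      have q: "q' = int q" "1 \<le> q" using pq by (auto simp: q_def)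
      have qle: "q \<le> 2 ^ k" using pq(4) q by simp
      have "(2::real) ^ m * 16 \<le> 2 ^ k"
        using k power_increasing[of "m + 4" k "2::real"] by (simp add: power_add)
      moreover have "(2::real) ^ k / 16 < real q" using pq(2) q by simp
      ultimately have "2 ^ m < real q" by linarith
      moreover have "real m < 2 ^ m" using less_exp[of m] by (metis of_nat_less_iff of_nat_numeral of_nat_power)
      ultimately have "m \<le> q" by linarith
      moreover have "0 < real q * \<alpha> - of_int p" using v(2) q pq(1) by (simp add: field_simps)
      moreover have "real q * \<alpha> - of_int p < \<delta> q"
      proof -
        have "real q * \<alpha> - of_int p < q * (r k / 4 ^ k)" using v(3) q pq(1) by (simp add: field_simps)
        also have "\<dots> \<le> 2 ^ k * ((2 ^ k * \<delta> (2 ^ k)) / 4 ^ k)"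
        proof (intro mult_mono divide_right_mono)
          show "real q \<le> 2 ^ k" using qle by (metis of_nat_le_iff of_nat_numeral of_nat_power)
        qed (use r0[of k] in \<open>auto simp: r_def\<close>)
        also have "\<dots> = \<delta> (2 ^ k)"
          using power_mult_distrib[of "2::real" 2 k] by (simp add: field_simps)
        also have "\<dots> \<le> \<delta> q" using mono q(2) qle by blast
        finally show ?thesis .
      qed
      ultimately show ?thesis using q by blast
    qed
    then have "infinite ?Q" by (simp add: infinite_nat_iff_unbounded_le)
    then show False using fin by simp
  qed
  ultimately show ?thesis by (rule negligible_subset)
qed

section \<open>The convergence half of Khinchin's theorem\<close>

lemma khinchin_convergence:
  fixes \<delta> :: "nat \<Rightarrow> real"
  assumes nonneg: "\<And>n. 0 \<le> \<delta> n" and sum: "summable \<delta>"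
  shows "negligible {\<alpha>::real. infinite {n::nat. 1 \<le> n \<and> (\<exists>p::int. \<bar>real n * \<alpha> - of_int p\<bar> \<le> \<delta> n)}}"
proof -
  define B where "B = {\<alpha>::real. infinite {n::nat. 1 \<le> n \<and> (\<exists>p::int. \<bar>real n * \<alpha> - of_int p\<bar> \<le> \<delta> n)}}"
  obtain d :: nat where d: "\<And>n. \<delta> n \<le> d"
  proof -
    have "Bseq \<delta>" using summable_imp_Bseq[OF sum] .
    then obtain K where "\<And>n. \<bar>\<delta> n\<bar> \<le> K" by (auto simp: Bseq_def)
    moreover obtain d :: nat where "K \<le> d" using real_arch_simple by blast
    ultimately show thesis using that[of d] by (metis abs_ge_self order_trans)
  qed
  have "negligible (B \<inter> {- real j..real j})" for j :: nat
  proof -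
    \<comment> \<open>Borel-Cantelli on a bounded window. For \<alpha> in \<open>{- j..j}\<close> a
      numerator has absolute value at most \<open>n * j + d\<close>, so \<open>A n\<close> is a
      union of O(n) intervals of length \<open>2 * \<delta> n / n\<close> and has measure O(\<delta>
      n). The index 0, where the division is meaningless, gets the empty set.\<close>
    define A where "A n = (if n = 0 then {} else
      (\<Union>p\<in>{- int (n * j + d)..int (n * j + d)}. {(of_int p - \<delta> n) / real n..(of_int p + \<delta> n) / real n}))" for n :: nat
    have Am: "A n \<in> lmeasurable" for n
    proof -
      have "{u..v} \<in> lmeasurable" for u v :: real using lmeasurable_cbox[of u v] by simp
      then show ?thesis unfolding A_def by (auto intro!: fmeasurable.finite_UN)
    qed
    have mA: "measure lebesgue (A n) \<le> real (2 * j + 2 * d + 1) * 2 * \<delta> n" for n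
    proof (cases "n = 0")
      case True
      then show ?thesis using nonneg[of n] by (simp add: A_def)
    next
      case False
      define I where "I = {- int (n * j + d)..int (n * j + d)}"
      have A: "A n = (\<Union>p\<in>I. {(of_int p - \<delta> n) / real n..(of_int p + \<delta> n) / real n})"
        using False by (simp add: A_def I_def)
      have "measure lebesgue (A n) \<le> (\<Sum>p\<in>I. measure lebesgue {(of_int p - \<delta> n) / real n..(of_int p + \<delta> n) / real n})"
        unfolding A by (rule measure_UNION_le) (auto simp: I_def)
      also have "\<dots> = (\<Sum>p\<in>I. 2 * \<delta> n / real n)"
      proof (rule sum.cong[OF refl])
        fix p :: int
        have "(of_int p - \<delta> n) / real n \<le> (of_int p + \<delta> n) / real n"
          using nonneg[of n] by (intro divide_right_mono) auto
        moreover have "(of_int p + \<delta> n) / real n - (of_int p - \<delta> n) / real n = 2 * \<delta> n / real n"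
          by (simp flip: diff_divide_distrib)
        ultimately show "measure lebesgue {(of_int p - \<delta> n) / real n..(of_int p + \<delta> n) / real n} = 2 * \<delta> n / real n"
          by simp
      qed
      also have "\<dots> = real (card I) * (2 * \<delta> n / real n)" by simp
      also have "card I = 2 * (n * j + d) + 1"
      proof -
        have "int (n * j + d) - - int (n * j + d) + 1 = int (2 * (n * j + d) + 1)" by simp
        then show ?thesis by (simp only: I_def card_atLeastAtMost_int nat_int)
      qed
      also have "real (2 * (n * j + d) + 1) * (2 * \<delta> n / real n) \<le> (real n * real (2 * j + 2 * d + 1)) * (2 * \<delta> n / real n)"
      proof (rule mult_right_mono)
        have "1 * (2 * d + 1) \<le> n * (2 * d + 1)" using False by (intro mult_right_mono) auto
        then have "2 * (n * j + d) + 1 \<le> n * (2 * j + 2 * d + 1)" by (simp add: algebra_simps)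
        then show "real (2 * (n * j + d) + 1) \<le> real n * real (2 * j + 2 * d + 1)"
          by (metis of_nat_le_iff of_nat_mult)
      qed (use nonneg[of n] in simp)
      also have "\<dots> = real (2 * j + 2 * d + 1) * 2 * \<delta> n" using False by simp
      finally show ?thesis .
    qed
    have "limsup A \<in> null_sets lebesgue"
    proof (rule borel_cantelli_limsup1)
      show "A n \<in> sets lebesgue" for n using Am by blast
      show "emeasure lebesgue (A n) < \<infinity>" for n using Am[of n] by (auto simp: fmeasurable_def)
      show "summable (\<lambda>n. measure lebesgue (A n))"
        by (rule summable_comparison_test'[OF summable_mult[OF sum, of "real (2 * j + 2 * d + 1) * 2"]])
          (use mA in auto)
    qed
    then have "negligible (limsup A)" by (simp add: negligible_iff_null_sets)
    moreover have "B \<inter> {- real j..real j} \<subseteq> limsup A"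
    proof
      fix \<alpha> assume \<alpha>: "\<alpha> \<in> B \<inter> {- real j..real j}"
      have "\<exists>m\<ge>k. \<alpha> \<in> A m" for k
      proof -
        obtain m p where m: "k \<le> m" "1 \<le> m" and p: "\<bar>real m * \<alpha> - of_int p\<bar> \<le> \<delta> m"
          using \<alpha> unfolding B_def infinite_nat_iff_unbounded_le by blast
        have "\<bar>real m * \<alpha>\<bar> \<le> real m * real j" using \<alpha> by (auto simp: abs_mult intro!: mult_left_mono)
        then have "\<bar>real_of_int p\<bar> \<le> real m * real j + real d" using p d[of m] by linarith
        then have "\<bar>real_of_int p\<bar> \<le> real_of_int (int (m * j + d))" by simp
        then have "\<bar>p\<bar> \<le> int (m * j + d)" by linarith
        then have "p \<in> {- int (m * j + d)..int (m * j + d)}" unfolding atLeastAtMost_iff by linarith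
        moreover have "\<alpha> \<in> {(of_int p - \<delta> m) / real m..(of_int p + \<delta> m) / real m}"
        proof -
          have "of_int p - \<delta> m \<le> \<alpha> * real m" "\<alpha> * real m \<le> of_int p + \<delta> m"
            using p by (auto simp: mult.commute)
          then show ?thesis using m(2) by (simp add: divide_le_eq le_divide_eq)
        qed
        ultimately have "\<alpha> \<in> A m" using m(2) unfolding A_def by auto
        then show ?thesis using m(1) by blast
      qed
      then show "\<alpha> \<in> limsup A" by (auto simp: limsup_INF_SUP)
    qed
    ultimately show ?thesis by (rule negligible_subset)
  qed
  then have "negligible (\<Union>j::nat. B \<inter> {- real j..real j})" by (intro negligible_countable_Union) auto
  moreover have "B \<subseteq> (\<Union>j::nat. B \<inter> {- real j..real j})"
  proof
    fix \<alpha> assume "\<alpha> \<in> B"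
    moreover obtain j :: nat where "\<bar>\<alpha>\<bar> \<le> real j" using real_arch_simple by blast
    ultimately have "\<alpha> \<in> B \<inter> {- real j..real j}" by (simp add: abs_le_iff)
    then show "\<alpha> \<in> (\<Union>j::nat. B \<inter> {- real j..real j})" by blast
  qed
  ultimately show ?thesis unfolding B_def[symmetric] by (rule negligible_subset)
qed

section \<open>Parametrization of the identity component\<close>

text \<open>The hypotheses say that both points follow the flow of \<wp>, given by
  \<open>x' = y\<close> and \<open>y' = 6 x\<^sup>2 - g2 / 2\<close>, at speeds \<open>d\<close> and
  \<open>- d\<close>, so that their parameters have a constant sum. The simple form of the
  derivative comes from the two curve equations, once the denominator is cleared.\<close>

lemma chord_slope_has_derivative:
  fixes x1 y1 x2 y2 :: "real \<Rightarrow> real"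
  assumes d1: "(x1 has_real_derivative d * y1 u) (at u)" "(y1 has_real_derivative d * (6 * x1 u ^ 2 - g2 / 2)) (at u)"
    and d2: "(x2 has_real_derivative - d * y2 u) (at u)" "(y2 has_real_derivative - d * (6 * x2 u ^ 2 - g2 / 2)) (at u)"
    and c: "y1 u ^ 2 = ec_rhs g2 g3 (x1 u)" "y2 u ^ 2 = ec_rhs g2 g3 (x2 u)" and ne: "x1 u \<noteq> x2 u"
  shows "((\<lambda>u. (y2 u - y1 u) / (x2 u - x1 u)) has_real_derivative - 2 * d * (x2 u - x1 u)) (at u)"
proof -
  let ?D = "x2 u - x1 u"
  have D: "?D \<noteq> 0" using ne by simp
  have "((\<lambda>u. (y2 u - y1 u) / (x2 u - x1 u)) has_real_derivative
      ((- d * (6 * x2 u ^ 2 - g2 / 2) - d * (6 * x1 u ^ 2 - g2 / 2)) * ?D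
        - (y2 u - y1 u) * (- d * y2 u - d * y1 u)) / (?D * ?D)) (at u)"
    using D by (intro DERIV_divide DERIV_diff d1 d2) auto
  moreover have "(- d * (6 * x2 u ^ 2 - g2 / 2) - d * (6 * x1 u ^ 2 - g2 / 2)) * ?D
        - (y2 u - y1 u) * (- d * y2 u - d * y1 u) = - 2 * d * ?D * (?D * ?D)"
    using c unfolding ec_rhs_def by algebra
  ultimately show ?thesis using D by simp
qed

text \<open>The addition theorem in infinitesimal form. By the preceding lemma
  \<open>l\<^sup>2 / 4\<close> has derivative \<open>- d * l * (x2 - x1) = d * (y1 - y2)\<close>,
  which is also the derivative of \<open>x1 + x2\<close>.\<close>

lemma chord_sum_has_derivative_0:
  fixes x1 y1 x2 y2 :: "real \<Rightarrow> real"
  assumes d1: "(x1 has_real_derivative d * y1 u) (at u)" "(y1 has_real_derivative d * (6 * x1 u ^ 2 - g2 / 2)) (at u)"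
    and d2: "(x2 has_real_derivative - d * y2 u) (at u)" "(y2 has_real_derivative - d * (6 * x2 u ^ 2 - g2 / 2)) (at u)"
    and c: "y1 u ^ 2 = ec_rhs g2 g3 (x1 u)" "y2 u ^ 2 = ec_rhs g2 g3 (x2 u)" and ne: "x1 u \<noteq> x2 u"
  defines "l \<equiv> \<lambda>u. (y2 u - y1 u) / (x2 u - x1 u)"
  defines "x3 \<equiv> \<lambda>u. l u ^ 2 / 4 - x1 u - x2 u"
  shows "(x3 has_real_derivative 0) (at u)"
    and "((\<lambda>u. - (y1 u + l u * (x3 u - x1 u))) has_real_derivative 0) (at u)"
proof -
  have l: "(l has_real_derivative - 2 * d * (x2 u - x1 u)) (at u)"
    unfolding l_def by (rule chord_slope_has_derivative[OF d1 d2 c ne])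
  have lD: "l u * (x2 u - x1 u) = y2 u - y1 u" using ne by (simp add: l_def)
  have "(x3 has_real_derivative 2 * l u * (- 2 * d * (x2 u - x1 u)) / 4 - d * y1 u - - d * y2 u) (at u)"
    unfolding x3_def by (rule derivative_eq_intros l d1 d2 refl | simp)+
  moreover have "2 * l u * (- 2 * d * (x2 u - x1 u)) / 4 - d * y1 u - - d * y2 u = 0"
    using lD by algebra
  ultimately show x3: "(x3 has_real_derivative 0) (at u)" by metis
  have "((\<lambda>u. - (y1 u + l u * (x3 u - x1 u))) has_real_derivative
      - (d * (6 * x1 u ^ 2 - g2 / 2) + ((- 2 * d * (x2 u - x1 u)) * (x3 u - x1 u) + (0 - d * y1 u) * l u))) (at u)"
    by (intro DERIV_minus DERIV_add DERIV_mult DERIV_diff d1 l x3)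
  moreover have "- (d * (6 * x1 u ^ 2 - g2 / 2) + ((- 2 * d * (x2 u - x1 u)) * (x3 u - x1 u) + (0 - d * y1 u) * l u)) = 0"
  proof -
    have "(x2 u - x1 u) * (d * (6 * x1 u ^ 2 - g2 / 2) + ((- 2 * d * (x2 u - x1 u)) * (l u ^ 2 / 4 - x1 u - x2 u - x1 u) + (0 - d * y1 u) * l u)) = 0"
      using lD c unfolding ec_rhs_def by algebra
    then show ?thesis using ne by (simp add: x3_def)
  qed
  ultimately show "((\<lambda>u. - (y1 u + l u * (x3 u - x1 u))) has_real_derivative 0) (at u)" by metis
qed

text \<open>Continuity of the addition as the first summand tends to the point at infinity: this
  supplies the initial value for the constancy of the sum.\<close>

lemma chord_sum_tendsto:
  fixes x1 y1 x2 y2 :: "real \<Rightarrow> real"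
  assumes x1: "filterlim x1 at_top F" and c1: "\<forall>\<^sub>F u in F. y1 u ^ 2 = ec_rhs g2 g3 (x1 u)"
    and c2: "\<forall>\<^sub>F u in F. y2 u ^ 2 = ec_rhs g2 g3 (x2 u)"
    and x2: "(x2 \<longlongrightarrow> a) F" and y2: "(y2 \<longlongrightarrow> b) F"
  defines "l \<equiv> \<lambda>u. (y2 u - y1 u) / (x2 u - x1 u)"
  defines "x3 \<equiv> \<lambda>u. l u ^ 2 / 4 - x1 u - x2 u"
  shows "(x3 \<longlongrightarrow> a) F" and "((\<lambda>u. - (y1 u + l u * (x3 u - x1 u))) \<longlongrightarrow> b) F"
proof -
  define w where "w u = 1 / x1 u" for u
  have w: "(w \<longlongrightarrow> 0) F"
    unfolding w_def using x1 by (intro real_tendsto_divide_at_top[OF tendsto_const])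
  define D where "D u = 1 - x2 u * w u" for u
  have D: "(D \<longlongrightarrow> 1) F"
    unfolding D_def by (rule tendsto_eq_intros x2 w refl | simp)+
  have x1pos: "\<forall>\<^sub>F u in F. 0 < x1 u" using x1 by (simp add: filterlim_at_top_dense)
  have x12: "\<forall>\<^sub>F u in F. x2 u < x1 u"
  proof -
    have "\<forall>\<^sub>F u in F. x2 u < a + 1" using x2 by (rule order_tendstoD) simp
    moreover have "\<forall>\<^sub>F u in F. a + 1 < x1 u" using x1 by (simp add: filterlim_at_top_dense)
    ultimately show ?thesis by eventually_elim simp
  qed
  \<comment> \<open>\<open>w = 1 / x1\<close> and \<open>s = y1 / x1\<^sup>2\<close> both vanish at
    infinity, the latter because the curve equation reads
    \<open>s\<^sup>2 = 4 w - g2 w^3 - g3 w^4\<close>. The quotients below are rational in them, with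
    powers of \<open>D\<close>, which tends to 1, as denominators.\<close>
  define s where "s u = y1 u * w u ^ 2" for u
  have s2: "((\<lambda>u. s u ^ 2) \<longlongrightarrow> 0) F"
  proof -
    have "((\<lambda>u. 4 * w u - g2 * w u ^ 3 - g3 * w u ^ 4) \<longlongrightarrow> 0) F"
      by (rule tendsto_eq_intros w refl | simp)+
    moreover have "\<forall>\<^sub>F u in F. 4 * w u - g2 * w u ^ 3 - g3 * w u ^ 4 = s u ^ 2"
      using x1pos c1
    proof eventually_elim
      case (elim u)
      then have "x1 u * w u = 1" by (simp add: w_def)
      with elim(2) show ?case unfolding s_def ec_rhs_def by algebra
    qed
    ultimately show ?thesis by (rule Lim_transform_eventually)
  qed
  have s: "(s \<longlongrightarrow> 0) F"
  proof -
    have "((\<lambda>u. sqrt (s u ^ 2)) \<longlongrightarrow> sqrt 0) F" by (intro tendsto_intros s2)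
    then show ?thesis by (simp add: tendsto_rabs_zero_iff)
  qed
  have lD: "((\<lambda>u. l u / (x1 u - x2 u)) \<longlongrightarrow> 0) F"
  proof -
    have "((\<lambda>u. (s u - y2 u * w u ^ 2) / D u ^ 2) \<longlongrightarrow> 0) F"
      by (rule tendsto_eq_intros w s y2 D refl | simp)+
    moreover have "\<forall>\<^sub>F u in F. (s u - y2 u * w u ^ 2) / D u ^ 2 = l u / (x1 u - x2 u)"
      using x1pos x12
    proof eventually_elim
      case (elim u)
      have "w u \<noteq> 0" using elim by (simp add: w_def)
      moreover have "D u = (x1 u - x2 u) * w u" using elim by (simp add: D_def w_def field_simps)
      moreover have "s u - y2 u * w u ^ 2 = (y1 u - y2 u) * w u ^ 2" by (simp add: s_def algebra_simps)
      moreover have "l u = (y1 u - y2 u) / (x1 u - x2 u)"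
        by (simp add: l_def) (metis minus_diff_eq minus_divide_divide)
      ultimately show ?case using elim by (simp add: power_mult_distrib power2_eq_square)
    qed
    ultimately show ?thesis by (rule Lim_transform_eventually)
  qed
  have l2D: "((\<lambda>u. l u ^ 2 / (x1 u - x2 u)) \<longlongrightarrow> 4) F"
  proof -
    have "((\<lambda>u. (4 - g2 * w u ^ 2 - g3 * w u ^ 3 - 2 * s u * y2 u * w u + y2 u ^ 2 * w u ^ 3) / D u ^ 3) \<longlongrightarrow> 4) F"
      by (rule tendsto_eq_intros w s y2 D refl | simp)+
    moreover have "\<forall>\<^sub>F u in F. (4 - g2 * w u ^ 2 - g3 * w u ^ 3 - 2 * s u * y2 u * w u + y2 u ^ 2 * w u ^ 3) / D u ^ 3
         = l u ^ 2 / (x1 u - x2 u)"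
      using x1pos x12 c1
    proof eventually_elim
      case (elim u)
      have xw: "x1 u * w u = 1" using elim by (simp add: w_def)
      have w0: "w u \<noteq> 0" using elim by (simp add: w_def)
      have D: "D u = (x1 u - x2 u) * w u" using elim by (simp add: D_def w_def field_simps)
      have "4 - g2 * w u ^ 2 - g3 * w u ^ 3 - 2 * s u * y2 u * w u + y2 u ^ 2 * w u ^ 3 = (y2 u - y1 u) ^ 2 * w u ^ 3"
        using xw elim(3) unfolding s_def ec_rhs_def by algebra
      moreover have "(x2 u - x1 u) ^ 2 * (x1 u - x2 u) = (x1 u - x2 u) ^ 3" by algebra
      ultimately show ?case using w0 elim
        by (simp add: D l_def power_mult_distrib power_divide)
    qed
    ultimately show ?thesis by (rule Lim_transform_eventually)
  qed
  have iD: "((\<lambda>u. 1 / (x1 u - x2 u)) \<longlongrightarrow> 0) F"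
  proof -
    have "((\<lambda>u. w u / D u) \<longlongrightarrow> 0) F"
      by (rule tendsto_eq_intros w D refl | simp)+
    moreover have "\<forall>\<^sub>F u in F. w u / D u = 1 / (x1 u - x2 u)"
      using x1pos x12 by eventually_elim (simp add: D_def w_def field_simps)
    ultimately show ?thesis by (rule Lim_transform_eventually)
  qed
  \<comment> \<open>In the chord formula \<open>l\<^sup>2 / 4\<close> and \<open>x1\<close> both
    become infinite. Rewriting the sum around \<open>(x2, y2)\<close>, which stays finite, leaves
    only \<open>1 / (x1 - x2)\<close>, \<open>l / (x1 - x2)\<close> and
    \<open>l\<^sup>2 / (x1 - x2)\<close>, with limits 0, 0 and 4.\<close>
  have e: "\<forall>\<^sub>F u in F. x2 u + ((12 * x2 u ^ 2 - g2) / 4 * (1 / (x1 u - x2 u)) - y2 u / 2 * (l u / (x1 u - x2 u))) = x3 u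
     \<and> - y2 u - ((12 * x2 u ^ 2 - g2) / 4 * (l u / (x1 u - x2 u)) - y2 u / 2 * (l u ^ 2 / (x1 u - x2 u)))
       = - (y1 u + l u * (x3 u - x1 u))"
    using x12 c1 c2
  proof eventually_elim
    case (elim u)
    define E where "E = 1 / (x1 u - x2 u)"
    have E: "E * (x1 u - x2 u) = 1" using elim by (simp add: E_def)
    have l: "l u * (x2 u - x1 u) = y2 u - y1 u" using elim by (simp add: l_def)
    have x3: "x2 u + ((12 * x2 u ^ 2 - g2) / 4 * E - y2 u / 2 * (l u * E)) = x3 u"
    proof -
      have "(x1 u - x2 u) * (x2 u + ((12 * x2 u ^ 2 - g2) / 4 * E - y2 u / 2 * (l u * E)) - x3 u)
        = (x1 u - x2 u) * x2 u + (12 * x2 u ^ 2 - g2) / 4 - y2 u / 2 * l u - (x1 u - x2 u) * x3 u"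
        using E by algebra
      moreover have "(x1 u - x2 u) * ((x1 u - x2 u) * x2 u + (12 * x2 u ^ 2 - g2) / 4 - y2 u / 2 * l u - (x1 u - x2 u) * x3 u) = 0"
        using l elim(2,3) unfolding x3_def ec_rhs_def by algebra
      ultimately show ?thesis using elim(1) by simp
    qed
    have "- y2 u - ((12 * x2 u ^ 2 - g2) / 4 * (l u * E) - y2 u / 2 * (l u ^ 2 * E)) = - (y2 u + l u * (x3 u - x2 u))"
      unfolding x3[symmetric] by (simp add: algebra_simps power2_eq_square)
    also have "\<dots> = - (y1 u + l u * (x3 u - x1 u))" using l by algebra
    finally show ?case using x3 by (simp add: E_def)
  qed
  have "((\<lambda>u. x2 u + ((12 * x2 u ^ 2 - g2) / 4 * (1 / (x1 u - x2 u)) - y2 u / 2 * (l u / (x1 u - x2 u)))) \<longlongrightarrow> a) F"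
    by (rule tendsto_eq_intros x2 y2 iD lD refl | simp)+
  then show "(x3 \<longlongrightarrow> a) F"
    by (rule Lim_transform_eventually) (use e in eventually_elim, simp)
  have "((\<lambda>u. - y2 u - ((12 * x2 u ^ 2 - g2) / 4 * (l u / (x1 u - x2 u)) - y2 u / 2 * (l u ^ 2 / (x1 u - x2 u)))) \<longlongrightarrow> b) F"
    by (rule tendsto_eq_intros x2 y2 l2D lD refl | simp)+
  then show "((\<lambda>u. - (y1 u + l u * (x3 u - x1 u))) \<longlongrightarrow> b) F"
    by (rule Lim_transform_eventually) (use e in eventually_elim, simp)
qed

text \<open>
  Here \<open>e\<close> is the largest real root. The substitution \<open>x = e + cot\<^sup>2 (\<theta> / 2) = e + (1 + cos \<theta>) / (1 - cos \<theta>)\<close>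
  turns \<open>dx / y\<close> into \<open>d\<theta> / sqrt (R (cos \<theta>))\<close>, which is smooth and \<open>2 pi\<close>-periodic. Below, \<open>H\<close> is its
  integral, \<open>ang\<close> the inverse of \<open>H\<close>, and \<open>X\<close>, \<open>Y\<close> are the restrictions of \<open>\<wp>\<close>, \<open>\<wp>'\<close> to the real line.
\<close>

locale real_weierstrass =
  fixes g2 g3 e :: real
  assumes root: "ec_rhs g2 g3 e = 0"
    and pos: "\<And>x. e < x \<Longrightarrow> 0 < ec_rhs g2 g3 x"
    and simple_root: "12 * e\<^sup>2 \<noteq> g2"
begin

text \<open>A quarter of the derivative of the cubic at \<open>e\<close>, hence the product of the
  differences between \<open>e\<close> and the other two complex roots.\<close>

definition \<kappa> :: real where "\<kappa> = 3 * e\<^sup>2 - g2 / 4"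

lemma ec_rhs_shift: "ec_rhs g2 g3 (e + v) = 4 * v * (v\<^sup>2 + 3 * e * v + \<kappa>)"
proof -
  have "g3 = 4 * e ^ 3 - g2 * e" using root by (simp add: ec_rhs_def)
  then show ?thesis
    unfolding ec_rhs_def \<kappa>_def by (simp add: field_simps power2_eq_square power3_eq_cube)
qed

lemma quadratic_pos: "0 < v \<Longrightarrow> 0 < v\<^sup>2 + 3 * e * v + \<kappa>"
  using pos[of "e + v"] by (simp add: ec_rhs_shift zero_less_mult_iff)

lemma \<kappa>_pos: "0 < \<kappa>"
proof (rule ccontr)
  assume "\<not> 0 < \<kappa>"
  moreover have "\<kappa> \<noteq> 0" using simple_root by (simp add: \<kappa>_def)
  ultimately have neg: "\<kappa> < 0" by simp
  \<comment> \<open>Chosen so that \<open>v\<^sup>2 + 3 * e * v \<le> v * (1 + 3 * \<bar>e\<bar>)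
    \<le> - \<kappa>\<close>, against the positivity of the quadratic factor to the right of
    0.\<close>
  define v where "v = min 1 (- \<kappa> / (1 + 3 * \<bar>e\<bar>))"
  have v: "0 < v" "v \<le> 1" "v \<le> - \<kappa> / (1 + 3 * \<bar>e\<bar>)"
    using neg by (auto simp: v_def add_pos_nonneg divide_neg_pos)
  have "v\<^sup>2 \<le> v" using v by (simp add: power2_eq_square mult_left_le)
  moreover have "e * v \<le> \<bar>e\<bar> * v" using v by (intro mult_right_mono) auto
  moreover have "v * (1 + 3 * \<bar>e\<bar>) \<le> - \<kappa>"
  proof -
    have p: "0 < 1 + 3 * \<bar>e\<bar>" by (simp add: add_pos_nonneg)
    show ?thesis using v(3) unfolding pos_le_divide_eq[OF p] .
  qed
  ultimately have "v\<^sup>2 + 3 * e * v + \<kappa> \<le> 0" by (simp add: algebra_simps)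
  then show False using quadratic_pos[OF v(1)] by simp
qed

text \<open>The quadratic factor \<open>v\<^sup>2 + 3 * e * v + \<kappa>\<close> at
  \<open>v = (1 + c) / (1 - c)\<close>, multiplied by \<open>(1 - c)\<^sup>2\<close>. This makes it
  a polynomial that is positive also at \<open>c = 1\<close>, the point at infinity, where it equals
  4; at \<open>c = -1\<close>, the point (e, 0), it equals \<open>4 * \<kappa>\<close>.\<close>

definition R :: "real \<Rightarrow> real" where
  "R c = (1 + c)\<^sup>2 + 3 * e * (1 - c\<^sup>2) + \<kappa> * (1 - c)\<^sup>2"

lemma R_pos:
  assumes "-1 \<le> c" "c \<le> 1"
  shows "0 < R c"
proof (cases "c = 1 \<or> c = -1")
  case True
  then show ?thesis using \<kappa>_pos by (auto simp: R_def)
next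
  case False
  define v where "v = (1 + c) / (1 - c)"
  have v: "0 < v" and vc: "v * (1 - c) = 1 + c" using False assms by (auto simp: v_def)
  have "R c = (1 - c)\<^sup>2 * (v\<^sup>2 + 3 * e * v + \<kappa>)"
    using vc unfolding R_def by algebra
  then show ?thesis using quadratic_pos[OF v] False by simp
qed

lemma R_cos_pos [simp]: "0 < R (cos \<theta>)"
  by (rule R_pos) auto

lemma R_cos_nonzero [simp]: "R (cos \<theta>) \<noteq> 0"
  using R_cos_pos[of \<theta>] by linarith

lemma R_bounds: "\<exists>m M. 0 < m \<and> 0 < M \<and> (\<forall>\<theta>. m \<le> 1 / sqrt (R (cos \<theta>)) \<and> 1 / sqrt (R (cos \<theta>)) \<le> M)"
proof -
  have cont: "continuous_on {-1..1} (\<lambda>c. 1 / sqrt (R c))"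
    unfolding R_def
    by (intro continuous_intros) (use R_pos in \<open>fastforce simp: R_def\<close>)
  obtain a where a: "a \<in> {-1..1}" "\<And>c. c \<in> {-1..1} \<Longrightarrow> 1 / sqrt (R a) \<le> 1 / sqrt (R c)"
    using continuous_attains_inf[OF _ _ cont] by auto
  obtain b where b: "b \<in> {-1..1}" "\<And>c. c \<in> {-1..1} \<Longrightarrow> 1 / sqrt (R c) \<le> 1 / sqrt (R b)"
    using continuous_attains_sup[OF _ _ cont] by auto
  have "0 < R a" "0 < R b" using R_pos a(1) b(1) by auto
  then show ?thesis
    using a(2) b(2) by (intro exI[of _ "1 / sqrt (R a)"] exI[of _ "1 / sqrt (R b)"]) auto
qed

definition H :: "real \<Rightarrow> real" where
  "H = (SOME F. F 0 = 0 \<and> (\<forall>\<theta>. (F has_real_derivative 1 / sqrt (R (cos \<theta>))) (at \<theta>)))"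

lemma H_ex: "\<exists>F. F 0 = 0 \<and> (\<forall>\<theta>. (F has_real_derivative 1 / sqrt (R (cos \<theta>))) (at \<theta>))"
proof -
  have "R (cos \<theta>) \<noteq> 0" for \<theta> using R_cos_pos[of \<theta>] by linarith
  then have cont: "isCont (\<lambda>\<theta>. 1 / sqrt (R (cos \<theta>))) \<theta>" for \<theta>
    unfolding R_def by (intro continuous_intros) auto
  obtain F where F: "\<And>\<theta>. (F has_vector_derivative 1 / sqrt (R (cos \<theta>))) (at \<theta>)"
    using einterval_antiderivative[of "-\<infinity>" "\<infinity>" "\<lambda>\<theta>. 1 / sqrt (R (cos \<theta>))"] cont by auto
  have "((\<lambda>\<theta>. F \<theta> - F 0) has_real_derivative 1 / sqrt (R (cos \<theta>))) (at \<theta>)" for \<theta>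
    using F[of \<theta>] DERIV_diff[OF _ DERIV_const, of F "1 / sqrt (R (cos \<theta>))" \<theta> UNIV "F 0"]
    by (simp add: has_real_derivative_iff_has_vector_derivative)
  then show ?thesis by (intro exI[of _ "\<lambda>\<theta>. F \<theta> - F 0"]) auto
qed

lemma H_0 [simp]: "H 0 = 0" and H_deriv: "(H has_real_derivative 1 / sqrt (R (cos \<theta>))) (at \<theta>)"
  using someI_ex[OF H_ex] unfolding H_def by auto

lemma H_less: "\<theta> < \<theta>' \<Longrightarrow> H \<theta> < H \<theta>'"
  by (rule DERIV_pos_imp_increasing) (auto intro!: exI[of _ "1 / sqrt (R (cos _))"] H_deriv)

lemma H_isCont: "isCont H \<theta>"
  using H_deriv by (rule DERIV_isCont)

lemma H_minus: "H (- \<theta>) = - H \<theta>"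
proof -
  have "((\<lambda>\<theta>. H (- \<theta>) + H \<theta>) has_real_derivative 0) (at \<theta>)" for \<theta>
  proof -
    have "((\<lambda>\<theta>. H (- \<theta>)) has_real_derivative 1 / sqrt (R (cos (- \<theta>))) * (- 1)) (at \<theta>)"
      by (rule DERIV_chain2[OF H_deriv]) (auto intro!: derivative_eq_intros)
    from DERIV_add[OF this H_deriv] show ?thesis by simp
  qed
  then have "H (- \<theta>) + H \<theta> = H (- 0) + H 0"
    using DERIV_isconst_all[of "\<lambda>\<theta>. H (- \<theta>) + H \<theta>"] by blast
  then show ?thesis by simp
qed

text \<open>The real period: a full turn of the angle, or twice the integral of dx / sqrt (4 x^3 -
  g2 x - g3) from \<open>e\<close> to infinity.\<close>

definition \<omega> :: real where "\<omega> = H (2 * pi)"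

lemma \<omega>_pos: "0 < \<omega>"
  using H_less[of 0 "2 * pi"] by (simp add: \<omega>_def)

lemma H_add_2pi: "H (\<theta> + 2 * pi) = H \<theta> + \<omega>"
proof -
  have "((\<lambda>\<theta>. H (\<theta> + 2 * pi) - H \<theta>) has_real_derivative 0) (at \<theta>)" for \<theta>
  proof -
    have "((\<lambda>\<theta>. H (\<theta> + 2 * pi)) has_real_derivative 1 / sqrt (R (cos (\<theta> + 2 * pi))) * 1) (at \<theta>)"
      by (rule DERIV_chain2[OF H_deriv]) (auto intro!: derivative_eq_intros)
    from DERIV_diff[OF this H_deriv] show ?thesis by simp
  qed
  then have "H (\<theta> + 2 * pi) - H \<theta> = H (0 + 2 * pi) - H 0"
    using DERIV_isconst_all[of "\<lambda>\<theta>. H (\<theta> + 2 * pi) - H \<theta>"] by blast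
  then show ?thesis by (simp add: \<omega>_def)
qed

lemma H_add_int: "H (\<theta> + 2 * pi * of_int n) = H \<theta> + of_int n * \<omega>"
proof (induction n rule: int_induct[of _ 0])
  case (step1 i)
  show ?case using H_add_2pi[of "\<theta> + 2 * pi * of_int i"] step1 by (simp add: algebra_simps)
next
  case (step2 i)
  show ?case using H_add_2pi[of "\<theta> + 2 * pi * of_int (i - 1)"] step2 by (simp add: algebra_simps)
qed simp

lemma H_bounds:
  obtains m M where "0 < m" "0 < M" "\<And>\<theta>. m * \<bar>\<theta>\<bar> \<le> \<bar>H \<theta>\<bar>" "\<And>\<theta>. \<bar>H \<theta>\<bar> \<le> M * \<bar>\<theta>\<bar>"
proof -
  obtain m M where mM: "0 < m" "0 < M"
    "\<And>\<theta>. m \<le> 1 / sqrt (R (cos \<theta>))" "\<And>\<theta>. 1 / sqrt (R (cos \<theta>)) \<le> M"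
    using R_bounds by blast
  have pos: "m * \<theta> \<le> H \<theta> \<and> H \<theta> \<le> M * \<theta>" if "0 < \<theta>" for \<theta>
  proof -
    have "\<exists>t>0. t < \<theta> \<and> H \<theta> - H 0 = (\<theta> - 0) * (1 / sqrt (R (cos t)))"
      by (rule MVT2) (use \<open>0 < \<theta>\<close> H_deriv in auto)
    then obtain t where "H \<theta> - H 0 = (\<theta> - 0) * (1 / sqrt (R (cos t)))" by blast
    then show ?thesis
      using mult_left_mono[OF mM(3)[of t], of \<theta>] mult_left_mono[OF mM(4)[of t], of \<theta>] that
      by (simp add: mult.commute)
  qed
  have pos': "0 \<le> H \<theta>" if "0 < \<theta>" for \<theta> using H_less[OF that] by simp
  show thesis
  proof (rule that[OF mM(1,2)])
    fix \<theta> :: real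
    consider "\<theta> = 0" | "0 < \<theta>" | "\<theta> < 0" by linarith
    then have "m * \<bar>\<theta>\<bar> \<le> \<bar>H \<theta>\<bar> \<and> \<bar>H \<theta>\<bar> \<le> M * \<bar>\<theta>\<bar>"
    proof cases
      case 2
      then show ?thesis using pos[OF 2] pos'[OF 2] by simp
    next
      case 3
      then show ?thesis using pos[of "- \<theta>"] pos'[of "- \<theta>"] by (simp add: H_minus)
    qed simp
    then show "m * \<bar>\<theta>\<bar> \<le> \<bar>H \<theta>\<bar>" "\<bar>H \<theta>\<bar> \<le> M * \<bar>\<theta>\<bar>" by auto
  qed
qed

lemma H_surj: "\<exists>\<theta>. H \<theta> = z"
proof -
  obtain m M where m: "0 < m" "\<And>\<theta>. m * \<bar>\<theta>\<bar> \<le> \<bar>H \<theta>\<bar>" using H_bounds by metis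
  define b where "b = \<bar>z\<bar> / m"
  have b: "0 \<le> b" using m by (simp add: b_def)
  have "m * \<bar>b\<bar> = \<bar>z\<bar>" using m by (simp add: b_def)
  moreover have "0 \<le> H b" using H_less[of 0 b] b by (cases "b = 0") auto
  ultimately have "\<bar>z\<bar> \<le> H b" using m(2)[of b] by simp
  then have "H (- b) \<le> z" "z \<le> H b" by (auto simp: H_minus)
  then show ?thesis
    using IVT[of H "- b" z b] b H_isCont by auto
qed

definition ang :: "real \<Rightarrow> real" where "ang = inv_into UNIV H"

lemma H_ang [simp]: "H (ang z) = z"
  using H_surj unfolding ang_def by (metis f_inv_into_f rangeI)

lemma inj_H: "inj H"
  using H_less by (intro injI) (metis less_irrefl linorder_less_linear)

lemma ang_H [simp]: "ang (H \<theta>) = \<theta>"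
  unfolding ang_def by (simp add: inj_H)

lemma ang_deriv: "(ang has_real_derivative sqrt (R (cos (ang z)))) (at z)"
proof -
  have "isCont ang (H (ang z))"
    by (rule isCont_inverse_function[where d = 1]) (auto intro: H_isCont)
  then have "(ang has_real_derivative inverse (1 / sqrt (R (cos (ang z))))) (at z)"
    using R_cos_pos[of "ang z"]
    by (intro DERIV_inverse_function[where f = H and a = "z - 1" and b = "z + 1"] H_deriv) auto
  then show ?thesis by simp
qed

lemma ang_minus: "ang (- z) = - ang z"
  using ang_H[of "- ang z"] by (simp add: H_minus)

lemma ang_add: "ang (z + of_int n * \<omega>) = ang z + 2 * pi * of_int n"
  using ang_H[of "ang z + 2 * pi * of_int n"] by (simp add: H_add_int)

definition period :: "real \<Rightarrow> bool" where "period z \<longleftrightarrow> (\<exists>n::int. z = of_int n * \<omega>)"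

lemma cos_ang_eq_1: "cos (ang z) = 1 \<longleftrightarrow> period z"
proof -
  have "cos (ang z) = 1 \<longleftrightarrow> (\<exists>n::int. ang z = 0 + 2 * pi * of_int n)"
    unfolding cos_one_2pi_int by (auto simp: algebra_simps)
  also have "\<dots> \<longleftrightarrow> (\<exists>n::int. z = of_int n * \<omega>)"
    by (metis H_0 H_ang H_add_int ang_H add_0)
  finally show ?thesis by (simp add: period_def)
qed

lemma cos_ang_less: "\<not> period z \<Longrightarrow> cos (ang z) < 1"
  using cos_ang_eq_1[of z] cos_le_one[of "ang z"] by linarith

definition X :: "real \<Rightarrow> real" where
  "X z = e + (1 + cos (ang z)) / (1 - cos (ang z))"

definition Y :: "real \<Rightarrow> real" where
  "Y z = - 2 * sin (ang z) * sqrt (R (cos (ang z))) / (1 - cos (ang z))\<^sup>2"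

lemma XY_curve:
  assumes "\<not> period z"
  shows "Y z ^ 2 = ec_rhs g2 g3 (X z)"
proof -
  define c v where "c = cos (ang z)" and "v = (1 + c) / (1 - c)"
  have c: "c < 1" using cos_ang_less[OF assms] by (simp add: c_def)
  have vc: "v * (1 - c) = 1 + c" using c by (simp add: v_def)
  have s: "sin (ang z) ^ 2 = 1 - c\<^sup>2" by (simp add: c_def sin_squared_eq)
  have "0 < R c" by (simp add: c_def)
  then have "Y z ^ 2 = 4 * (1 - c\<^sup>2) * R c / (1 - c) ^ 4"
    by (simp add: Y_def power_mult_distrib power_divide s flip: c_def)
  also have "\<dots> = 4 * v * (v\<^sup>2 + 3 * e * v + \<kappa>)"
  proof -
    have "4 * (1 - c\<^sup>2) * R c = 4 * v * (v\<^sup>2 + 3 * e * v + \<kappa>) * (1 - c) ^ 4"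
      using vc unfolding R_def by algebra
    then show ?thesis using c by (simp add: field_simps)
  qed
  also have "\<dots> = ec_rhs g2 g3 (X z)" by (simp add: ec_rhs_shift X_def v_def c_def)
  finally show ?thesis .
qed

lemma X_deriv:
  assumes "\<not> period z"
  shows "(X has_real_derivative Y z) (at z)"
proof -
  define c where "c = cos (ang z)"
  have c: "1 - c \<noteq> 0" using cos_ang_less[OF assms] by (simp add: c_def)
  have dc: "((\<lambda>z. cos (ang z)) has_real_derivative - sin (ang z) * sqrt (R c)) (at z)"
    unfolding c_def by (rule DERIV_fun_cos[OF ang_deriv])
  have "(X has_real_derivative 0 + ((0 + - sin (ang z) * sqrt (R c)) * (1 - c) - (1 + c) * (0 - - sin (ang z) * sqrt (R c))) / ((1 - c) * (1 - c))) (at z)"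
    unfolding X_def c_def using c by (intro DERIV_add DERIV_divide DERIV_diff DERIV_const dc[unfolded c_def]) (auto simp: c_def)
  moreover have "0 + ((0 + - sin (ang z) * sqrt (R c)) * (1 - c) - (1 + c) * (0 - - sin (ang z) * sqrt (R c))) / ((1 - c) * (1 - c)) = Y z"
    using c by (simp add: Y_def power2_eq_square algebra_simps flip: c_def)
  ultimately show ?thesis by metis
qed

text \<open>The second-order equation of \<wp>. Together with \<open>X_deriv\<close> it makes
  \<open>X\<close> and \<open>Y\<close> a flow as in the chord lemmas.\<close>

lemma Y_deriv:
  assumes "\<not> period z"
  shows "(Y has_real_derivative 6 * X z ^ 2 - g2 / 2) (at z)"
proof -
  define c s q where "c = cos (ang z)" and "s = sin (ang z)" and "q = sqrt (R c)"
  have c: "1 - c \<noteq> 0" using cos_ang_less[OF assms] by (simp add: c_def)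
  have Rc: "0 < R c" by (simp add: c_def)
  have q: "q\<^sup>2 = R c" "q \<noteq> 0" using Rc by (auto simp: q_def)
  have s: "s\<^sup>2 = 1 - c\<^sup>2" by (simp add: c_def s_def sin_squared_eq)
  have dc: "((\<lambda>z. cos (ang z)) has_real_derivative - s * q) (at z)"
    unfolding c_def s_def q_def by (rule DERIV_fun_cos[OF ang_deriv])
  have ds: "((\<lambda>z. sin (ang z)) has_real_derivative c * q) (at z)"
    unfolding c_def s_def q_def by (rule DERIV_fun_sin[OF ang_deriv])
  define R' where "R' = 2 * (1 + c) - 6 * e * c - 2 * \<kappa> * (1 - c)"
  have "(R has_real_derivative R') (at c)"
    unfolding R_def R'_def by (auto intro!: derivative_eq_intros simp: algebra_simps)
  from DERIV_chain2[OF this[unfolded c_def] dc]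
  have dR: "((\<lambda>z. R (cos (ang z))) has_real_derivative R' * (- s * q)) (at z)" .
  have "((\<lambda>x. sqrt x) has_real_derivative inverse (sqrt (R c)) / 2) (at (R c))"
    using DERIV_real_sqrt[OF Rc] .
  from DERIV_chain2[OF this[unfolded c_def] dR]
  have dq: "((\<lambda>z. sqrt (R (cos (ang z)))) has_real_derivative - s * R' / 2) (at z)"
    by (simp add: q_def c_def field_simps)
  have "(Y has_real_derivative
      (((0 * s + (c * q) * - 2) * q + - s * R' / 2 * (- 2 * s)) * (1 - c)\<^sup>2
        - (- 2 * s * q) * (2 * (1 - c) * (0 - - s * q))) / ((1 - c)\<^sup>2 * (1 - c)\<^sup>2)) (at z)"
  proof -
    have d1: "((\<lambda>z. - 2 * sin (ang z)) has_real_derivative 0 * s + (c * q) * - 2) (at z)"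
      unfolding s_def by (rule DERIV_mult[OF DERIV_const ds])
    have d2: "((\<lambda>z. - 2 * sin (ang z) * sqrt (R (cos (ang z)))) has_real_derivative
        (0 * s + (c * q) * - 2) * q + - s * R' / 2 * (- 2 * s)) (at z)"
      using DERIV_mult[OF d1 dq] by (simp add: s_def q_def c_def)
    have d3: "((\<lambda>z. (1 - cos (ang z))\<^sup>2) has_real_derivative 2 * (1 - c) * (0 - - s * q)) (at z)"
      using DERIV_power[OF DERIV_diff[OF DERIV_const dc], of 1 2] by (simp add: c_def algebra_simps)
    show ?thesis
      using DERIV_divide[OF d2 d3] c unfolding Y_def by (simp add: s_def q_def c_def)
  qed
  moreover have "(((0 * s + (c * q) * - 2) * q + - s * R' / 2 * (- 2 * s)) * (1 - c)\<^sup>2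
        - (- 2 * s * q) * (2 * (1 - c) * (0 - - s * q))) / ((1 - c)\<^sup>2 * (1 - c)\<^sup>2) = 6 * X z ^ 2 - g2 / 2"
  proof -
    define v where "v = (1 + c) / (1 - c)"
    have vc: "v * (1 - c) = 1 + c" using c by (simp add: v_def)
    have X: "X z = e + v" by (simp add: X_def v_def c_def)
    have g2: "g2 / 2 = 6 * e\<^sup>2 - 2 * \<kappa>" by (simp add: \<kappa>_def)
    have "((0 * s + (c * q) * - 2) * q + - s * R' / 2 * (- 2 * s)) * (1 - c)\<^sup>2
        - (- 2 * s * q) * (2 * (1 - c) * (0 - - s * q))
      = (- 2 * c * R c + (1 - c\<^sup>2) * R') * (1 - c)\<^sup>2 + 4 * (1 - c\<^sup>2) * R c * (1 - c)"
      using s q(1) by algebra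
    also have "\<dots> = (6 * (e + v) ^ 2 - g2 / 2) * ((1 - c)\<^sup>2 * (1 - c)\<^sup>2)"
    proof -
      have "(6 * (e + v) ^ 2 - g2 / 2) * ((1 - c)\<^sup>2 * (1 - c)\<^sup>2)
         = (6 * (v * (1 - c))\<^sup>2 + 12 * e * (v * (1 - c)) * (1 - c) + 2 * \<kappa> * (1 - c)\<^sup>2) * (1 - c)\<^sup>2"
        unfolding g2 by algebra
      also have "\<dots> = (- 2 * c * R c + (1 - c\<^sup>2) * R') * (1 - c)\<^sup>2 + 4 * (1 - c\<^sup>2) * R c * (1 - c)"
        unfolding vc R_def R'_def by algebra
      finally show ?thesis by simp
    qed
    finally show ?thesis using c by (simp add: X)
  qed
  ultimately show ?thesis by metis
qed

end

lemma ec_add_commute_chord: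
  assumes "x1 \<noteq> x2"
  shows "ec_add g2 (Aff x1 y1) (Aff x2 y2) = ec_add g2 (Aff x2 y2) (Aff x1 y1)"
proof -
  define l where "l = (y2 - y1) / (x2 - x1)"
  have l': "(y1 - y2) / (x1 - x2) = l" unfolding l_def by (metis minus_diff_eq minus_divide_divide)
  have "l * (x2 - x1) = y2 - y1" using assms by (simp add: l_def)
  then have "y1 + l * (x - x1) = y2 + l * (x - x2)" for x by algebra
  then show ?thesis using assms l' by (simp add: ec_third_def Let_def algebra_simps flip: l_def)
qed

context real_weierstrass
begin

section \<open>Periodicity and additivity of the parametrization\<close>

lemma period_add_int [simp]: "period (z + of_int n * \<omega>) \<longleftrightarrow> period z"
proof
  assume "period (z + of_int n * \<omega>)"
  then obtain m :: int where "z + of_int n * \<omega> = of_int m * \<omega>" by (auto simp: period_def)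
  then have "z = of_int (m - n) * \<omega>" by (simp add: algebra_simps)
  then show "period z" unfolding period_def by blast
next
  assume "period z"
  then obtain m :: int where "z = of_int m * \<omega>" by (auto simp: period_def)
  then have "z + of_int n * \<omega> = of_int (m + n) * \<omega>" by (simp add: algebra_simps)
  then show "period (z + of_int n * \<omega>)" unfolding period_def by blast
qed

lemma period_minus [simp]: "period (- z) \<longleftrightarrow> period z"
  using cos_ang_eq_1[of z] cos_ang_eq_1[of "- z"] by (simp add: ang_minus)

lemma not_period:
  assumes "z \<noteq> 0" "\<bar>z\<bar> < \<omega>"
  shows "\<not> period z"
proof
  assume "period z"
  then obtain n :: int where n: "z = of_int n * \<omega>" by (auto simp: period_def)
  then have "1 \<le> \<bar>real_of_int n\<bar>" using assms by (cases "n = 0") auto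
  then have "1 * \<omega> \<le> \<bar>real_of_int n\<bar> * \<omega>" using \<omega>_pos by (intro mult_right_mono) auto
  then show False using assms n \<omega>_pos by (simp add: abs_mult)
qed

lemma X_add_int [simp]: "X (z + of_int n * \<omega>) = X z" and Y_add_int [simp]: "Y (z + of_int n * \<omega>) = Y z"
  by (simp_all add: X_def Y_def ang_add cos_add sin_add cos_int_2pin sin_int_2pin)

lemma X_minus [simp]: "X (- z) = X z" and Y_minus [simp]: "Y (- z) = - Y z"
  by (simp_all add: X_def Y_def ang_minus)

lemma X_eq_imp:
  assumes "\<not> period z" "\<not> period w" "X z = X w"
  obtains n :: int where "z = w + of_int n * \<omega> \<or> z = - w + of_int n * \<omega>"
proof -
  have "cos (ang z) = cos (ang w)"
    using assms(3) cos_ang_less[OF assms(1)] cos_ang_less[OF assms(2)]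
    by (simp add: X_def field_simps)
  then obtain t where t: "t \<in> \<int>" "ang z = ang w + 2 * t * pi \<or> ang z = - ang w + 2 * t * pi"
    unfolding cos_eq by blast
  then obtain n :: int where n: "t = of_int n" by (auto elim: Ints_cases)
  have "ang z = ang w + 2 * pi * of_int n \<or> ang z = ang (- w) + 2 * pi * of_int n"
    using t(2) n by (simp add: ang_minus mult.commute mult.left_commute)
  then have "H (ang z) = w + of_int n * \<omega> \<or> H (ang z) = - w + of_int n * \<omega>"
    by (metis H_add_int H_ang)
  then show thesis using that by simp
qed

definition pt :: "real \<Rightarrow> ec_point" where
  "pt z = (if period z then Infty else Aff (X z) (Y z))"

lemma pt_add_int [simp]: "pt (z + of_int n * \<omega>) = pt z"
  by (simp add: pt_def)

text \<open>The first summand moves along \<open>u * d\<close> while the parameters keep the sum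
  \<open>c\<close>. The chord sum is constant for u in (0, 1] and tends to \<open>pt c\<close> as u
  tends to 0. The hypotheses keep both points finite and the chord non-vertical along the whole
  path.\<close>

lemma pt_chord_const:
  assumes np: "\<And>u. 0 < u \<Longrightarrow> u \<le> 1 \<Longrightarrow> \<not> period (u * d)"
    and npc: "\<And>u. 0 < u \<Longrightarrow> u \<le> 1 \<Longrightarrow> \<not> period (c - u * d)"
    and ne: "\<And>u. 0 < u \<Longrightarrow> u \<le> 1 \<Longrightarrow> X (u * d) \<noteq> X (c - u * d)"
    and c: "\<not> period c"
  shows "ec_add g2 (pt d) (pt (c - d)) = pt c"
proof -
  define x1 y1 x2 y2 where "x1 u = X (u * d)" and "y1 u = Y (u * d)"
    and "x2 u = X (c - u * d)" and "y2 u = Y (c - u * d)" for u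
  define l where "l u = (y2 u - y1 u) / (x2 u - x1 u)" for u
  define x3 where "x3 u = l u ^ 2 / 4 - x1 u - x2 u" for u
  define y3 where "y3 u = - (y1 u + l u * (x3 u - x1 u))" for u
  have zero: "(x3 has_real_derivative 0) (at u)" "(y3 has_real_derivative 0) (at u)"
    if u: "0 < u" "u \<le> 1" for u
  proof -
    have a: "((\<lambda>u. u * d) has_real_derivative d) (at u)" "((\<lambda>u. c - u * d) has_real_derivative - d) (at u)"
      by (auto intro!: derivative_eq_intros)
    have d1: "(x1 has_real_derivative d * y1 u) (at u)" "(y1 has_real_derivative d * (6 * x1 u ^ 2 - g2 / 2)) (at u)"
      using DERIV_chain2[OF X_deriv[OF np[OF u]] a(1)] DERIV_chain2[OF Y_deriv[OF np[OF u]] a(1)]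
      unfolding x1_def y1_def by (simp_all add: mult.commute)
    have d2: "(x2 has_real_derivative - d * y2 u) (at u)" "(y2 has_real_derivative - d * (6 * x2 u ^ 2 - g2 / 2)) (at u)"
      using DERIV_chain2[OF X_deriv[OF npc[OF u]] a(2)] DERIV_chain2[OF Y_deriv[OF npc[OF u]] a(2)]
      unfolding x2_def y2_def by (simp_all add: mult.commute)
    have cu: "y1 u ^ 2 = ec_rhs g2 g3 (x1 u)" "y2 u ^ 2 = ec_rhs g2 g3 (x2 u)" "x1 u \<noteq> x2 u"
      using XY_curve[OF np[OF u]] XY_curve[OF npc[OF u]] ne[OF u] by (auto simp: x1_def y1_def x2_def y2_def)
    show "(x3 has_real_derivative 0) (at u)" "(y3 has_real_derivative 0) (at u)"
      using chord_sum_has_derivative_0[OF d1 d2 cu] unfolding x3_def[abs_def] y3_def[abs_def] l_def by auto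
  qed
  have const: "f u = f 1" if f: "\<And>u. 0 < u \<Longrightarrow> u \<le> 1 \<Longrightarrow> (f has_real_derivative 0) (at u)" and u: "0 < u" "u \<le> 1"
    for f :: "real \<Rightarrow> real" and u
  proof -
    have "\<exists>k. \<forall>x\<in>{0<..1}. f x = k"
      by (rule has_field_derivative_zero_constant) (auto intro: DERIV_subset f)
    then show ?thesis using u by force
  qed
  have ev: "\<forall>\<^sub>F u in at_right (0::real). 0 < u \<and> u \<le> 1"
    unfolding eventually_at_right_field by (intro exI[of _ 1]) auto
  have ang0: "((\<lambda>u. cos (ang (u * d))) \<longlongrightarrow> 1) (at_right 0)"
  proof -
    have "isCont (\<lambda>u. cos (ang (u * d))) 0"
      by (intro continuous_intros isCont_o2[OF _ DERIV_isCont[OF ang_deriv]])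
    then have "((\<lambda>u. cos (ang (u * d))) \<longlongrightarrow> cos (ang (0 * d))) (at_right 0)"
      unfolding isCont_def by (rule filterlim_mono[OF _ order_refl]) (simp add: at_le)
    moreover have "ang 0 = 0" using ang_H[of 0] by simp
    ultimately show ?thesis by simp
  qed
  have x1_lim: "filterlim x1 at_top (at_right 0)"
  proof -
    have "filterlim (\<lambda>u. (1 + cos (ang (u * d))) / (1 - cos (ang (u * d)))) at_top (at_right 0)"
    proof (rule LIM_at_top_divide)
      show "((\<lambda>u. 1 + cos (ang (u * d))) \<longlongrightarrow> 2) (at_right 0)"
        by (rule tendsto_eq_intros ang0 refl | simp)+
      show "((\<lambda>u. 1 - cos (ang (u * d))) \<longlongrightarrow> 0) (at_right 0)"
        by (rule tendsto_eq_intros ang0 refl | simp)+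
      show "\<forall>\<^sub>F u in at_right 0. 0 < 1 - cos (ang (u * d))"
        using ev by eventually_elim (use np cos_ang_less in force)
    qed simp
    then show ?thesis
      unfolding x1_def X_def by (intro filterlim_tendsto_add_at_top[OF tendsto_const])
  qed
  have lim2: "(x2 \<longlongrightarrow> X c) (at_right 0)" "(y2 \<longlongrightarrow> Y c) (at_right 0)"
  proof -
    have cont: "isCont X (c - 0 * d)" "isCont Y (c - 0 * d)"
      using c by (auto intro: DERIV_isCont[OF X_deriv] DERIV_isCont[OF Y_deriv])
    have "isCont x2 0" "isCont y2 0"
      unfolding x2_def y2_def
      by (rule isCont_o2[where g = X], intro continuous_intros, rule cont(1))
        (rule isCont_o2[where g = Y], intro continuous_intros, rule cont(2))
    then have "(x2 \<longlongrightarrow> x2 0) (at_right 0)" "(y2 \<longlongrightarrow> y2 0) (at_right 0)"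
      unfolding isCont_def by (auto intro: filterlim_mono[OF _ order_refl] simp: at_le)
    then show "(x2 \<longlongrightarrow> X c) (at_right 0)" "(y2 \<longlongrightarrow> Y c) (at_right 0)" by (auto simp: x2_def y2_def)
  qed
  have c1: "\<forall>\<^sub>F u in at_right 0. y1 u ^ 2 = ec_rhs g2 g3 (x1 u)"
    and c2: "\<forall>\<^sub>F u in at_right 0. y2 u ^ 2 = ec_rhs g2 g3 (x2 u)"
    using ev by (eventually_elim, simp add: x1_def y1_def x2_def y2_def XY_curve np npc)+
  have lim3: "(x3 \<longlongrightarrow> X c) (at_right 0)" "(y3 \<longlongrightarrow> Y c) (at_right 0)"
    using chord_sum_tendsto[OF x1_lim c1 c2 lim2] unfolding x3_def[abs_def] y3_def[abs_def] l_def by auto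
  have eqc: "f 1 = L" if "(f \<longlongrightarrow> L) (at_right 0)" "\<And>u. 0 < u \<Longrightarrow> u \<le> 1 \<Longrightarrow> (f has_real_derivative 0) (at u)"
    for f :: "real \<Rightarrow> real" and L
  proof -
    have "\<forall>\<^sub>F u in at_right 0. f u = f 1" using ev by eventually_elim (use const[OF that(2)] in blast)
    then have "((\<lambda>u::real. f 1) \<longlongrightarrow> L) (at_right 0)" by (rule Lim_transform_eventually[OF that(1)])
    then show ?thesis by (simp add: tendsto_const_iff)
  qed
  have "x3 1 = X c" "y3 1 = Y c" using eqc[OF lim3(1) zero(1)] eqc[OF lim3(2) zero(2)] by auto
  moreover have "ec_add g2 (pt d) (pt (c - d)) = Aff (x3 1) (y3 1)"
    using np[of 1] npc[of 1] ne[of 1]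
    by (simp add: pt_def ec_third_def Let_def x3_def y3_def l_def x1_def x2_def y1_def y2_def)
  ultimately show ?thesis using c by (simp add: pt_def)
qed

text \<open>The order of the absolute values makes the path of \<open>pt_chord_const\<close> safe.
  Equal abscissae would make the sum \<open>c\<close> or the difference
  \<open>(2 * u - 1) * t1 - t2\<close> of the parameters a period; like \<open>u * t1\<close> and
  \<open>t2 + (1 - u) * t1\<close>, both are nonzero and smaller than \<omega> in absolute
  value.\<close>

lemma pt_add_less:
  assumes t: "t1 \<noteq> 0" "\<bar>t1\<bar> < \<bar>t2\<bar>" "\<bar>t2\<bar> \<le> \<omega> / 2"
  shows "ec_add g2 (pt t1) (pt t2) = pt (t1 + t2)" "X t1 \<noteq> X t2"
proof -
  define c where "c = t1 + t2"
  have c: "\<not> period c" unfolding c_def by (rule not_period) (use t in linarith)+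
  have ut: "u * t1 \<noteq> 0" "\<bar>u * t1\<bar> \<le> \<bar>t1\<bar>" "\<bar>(1 - u) * t1\<bar> \<le> \<bar>t1\<bar>" "\<bar>(2 * u - 1) * t1\<bar> \<le> \<bar>t1\<bar>"
    if "0 < u" "u \<le> 1" for u
    using that t(1) by (auto simp: abs_mult intro!: mult_left_le_one_le)
  have np: "\<not> period (u * t1)" if "0 < u" "u \<le> 1" for u
    by (rule not_period) (use ut[OF that] t in linarith)+
  have npc: "\<not> period (c - u * t1)" if "0 < u" "u \<le> 1" for u
  proof -
    have "c - u * t1 = t2 + (1 - u) * t1" by (simp add: c_def algebra_simps)
    then show ?thesis by (intro not_period) (use ut(3)[OF that] t in linarith)+
  qed
  have ne: "X (u * t1) \<noteq> X (c - u * t1)" if u: "0 < u" "u \<le> 1" for u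
  proof
    assume "X (u * t1) = X (c - u * t1)"
    then obtain n :: int where "u * t1 = c - u * t1 + of_int n * \<omega> \<or> u * t1 = - (c - u * t1) + of_int n * \<omega>"
      using X_eq_imp[OF np[OF u] npc[OF u]] by metis
    then have "(2 * u - 1) * t1 - t2 = of_int n * \<omega> \<or> c = of_int n * \<omega>"
      by (auto simp: c_def algebra_simps)
    then have "period ((2 * u - 1) * t1 - t2) \<or> period c" unfolding period_def by blast
    moreover have "\<not> period ((2 * u - 1) * t1 - t2)"
      by (rule not_period) (use ut(4)[OF u] t in linarith)+
    ultimately show False using c by simp
  qed
  show "ec_add g2 (pt t1) (pt t2) = pt (t1 + t2)"
    using pt_chord_const[OF np npc ne c] by (simp add: c_def)
  show "X t1 \<noteq> X t2" using ne[of 1] by (simp add: c_def)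
qed

lemma pt_add_neq:
  assumes t: "t1 \<noteq> 0" "t2 \<noteq> 0" "\<bar>t1\<bar> \<noteq> \<bar>t2\<bar>" "\<bar>t1\<bar> \<le> \<omega> / 2" "\<bar>t2\<bar> \<le> \<omega> / 2"
  shows "ec_add g2 (pt t1) (pt t2) = pt (t1 + t2)" "X t1 \<noteq> X t2"
proof -
  have "ec_add g2 (pt t1) (pt t2) = pt (t1 + t2) \<and> X t1 \<noteq> X t2"
  proof (cases "\<bar>t1\<bar> < \<bar>t2\<bar>")
    case True
    then show ?thesis using pt_add_less t by blast
  next
    case False
    then have "\<bar>t2\<bar> < \<bar>t1\<bar>" using t by simp
    from pt_add_less[OF t(2) this t(4)]
    have *: "ec_add g2 (pt t2) (pt t1) = pt (t2 + t1)" "X t2 \<noteq> X t1" by auto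
    have "\<not> period t1" "\<not> period t2" by (rule not_period; use t \<omega>_pos in linarith)+
    then have "ec_add g2 (pt t1) (pt t2) = ec_add g2 (pt t2) (pt t1)"
      using ec_add_commute_chord[OF *(2), of g2 "Y t2" "Y t1"] by (simp only: pt_def if_False)
    then show ?thesis using * by (auto simp: add.commute)
  qed
  then show "ec_add g2 (pt t1) (pt t2) = pt (t1 + t2)" "X t1 \<noteq> X t2" by auto
qed

lemma Y_nonzero:
  assumes "t \<noteq> 0" "\<bar>t\<bar> < \<omega> / 2"
  shows "Y t \<noteq> 0"
proof
  assume "Y t = 0"
  moreover have "\<not> period t" using assms \<omega>_pos by (intro not_period) auto
  ultimately have "sin (ang t) = 0" using cos_ang_less[of t] by (auto simp: Y_def)
  then obtain n :: int where "ang t = of_int n * pi" unfolding sin_zero_iff_int2 by blast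
  then have "ang t = ang (- t) + 2 * pi * of_int n" by (simp add: ang_minus)
  then have "H (ang t) = - t + of_int n * \<omega>" by (metis H_add_int H_ang)
  then have "2 * t = of_int n * \<omega>" by simp
  then have "period (2 * t)" unfolding period_def by blast
  moreover have "\<not> period (2 * t)" using assms by (intro not_period) auto
  ultimately show False by simp
qed

text \<open>The tangent as a limit of chords: the sum of \<open>pt t\<close> and
  \<open>pt (t + h)\<close> is known for small nonzero \<open>h\<close>, and the chord slope tends
  to Y' / X', the tangent slope, because \<open>Y t\<close> does not vanish.\<close>

lemma pt_double:
  assumes t: "t \<noteq> 0" "\<bar>t\<bar> < \<omega> / 2"
  shows "ec_add g2 (pt t) (pt t) = pt (t + t)"
proof -
  have np: "\<not> period t" using t \<omega>_pos by (intro not_period) auto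
  have np2: "\<not> period (t + t)" using t by (intro not_period) auto
  have Yt: "Y t \<noteq> 0" using Y_nonzero[OF t] .
  define l where "l h = (Y (t + h) - Y t) / (X (t + h) - X t)" for h
  define x3 where "x3 h = l h ^ 2 / 4 - X t - X (t + h)" for h
  define y3 where "y3 h = - (Y t + l h * (x3 h - X t))" for h
  have ev: "\<forall>\<^sub>F h in at 0. X (t + t + h) = x3 h \<and> Y (t + t + h) = y3 h"
  proof -
    define r where "r = min (\<bar>t\<bar>) (\<omega> / 2 - \<bar>t\<bar>)"
    have "0 < r" using t by (simp add: r_def)
    then have "\<forall>\<^sub>F h in at 0. h \<noteq> 0 \<and> \<bar>h\<bar> < r"
      unfolding eventually_at by (intro exI[of _ r]) auto
    then show ?thesis
    proof eventually_elim
      case (elim h)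
      have th: "t + h \<noteq> 0" "\<bar>t\<bar> \<noteq> \<bar>t + h\<bar>" "\<bar>t + h\<bar> < \<omega> / 2" using elim unfolding r_def by linarith+
      have "\<not> period (t + h)" using th \<omega>_pos by (intro not_period) auto
      moreover have "\<not> period (t + (t + h))" by (rule not_period) (use th t elim in \<open>unfold r_def, linarith\<close>)+
      moreover have "ec_add g2 (pt t) (pt (t + h)) = pt (t + (t + h))" "X t \<noteq> X (t + h)"
        using pt_add_neq[OF t(1) th(1,2)] th(3) t(2) by auto
      ultimately have "ec_third (l h) (X t) (Y t) (X (t + h)) = Aff (X (t + t + h)) (Y (t + t + h))"
        using np by (simp add: pt_def l_def add.assoc)
      then show ?case unfolding ec_third_def Let_def x3_def[symmetric] y3_def[symmetric] by simp
    qed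
  qed
  have q: "((\<lambda>h. (X (t + h) - X t) / h) \<longlongrightarrow> Y t) (at 0)"
    "((\<lambda>h. (Y (t + h) - Y t) / h) \<longlongrightarrow> 6 * X t ^ 2 - g2 / 2) (at 0)"
    using X_deriv[OF np] Y_deriv[OF np] by (simp_all add: DERIV_def)
  define l0 where "l0 = (12 * X t ^ 2 - g2) / (2 * Y t)"
  have l: "(l \<longlongrightarrow> l0) (at 0)"
  proof -
    have "((\<lambda>h. ((Y (t + h) - Y t) / h) / ((X (t + h) - X t) / h)) \<longlongrightarrow> (6 * X t ^ 2 - g2 / 2) / Y t) (at 0)"
      using q Yt by (intro tendsto_divide)
    moreover have "\<forall>\<^sub>F h in at 0. ((Y (t + h) - Y t) / h) / ((X (t + h) - X t) / h) = l h"
      unfolding eventually_at by (intro exI[of _ 1]) (auto simp: l_def)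
    ultimately have "(l \<longlongrightarrow> (6 * X t ^ 2 - g2 / 2) / Y t) (at 0)" by (rule Lim_transform_eventually)
    moreover have "(6 * X t ^ 2 - g2 / 2) / Y t = l0" by (simp add: l0_def field_simps)
    ultimately show ?thesis by simp
  qed
  have cX: "((\<lambda>h. X (s + h)) \<longlongrightarrow> X s) (at 0)" and cY: "((\<lambda>h. Y (s + h)) \<longlongrightarrow> Y s) (at 0)" if "\<not> period s" for s
    using DERIV_isCont[OF X_deriv[OF that]] DERIV_isCont[OF Y_deriv[OF that]] by (simp_all add: isCont_iff)
  have x3: "(x3 \<longlongrightarrow> l0 ^ 2 / 4 - X t - X t) (at 0)"
    unfolding x3_def by (intro tendsto_intros l cX np) auto
  have y3: "(y3 \<longlongrightarrow> - (Y t + l0 * (l0 ^ 2 / 4 - X t - X t - X t))) (at 0)"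
    unfolding y3_def by (intro tendsto_intros l x3)
  have "((\<lambda>h. X (t + t + h)) \<longlongrightarrow> l0 ^ 2 / 4 - X t - X t) (at 0)"
    using x3 by (rule Lim_transform_eventually) (use ev in eventually_elim, simp)
  then have 1: "X (t + t) = l0 ^ 2 / 4 - X t - X t"
    using cX[OF np2] tendsto_unique[OF at_neq_bot] by blast
  have "((\<lambda>h. Y (t + t + h)) \<longlongrightarrow> - (Y t + l0 * (l0 ^ 2 / 4 - X t - X t - X t))) (at 0)"
    using y3 by (rule Lim_transform_eventually) (use ev in eventually_elim, simp)
  then have 2: "Y (t + t) = - (Y t + l0 * (l0 ^ 2 / 4 - X t - X t - X t))"
    using cY[OF np2] tendsto_unique[OF at_neq_bot] by blast
  show ?thesis
    using np np2 Yt 1 2 by (simp add: pt_def ec_third_def Let_def l0_def)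
qed

lemma pt_add: "ec_add g2 (pt s) (pt t) = pt (s + t)"
proof -
  have red: "\<exists>n::int. - \<omega> / 2 < z + of_int n * \<omega> \<and> z + of_int n * \<omega> \<le> \<omega> / 2" for z
  proof -
    define n where "n = - \<lceil>z / \<omega> - 1 / 2\<rceil>"
    have "- 1 / 2 < z / \<omega> + of_int n \<and> z / \<omega> + of_int n \<le> 1 / 2" unfolding n_def by linarith
    then have "- 1 / 2 * \<omega> < (z / \<omega> + of_int n) * \<omega> \<and> (z / \<omega> + of_int n) * \<omega> \<le> 1 / 2 * \<omega>"
      using \<omega>_pos mult_less_cancel_right_pos mult_le_cancel_right_pos by blast
    moreover have "(z / \<omega> + of_int n) * \<omega> = z + of_int n * \<omega>" using \<omega>_pos by (simp add: distrib_right)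
    ultimately show ?thesis by auto
  qed
  obtain m n :: int where m: "- \<omega> / 2 < s + of_int m * \<omega>" "s + of_int m * \<omega> \<le> \<omega> / 2"
    and n: "- \<omega> / 2 < t + of_int n * \<omega>" "t + of_int n * \<omega> \<le> \<omega> / 2"
    using red[of s] red[of t] by auto
  define s' t' where "s' = s + of_int m * \<omega>" and "t' = t + of_int n * \<omega>"
  have b: "\<bar>s'\<bar> \<le> \<omega> / 2" "\<bar>t'\<bar> \<le> \<omega> / 2" using m n unfolding s'_def t'_def by linarith+
  have p0: "pt 0 = Infty" by (auto simp: pt_def period_def intro: exI[of _ 0])
  have "ec_add g2 (pt s') (pt t') = pt (s' + t')"
  proof (cases "s' = 0 \<or> t' = 0")
    case True
    then show ?thesis using p0 by (auto, cases "pt s'", auto)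
  next
    case nz: False
    have np: "\<not> period s'" "\<not> period t'" by (rule not_period; use nz b \<omega>_pos in linarith)+
    show ?thesis
    proof (cases "\<bar>s'\<bar> = \<bar>t'\<bar>")
      case False
      then show ?thesis using nz b by (intro pt_add_neq) auto
    next
      case True
      then consider "s' = - t'" | "s' = t'" "\<bar>t'\<bar> < \<omega> / 2" | "s' = t'" "\<bar>t'\<bar> = \<omega> / 2"
        using b by linarith
      then show ?thesis
      proof cases
        case 1
        then show ?thesis using np p0 by (simp add: pt_def)
      next
        case 2
        then show ?thesis using nz pt_double by auto
      next
        case 3
        \<comment> \<open>The reduced range excludes \<open>- \<omega> / 2\<close>, so this is the
          2-torsion point (e, 0). Its ordinate vanishes because \<open>Y\<close> is odd and
          periodic, and the addition law returns \<open>Infty\<close>.\<close>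
        then have t': "t' = \<omega> / 2" using n unfolding t'_def[symmetric] by linarith
        have "Y (- (\<omega> / 2) + of_int 1 * \<omega>) = - Y (\<omega> / 2)" unfolding Y_add_int by simp
        then have "Y t' = 0" by (simp add: t')
        moreover have "pt (t' + t') = pt (0 + of_int 1 * \<omega>)" by (simp add: t')
        ultimately show ?thesis using 3(1) np p0 unfolding pt_add_int by (simp add: pt_def)
      qed
    qed
  qed
  moreover have "s' + t' = (s + t) + of_int (m + n) * \<omega>" by (simp add: s'_def t'_def algebra_simps)
  ultimately show ?thesis by (simp only: s'_def t'_def pt_add_int)
qed

lemma pt_pow: "pt z [^]\<^bsub>ec_group g2 g3\<^esub> (n::nat) = pt (real n * z)"
proof (induction n)
  case 0
  have "period 0" by (auto simp: period_def intro: exI[of _ 0])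
  then show ?case by (simp add: nat_pow_def ec_group_def pt_def)
next
  case (Suc n)
  then show ?case by (simp add: nat_pow_def ec_group_def pt_add algebra_simps)
qed

end

section \<open>Translation to the oval\<close>

text \<open>
  The line \<open>y = l x + m\<close> meets the curve in points with abscissae \<open>x1\<close>, \<open>x2\<close>, \<open>x3\<close>: Vieta's formulas
  for \<open>ec_rhs g2 g3 x - (l x + m)\<^sup>2 = 4 (x - x1) (x - x2) (x - x3)\<close>, which cover chords and tangents alike.
\<close>

definition ec_line :: "real \<Rightarrow> real \<Rightarrow> real \<Rightarrow> real \<Rightarrow> real \<Rightarrow> real \<Rightarrow> real \<Rightarrow> bool" where
  "ec_line g2 g3 l m x1 x2 x3 \<longleftrightarrow>
    l\<^sup>2 = 4 * (x1 + x2 + x3) \<and> - 2 * l * m - g2 = 4 * (x1 * x2 + x1 * x3 + x2 * x3) \<and>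
    m\<^sup>2 + g3 = 4 * x1 * x2 * x3"

lemma ec_add_if_line:
  assumes line: "ec_line g2 g3 l m x1 x2 x3" and y: "y1 = l * x1 + m" "y2 = l * x2 + m"
    and ne: "\<not> (x1 = x2 \<and> y1 = - y2)"
  shows "ec_add g2 (Aff x1 y1) (Aff x2 y2) = Aff x3 (- (l * x3 + m))"
proof -
  have x3: "l\<^sup>2 / 4 - x1 - x2 = x3" using line by (simp add: ec_line_def field_simps)
  have third: "ec_third l x1 y1 x2 = Aff x3 (- (l * x3 + m))"
  proof -
    have "y1 + l * (x3 - x1) = l * x3 + m" by (simp add: y(1) algebra_simps)
    then show ?thesis by (simp add: ec_third_def Let_def x3)
  qed
  show ?thesis
  proof (cases "x1 = x2")
    case False
    then have "(y2 - y1) / (x2 - x1) = l" by (simp add: y field_simps)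
    then show ?thesis using False third by simp
  next
    case True
    then have y1: "y1 \<noteq> 0" using ne y by auto
    have "2 * y1 * l = 12 * x1\<^sup>2 - g2"
      using line unfolding ec_line_def y True by algebra
    then have "(12 * x1\<^sup>2 - g2) / (2 * y1) = l" using y1 by (simp add: field_simps)
    then show ?thesis using True ne third by simp
  qed
qed

lemma ec_line_if_add:
  assumes c: "y1\<^sup>2 = ec_rhs g2 g3 x1" "y2\<^sup>2 = ec_rhs g2 g3 x2" and ne: "\<not> (x1 = x2 \<and> y1 = - y2)"
  obtains l m x3 where "ec_line g2 g3 l m x1 x2 x3" "y1 = l * x1 + m" "y2 = l * x2 + m"
proof -
  define l where "l = (if x1 = x2 then (12 * x1\<^sup>2 - g2) / (2 * y1) else (y2 - y1) / (x2 - x1))"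
  define m where "m = y1 - l * x1"
  define x3 where "x3 = l\<^sup>2 / 4 - x1 - x2"
  have m: "y1 = l * x1 + m" by (simp add: m_def)
  have l2: "l\<^sup>2 = 4 * (x1 + x2 + x3)" by (simp add: x3_def)
  show thesis
  proof (cases "x1 = x2")
    case True
    then have y: "y2 = y1" "y1 \<noteq> 0" using c ne power2_eq_iff[of y1 y2] by auto
    have l: "2 * y1 * l = 12 * x1\<^sup>2 - g2" using True y by (simp add: l_def)
    have b: "- 2 * l * m - g2 = 4 * (x1 * x2 + x1 * x3 + x2 * x3)"
      using l l2 True unfolding m_def by algebra
    moreover have "m\<^sup>2 + g3 = 4 * x1 * x2 * x3"
      using c(1) l2 b True unfolding m_def ec_rhs_def by algebra
    ultimately show thesis using that[of l m x3] l2 m y True by (simp add: ec_line_def)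
  next
    case False
    then have l: "l * (x2 - x1) = y2 - y1" by (simp add: l_def)
    then have y2: "y2 = l * x2 + m" by (simp add: m_def algebra_simps)
    have "(x1 - x2) * (- 2 * l * m - g2) = (x1 - x2) * (4 * (x1 * x2 + x1 * x3 + x2 * x3))"
      using c l2 unfolding ec_rhs_def m y2 by algebra
    then have b: "- 2 * l * m - g2 = 4 * (x1 * x2 + x1 * x3 + x2 * x3)" using False by simp
    moreover have "m\<^sup>2 + g3 = 4 * x1 * x2 * x3"
      using c(1) l2 b unfolding ec_rhs_def m by algebra
    ultimately show thesis using that[of l m x3] l2 m y2 by (simp add: ec_line_def)
  qed
qed

text \<open>Translation by the 2-torsion point \<open>(h, 0)\<close>.\<close>

definition ec_trans :: "real \<Rightarrow> real \<Rightarrow> ec_point \<Rightarrow> ec_point" where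
  "ec_trans g2 h P = (case P of Infty \<Rightarrow> Aff h 0 | Aff x y \<Rightarrow>
     Aff (h + (3 * h\<^sup>2 - g2 / 4) / (x - h)) (- (3 * h\<^sup>2 - g2 / 4) * y / (x - h)\<^sup>2))"

text \<open>Translating two of three collinear points by a 2-torsion point keeps the triple collinear.\<close>

lemma ec_line_trans:
  assumes line: "ec_line g2 g3 l m x1 x2 x3" and h: "ec_rhs g2 g3 h = 0" "x1 \<noteq> h" "x2 \<noteq> h"
  defines "k \<equiv> 3 * h\<^sup>2 - g2 / 4"
  obtains l' m' where "ec_line g2 g3 l' m' (h + k / (x1 - h)) (h + k / (x2 - h)) x3"
    "l' * (h + k / (x1 - h)) + m' = - k * (l * x1 + m) / (x1 - h)\<^sup>2"
    "l' * (h + k / (x2 - h)) + m' = - k * (l * x2 + m) / (x2 - h)\<^sup>2"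
    "l' * x3 + m' = l * x3 + m"
proof -
  define v1 v2 v3 n where "v1 = x1 - h" and "v2 = x2 - h" and "v3 = x3 - h" and "n = l * h + m"
  have v: "x1 = h + v1" "x2 = h + v2" "x3 = h + v3" "m = n - l * h" by (auto simp: v1_def v2_def v3_def n_def)
  have nz: "v1 \<noteq> 0" "v2 \<noteq> 0" using h by (auto simp: v1_def v2_def)
  have g2: "g2 = 12 * h\<^sup>2 - 4 * k" by (simp add: k_def)
  have g3: "g3 = 4 * h ^ 3 - g2 * h" using h(1) by (simp add: ec_rhs_def)
  have i: "l\<^sup>2 = 4 * (v1 + v2 + v3) + 12 * h" using line unfolding ec_line_def v by algebra
  have ii: "4 * k - 2 * l * n = 4 * (v1 * v2 + v1 * v3 + v2 * v3)"
    using line g2 unfolding ec_line_def v by algebra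
  have iii: "n\<^sup>2 = 4 * v1 * v2 * v3"
    using line g2 g3 unfolding ec_line_def v by algebra
  define a b where "a = 1 / v1" and "b = 1 / v2"
  have ab: "a * v1 = 1" "b * v2 = 1" using nz by (auto simp: a_def b_def)
  \<comment> \<open>The slope between the translated points: their ordinates are
    \<open>- k * (l * a + n * a\<^sup>2)\<close> and \<open>- k * (l * b + n * b\<^sup>2)\<close>
    and their abscissae differ by \<open>k * (a - b)\<close>. After cancelling \<open>a - b\<close>
    the formula also covers tangents. \<open>m'\<close> then puts the third point on the new
    line.\<close>
  define l' where "l' = - l - n * (a + b)"
  define m' where "m' = l * x3 + m - l' * x3"
  define n' where "n' = n + (l - l') * v3"
  have m': "m' = n' - l' * h" by (simp add: m'_def n'_def v algebra_simps)
  have i': "l'\<^sup>2 = 4 * (k * a + k * b + v3) + 12 * h"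
    using i ii iii ab unfolding l'_def by algebra
  have y1: "l' * (k * a) + n' = - k * (l * v1 + n) * a\<^sup>2"
    using i ii iii ab unfolding l'_def n'_def by algebra
  have y2: "l' * (k * b) + n' = - k * (l * v2 + n) * b\<^sup>2"
    using i ii iii ab unfolding l'_def n'_def by algebra
  have ii': "4 * k - 2 * l' * n' = 4 * (k * a * k * b + k * a * v3 + k * b * v3)"
    using i ii iii ab unfolding l'_def n'_def by algebra
  have iii': "n'\<^sup>2 = 4 * (k * a) * (k * b) * v3"
    using i ii iii ab unfolding l'_def n'_def by algebra
  have t: "k / (x1 - h) = k * a" "k / (x2 - h) = k * b" "- k * y / (x1 - h)\<^sup>2 = - k * y * a\<^sup>2"
      "- k * y / (x2 - h)\<^sup>2 = - k * y * b\<^sup>2" for y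
    by (simp_all add: a_def b_def v1_def v2_def power_divide)
  show thesis
  proof (rule that[of l' m'])
    have "m'\<^sup>2 + g3 = 4 * (h + k * a) * (h + k * b) * (h + v3)"
      unfolding g3 m' using g2 i' ii' iii' by algebra
    moreover have "- 2 * l' * m' - g2 = 4 * ((h + k * a) * (h + k * b) + (h + k * a) * (h + v3) + (h + k * b) * (h + v3))"
      unfolding m' using g2 i' ii' by algebra
    moreover have "l'\<^sup>2 = 4 * ((h + k * a) + (h + k * b) + (h + v3))" using i' by simp
    ultimately show "ec_line g2 g3 l' m' (h + k / (x1 - h)) (h + k / (x2 - h)) x3"
      unfolding t ec_line_def v(3) by simp
    show "l' * (h + k / (x1 - h)) + m' = - k * (l * x1 + m) / (x1 - h)\<^sup>2"
      unfolding t m' using y1 by (simp add: v algebra_simps)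
    show "l' * (h + k / (x2 - h)) + m' = - k * (l * x2 + m) / (x2 - h)\<^sup>2"
      unfolding t m' using y2 by (simp add: v algebra_simps)
    show "l' * x3 + m' = l * x3 + m" by (simp add: m'_def)
  qed
qed

text \<open>(P + T) + (Q + T) = P + Q for T = (h, 0): by \<open>ec_line_trans\<close> the line
  through the two translates meets the curve in the same third point as the line through P and
  Q.\<close>

lemma ec_add_trans_trans:
  assumes c: "y1\<^sup>2 = ec_rhs g2 g3 x1" "y2\<^sup>2 = ec_rhs g2 g3 x2" and ne: "\<not> (x1 = x2 \<and> y1 = - y2)"
    and h: "ec_rhs g2 g3 h = 0" "x1 \<noteq> h" "x2 \<noteq> h" and k: "12 * h\<^sup>2 \<noteq> g2"
  shows "ec_add g2 (ec_trans g2 h (Aff x1 y1)) (ec_trans g2 h (Aff x2 y2)) = ec_add g2 (Aff x1 y1) (Aff x2 y2)"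
proof -
  define k where "k = 3 * h\<^sup>2 - g2 / 4"
  have k0: "k \<noteq> 0" using \<open>12 * h\<^sup>2 \<noteq> g2\<close> by (simp add: k_def)
  obtain l m x3 where line: "ec_line g2 g3 l m x1 x2 x3" and y: "y1 = l * x1 + m" "y2 = l * x2 + m"
    using ec_line_if_add[OF c ne] by metis
  obtain l' m' where line': "ec_line g2 g3 l' m' (h + k / (x1 - h)) (h + k / (x2 - h)) x3"
    and y': "l' * (h + k / (x1 - h)) + m' = - k * y1 / (x1 - h)\<^sup>2"
      "l' * (h + k / (x2 - h)) + m' = - k * y2 / (x2 - h)\<^sup>2" "l' * x3 + m' = l * x3 + m"
    using ec_line_trans[OF line h] unfolding k_def y by metis
  have "\<not> (h + k / (x1 - h) = h + k / (x2 - h) \<and> - k * y1 / (x1 - h)\<^sup>2 = - (- k * y2 / (x2 - h)\<^sup>2))"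
  proof
    assume *: "h + k / (x1 - h) = h + k / (x2 - h) \<and> - k * y1 / (x1 - h)\<^sup>2 = - (- k * y2 / (x2 - h)\<^sup>2)"
    then have "k / (x1 - h) = k / (x2 - h)" by simp
    then have "x1 = x2" using k0 h by (simp add: field_simps)
    moreover from this have "k * (y1 + y2) = 0" using * h by (simp add: field_simps)
    ultimately show False using ne k0 by auto
  qed
  from ec_add_if_line[OF line' y'(1)[symmetric] y'(2)[symmetric] this] ec_add_if_line[OF line y ne]
  show ?thesis by (simp add: ec_trans_def y'(3) flip: k_def)
qed

text \<open>P + (Q + T) = (P + Q) + T. Here the second and third of the three collinear points are
  translated and the first is kept, so that one summand and the sum move together.\<close>

lemma ec_add_trans:
  assumes c: "y1\<^sup>2 = ec_rhs g2 g3 x1" "y2\<^sup>2 = ec_rhs g2 g3 x2" and ne: "\<not> (x1 = x2 \<and> y1 = - y2)"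
    and h: "ec_rhs g2 g3 h = 0" "x2 \<noteq> h" and ne': "x1 \<noteq> h + (3 * h\<^sup>2 - g2 / 4) / (x2 - h)"
    and add: "ec_add g2 (Aff x1 y1) (Aff x2 y2) = Aff x3 y3" and x3: "x3 \<noteq> h"
  shows "ec_add g2 (Aff x1 y1) (ec_trans g2 h (Aff x2 y2)) = ec_trans g2 h (Aff x3 y3)"
proof -
  define k where "k = 3 * h\<^sup>2 - g2 / 4"
  obtain l m x3' where line': "ec_line g2 g3 l m x1 x2 x3'" and y: "y1 = l * x1 + m" "y2 = l * x2 + m"
    using ec_line_if_add[OF c ne] by metis
  have "x3' = x3" "y3 = - (l * x3 + m)" using ec_add_if_line[OF line' y ne] add by auto
  then have "ec_line g2 g3 l m x2 x3 x1" and y3: "l * x3 + m = - y3"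
    using line' by (auto simp: ec_line_def algebra_simps)
  from ec_line_trans[OF this(1) h x3]
  obtain l' m' where line': "ec_line g2 g3 l' m' (h + k / (x2 - h)) (h + k / (x3 - h)) x1"
    and y': "l' * (h + k / (x2 - h)) + m' = - k * y2 / (x2 - h)\<^sup>2"
      "l' * (h + k / (x3 - h)) + m' = - k * (- y3) / (x3 - h)\<^sup>2" "l' * x1 + m' = y1"
    unfolding k_def y(1,2) y3 by metis
  have "ec_line g2 g3 l' m' x1 (h + k / (x2 - h)) (h + k / (x3 - h))"
    using line' by (auto simp: ec_line_def algebra_simps)
  from ec_add_if_line[OF this y'(3)[symmetric] y'(1)[symmetric]] ne'
  show ?thesis by (simp add: ec_trans_def y'(2) flip: k_def)
qed

lemma ec_trans_curve:
  assumes c: "y\<^sup>2 = ec_rhs g2 g3 x" and h: "ec_rhs g2 g3 h = 0" "x \<noteq> h"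
  defines "k \<equiv> 3 * h\<^sup>2 - g2 / 4"
  shows "(- k * y / (x - h)\<^sup>2)\<^sup>2 = ec_rhs g2 g3 (h + k / (x - h))"
proof -
  define v a where "v = x - h" and "a = 1 / v"
  have x: "x = h + v" by (simp add: v_def)
  have av: "a * v = 1" using h by (simp add: a_def v_def)
  have g2: "g2 = 12 * h\<^sup>2 - 4 * k" by (simp add: k_def)
  have g3: "g3 = 4 * h ^ 3 - g2 * h" using h(1) by (simp add: ec_rhs_def)
  have c': "y\<^sup>2 = 4 * v * (v\<^sup>2 + 3 * h * v + k)"
    using c g2 g3 unfolding ec_rhs_def x by algebra
  have "(- k * y * a\<^sup>2)\<^sup>2 = 4 * (h + k * a) ^ 3 - g2 * (h + k * a) - g3"
    using c' g2 g3 av by algebra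
  moreover have "- k * y / (x - h)\<^sup>2 = - k * y * a\<^sup>2" "k / (x - h) = k * a"
    by (simp_all add: a_def v_def power_divide)
  ultimately show ?thesis by (simp add: ec_rhs_def)
qed

context real_weierstrass
begin

section \<open>Range of the parametrization and its growth near the periods\<close>

lemma X_ge: "\<not> period z \<Longrightarrow> e \<le> X z"
proof -
  assume "\<not> period z"
  moreover have "0 \<le> 1 + cos (ang z)" using cos_ge_minus_one[of "ang z"] by linarith
  ultimately show ?thesis using cos_ang_less[of z] by (simp add: X_def)
qed

lemma XY_surj:
  assumes x: "e < x" and y: "y\<^sup>2 = ec_rhs g2 g3 x"
  obtains z where "\<not> period z" "X z = x" "Y z = y"
proof -
  define v where "v = x - e"
  have v: "0 < v" using x by (simp add: v_def)
  define c where "c = (v - 1) / (v + 1)"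
  have c: "-1 \<le> c" "c < 1" using v by (auto simp: c_def field_simps)
  have vc: "(1 + c) / (1 - c) = v" using v by (simp add: c_def field_simps)
  define z where "z = H (arccos c)"
  have cos: "cos (ang z) = c" using c by (simp add: z_def cos_arccos)
  then have np: "\<not> period z" using c cos_ang_eq_1[of z] by simp
  have X: "X z = x" unfolding X_def cos vc by (simp add: v_def)
  have "Y z ^ 2 = y ^ 2" using XY_curve[OF np] y by (simp add: X)
  then have "Y z = y \<or> Y (- z) = y" by (auto simp: power2_eq_iff)
  then show thesis using that np X by (metis X_minus period_minus)
qed

text \<open>With \<theta> the angle of \<open>z\<close>, the bound
  \<open>m * \<bar>\<theta>\<bar> \<le> \<bar>z\<bar>\<close> gives
  \<open>1 - cos \<theta> \<le> \<theta>\<^sup>2 / 2\<close>, and so X - e is at least twice the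
  square of \<open>t = m / - z\<close>. The bound for \<open>Y\<close> follows by squaring through
  the curve equation; its sign is the reason for approaching 0 from the left.\<close>

lemma XY_near_0:
  obtains \<delta> k where "0 < \<delta>" "0 < k"
    "\<And>z. - \<delta> < z \<Longrightarrow> z < 0 \<Longrightarrow> \<not> period z \<and> (k / - z) ^ 2 < X z \<and> (k / - z) ^ 3 < Y z"
proof -
  obtain m where m: "0 < m" "\<And>\<theta>. m * \<bar>\<theta>\<bar> \<le> \<bar>H \<theta>\<bar>" using H_bounds by metis
  \<comment> \<open>The first bound forces \<open>t > 6 * \<bar>e\<bar> + 1\<close>, so that
    \<open>v \<ge> 2 * t\<^sup>2\<close> outweighs both \<open>e\<close> in \<open>X\<close> and the
    term \<open>3 * e * v\<close> in the cubic; the second keeps \<open>z\<close> away from the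
    other periods.\<close>
  define \<delta> where "\<delta> = min (m / (6 * \<bar>e\<bar> + 1)) \<omega>"
  have p: "0 < 6 * \<bar>e\<bar> + 1" by (simp add: add_nonneg_pos)
  have \<delta>: "0 < \<delta>" using m p \<omega>_pos by (simp add: \<delta>_def)
  have "\<not> period z \<and> (m / - z) ^ 2 < X z \<and> (m / - z) ^ 3 < Y z" if z: "- \<delta> < z" "z < 0" for z
  proof -
    have np: "\<not> period z" by (rule not_period) (use z in \<open>auto simp: \<delta>_def\<close>)
    define \<theta> c v t where "\<theta> = ang z" and "c = cos \<theta>" and "v = (1 + c) / (1 - c)" and "t = m / - z"
    have H\<theta>: "H \<theta> = z" by (simp add: \<theta>_def)
    have "\<theta> < 0" using H_less[of 0 \<theta>] H\<theta> z(2) by (cases "\<theta> = 0") (auto simp: linorder_neq_iff)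
    have t1: "6 * \<bar>e\<bar> + 1 < t"
    proof -
      have "- z < m / (6 * \<bar>e\<bar> + 1)" using z by (simp add: \<delta>_def)
      then have "- z * (6 * \<bar>e\<bar> + 1) < m" using p by (simp add: pos_less_divide_eq)
      then show ?thesis using z(2) by (simp add: t_def field_simps)
    qed
    have "m * \<bar>\<theta>\<bar> \<le> - z" using m(2)[of \<theta>] H\<theta> z(2) by simp
    then have \<theta>t: "\<bar>\<theta>\<bar> * t \<le> 1" using z(2) by (simp add: t_def field_simps)
    have t0: "1 < t" using t1 by simp
    have "\<bar>\<theta>\<bar> * 1 \<le> \<bar>\<theta>\<bar> * t" using t0 by (intro mult_left_mono) auto
    then have \<theta>1: "\<bar>\<theta>\<bar> \<le> 1" using \<theta>t by simp
    have c0: "0 \<le> c" unfolding c_def using \<theta>1 pi_gt3 by (intro cos_ge_zero) auto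
    have c1: "c < 1" using cos_ang_less[OF np] by (simp add: c_def \<theta>_def)
    have "1 - c = 2 * sin (\<theta> / 2) ^ 2" using cos_double_sin[of "\<theta> / 2"] by (simp add: c_def)
    also have "\<dots> \<le> 2 * (\<theta> / 2) ^ 2"
      using abs_sin_x_le_abs_x[of "\<theta> / 2"] by (intro mult_left_mono) (auto simp: abs_le_square_iff[symmetric])
    finally have "1 - c \<le> \<theta>\<^sup>2 / 2" by (simp add: power_divide)
    then have "(1 - c) * (2 * t\<^sup>2) \<le> \<theta>\<^sup>2 / 2 * (2 * t\<^sup>2)" by (intro mult_right_mono) auto
    also have "\<dots> = (\<bar>\<theta>\<bar> * t)\<^sup>2" by (simp add: power_mult_distrib)
    also have "\<dots> \<le> 1" using \<theta>t t0 by (simp add: abs_square_le_1)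
    finally have "(1 - c) * (2 * t\<^sup>2) \<le> 1 + c" using c0 by simp
    then have v: "2 * t\<^sup>2 \<le> v" using c1 by (simp add: v_def field_simps)
    have "t * 1 \<le> t * t" using t0 by (intro mult_left_mono) auto
    then have q: "6 * \<bar>e\<bar> + 1 < t\<^sup>2" using t1 by (simp add: power2_eq_square)
    have X: "X z = e + v" by (simp add: X_def v_def c_def \<theta>_def)
    have "t\<^sup>2 < X z" using v q unfolding X by linarith
    moreover have "t ^ 3 < Y z"
    proof (rule power2_less_imp_less)
      have v6: "6 * \<bar>e\<bar> \<le> v" "0 < v" using v q by linarith+
      have "(t ^ 3)\<^sup>2 = (t\<^sup>2) ^ 3" by (simp flip: power_mult)
      also have "\<dots> < v ^ 3" by (intro power_strict_mono) (use v q in linarith | simp)+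
      also have "\<dots> \<le> 4 * v * (v\<^sup>2 + 3 * e * v + \<kappa>)"
      proof -
        have "0 \<le> v * (v + 6 * e)" using v6 by (intro mult_nonneg_nonneg) linarith+
        then have "v\<^sup>2 / 2 \<le> v\<^sup>2 + 3 * e * v + \<kappa>" using \<kappa>_pos by (simp add: power2_eq_square algebra_simps)
        then have "4 * v * (v\<^sup>2 / 2) \<le> 4 * v * (v\<^sup>2 + 3 * e * v + \<kappa>)" using v6 by (intro mult_left_mono) auto
        moreover have "v ^ 3 \<le> 4 * v * (v\<^sup>2 / 2)" using v6 by (simp add: power2_eq_square power3_eq_cube)
        ultimately show ?thesis by linarith
      qed
      also have "\<dots> = Y z ^ 2" using XY_curve[OF np] by (simp add: X ec_rhs_shift)
      finally show "(t ^ 3)\<^sup>2 < (Y z)\<^sup>2" .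
      have "0 < sin (- \<theta>)" using \<theta>1 \<open>\<theta> < 0\<close> pi_gt3 by (intro sin_gt_zero) auto
      then have "0 \<le> 2 * sin (- \<theta>) * sqrt (R (cos \<theta>)) / (1 - cos \<theta>)\<^sup>2"
        using R_cos_pos[of \<theta>]
        by (intro divide_nonneg_nonneg mult_nonneg_nonneg real_sqrt_ge_zero) (linarith | simp)+
      then show "0 \<le> Y z" by (simp add: Y_def \<theta>_def)
    qed
    ultimately show ?thesis using np by (simp add: t_def)
  qed
  then show thesis using that \<delta> m(1) by blast
qed

text \<open>After reducing the angle to \<theta> in [-pi, pi], X - e is cot^2 (\<theta> / 2). A
  large \<open>X\<close> thus bounds tan (\<theta> / 2), hence \<theta>, and the Lipschitz bound for
  \<open>H\<close> transfers this to \<open>z\<close>. From \<open>T0\<close> on, \<open>e\<close>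
  is at most half of T^2.\<close>

lemma X_large_imp:
  obtains T0 C where "0 < C" "0 < T0" "\<And>z T. \<lbrakk>T0 \<le> T; \<not> period z; T\<^sup>2 < X z\<rbrakk> \<Longrightarrow> \<exists>n::int. \<bar>z - of_int n * \<omega>\<bar> \<le> C / T"
proof -
  obtain M where M: "0 < M" "\<And>\<theta>. \<bar>H \<theta>\<bar> \<le> M * \<bar>\<theta>\<bar>" using H_bounds by metis
  define T0 where "T0 = 2 * \<bar>e\<bar> + 1"
  have "\<exists>n::int. \<bar>z - of_int n * \<omega>\<bar> \<le> 4 * M / T" if T: "T0 \<le> T" "\<not> period z" "T\<^sup>2 < X z" for z T
  proof -
    define n where "n = round (ang z / (2 * pi))"
    define \<theta> where "\<theta> = ang z + 2 * pi * of_int (- n)"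
    define x where "x = \<theta> / 2"
    have "\<bar>ang z / (2 * pi) - of_int n\<bar> \<le> 1 / 2" unfolding n_def
      using of_int_round_abs_le[of "ang z / (2 * pi)"] by (simp add: abs_minus_commute)
    then have "\<bar>ang z / (2 * pi) - of_int n\<bar> * (2 * pi) \<le> 1 / 2 * (2 * pi)" by (intro mult_right_mono) auto
    moreover have "\<bar>ang z / (2 * pi) - of_int n\<bar> * (2 * pi) = \<bar>\<theta>\<bar>"
    proof -
      have "\<theta> = (ang z / (2 * pi) - of_int n) * (2 * pi)" by (simp add: \<theta>_def field_simps)
      then show ?thesis by (simp add: abs_mult)
    qed
    ultimately have x: "\<bar>x\<bar> \<le> pi / 2" by (simp add: x_def)
    have H\<theta>: "H \<theta> = z - of_int n * \<omega>" unfolding \<theta>_def H_add_int by simp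
    have cos\<theta>: "cos \<theta> = cos (ang z)"
      unfolding \<theta>_def by (simp only: cos_add cos_int_2pin sin_int_2pin)
    define v where "v = (1 + cos \<theta>) / (1 - cos \<theta>)"
    have X: "X z = e + v" by (simp add: X_def v_def cos\<theta>)
    have T1: "1 \<le> T" "2 * \<bar>e\<bar> + 1 \<le> T" using T(1) by (auto simp: T0_def)
    have "T * 1 \<le> T * T" using T1 by (intro mult_left_mono) auto
    then have "T \<le> T\<^sup>2" by (simp add: power2_eq_square)
    then have v: "T\<^sup>2 / 2 < v" using T(3) T1(2) unfolding X by linarith
    have cx: "1 + cos \<theta> = 2 * cos x ^ 2" "1 - cos \<theta> = 2 * sin x ^ 2"
      using cos_double_cos[of x] cos_double_sin[of x] by (auto simp: x_def)
    have v0: "0 < v" using v zero_le_power2[of T] by linarith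
    then have cosx: "cos x \<noteq> 0" and sinx: "sin x \<noteq> 0" unfolding v_def cx by auto
    have "\<bar>x\<bar> \<noteq> pi / 2"
    proof
      assume "\<bar>x\<bar> = pi / 2"
      then have "cos \<bar>x\<bar> = 0" by (simp only: cos_pi_half)
      then show False using cosx by (simp add: abs_if split: if_splits)
    qed
    then have "\<bar>x\<bar> \<le> \<bar>tan x\<bar>" using x by (intro abs_tan_ge) auto
    moreover have "\<bar>tan x\<bar> \<le> 2 / T"
    proof (rule power2_le_imp_le)
      have "\<bar>tan x\<bar>\<^sup>2 = 1 / v" using cosx sinx unfolding v_def cx by (simp add: tan_def power_divide)
      also have "\<dots> \<le> 1 / (T\<^sup>2 / 2)" using v v0 T1 by (intro divide_left_mono) auto
      also have "\<dots> \<le> (2 / T)\<^sup>2" by (simp add: power_divide divide_right_mono)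
      finally show "\<bar>tan x\<bar>\<^sup>2 \<le> (2 / T)\<^sup>2" .
    qed (use T1 in auto)
    ultimately have "\<bar>\<theta>\<bar> \<le> 4 / T" by (simp add: x_def)
    then have "M * \<bar>\<theta>\<bar> \<le> M * (4 / T)" using M(1) by (intro mult_left_mono) auto
    then show ?thesis using M(2)[of \<theta>] H\<theta> by (intro exI[of _ n]) (simp add: mult.commute)
  qed
  moreover have "0 < T0" by (simp add: T0_def add_nonneg_pos)
  ultimately show thesis using that[of "4 * M" T0] M(1) by simp
qed

lemma X_differentiable_on: "X differentiable_on {z. \<not> period z}"
  using X_deriv unfolding differentiable_on_def
  by (metis (mono_tags, lifting) differentiable_at_withinI mem_Collect_eq real_differentiable_def)

lemma negligible_torsion: "negligible {z. \<exists>n\<ge>(1::nat). period (real n * z)}"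
proof -
  have "{z. \<exists>n\<ge>(1::nat). period (real n * z)} \<subseteq> range (\<lambda>(n::nat, m::int). of_int m * \<omega> / real n)"
  proof
    fix z assume "z \<in> {z. \<exists>n\<ge>(1::nat). period (real n * z)}"
    then obtain n :: nat and m :: int where "1 \<le> n" "real n * z = of_int m * \<omega>" by (auto simp: period_def)
    then have "z = (\<lambda>(n::nat, m::int). of_int m * \<omega> / real n) (n, m)" by (simp add: field_simps)
    then show "z \<in> range (\<lambda>(n::nat, m::int). of_int m * \<omega> / real n)" by (rule range_eqI)
  qed
  then have "countable {z. \<exists>n\<ge>(1::nat). period (real n * z)}"
    by (rule countable_subset) auto
  then show ?thesis by (simp add: negligible_iff_null_sets null_sets_completionI countable_imp_null_set_lborel)
qed

end

text \<open>Three real roots \<open>h < f < e\<close>: the oval lies over \<open>{h..f}\<close>, and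
  translation by (h, 0) exchanges it with the identity component.\<close>

locale real_weierstrass_oval = real_weierstrass +
  fixes h f :: real
  assumes roots: "h < f" "f < e"
    and factor: "\<And>x. ec_rhs g2 g3 x = 4 * (x - e) * (x - h) * (x - f)"
begin

lemma root_h: "ec_rhs g2 g3 h = 0"
  by (simp add: factor)

lemma trans_const: "3 * h\<^sup>2 - g2 / 4 = (e - h) * (f - h)"
proof -
  \<comment> \<open>Three values of the factored cubic stand in for a comparison of
    coefficients.\<close>
  have "4 - g2 - g3 = 4 * (1 - e) * (1 - h) * (1 - f)" "- 4 + g2 - g3 = 4 * (- 1 - e) * (- 1 - h) * (- 1 - f)"
    "- g3 = 4 * (0 - e) * (0 - h) * (0 - f)"
    using factor[of 1] factor[of "-1"] factor[of 0] by (simp_all add: ec_rhs_def)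
  then show ?thesis by algebra
qed

lemma trans_const_pos: "0 < (e - h) * (f - h)"
  using roots by simp

lemma trans_pt_x_le:
  assumes "\<not> period z"
  shows "h + (e - h) * (f - h) / (X z - h) \<le> f"
proof -
  have "(e - h) * (f - h) / (X z - h) \<le> (e - h) * (f - h) / (e - h)"
    using X_ge[OF assms] roots by (intro divide_left_mono mult_pos_pos) auto
  then show ?thesis using roots by simp
qed

text \<open>n (P + T) = n P + n T with 2 T = 0. The step from even to odd uses
  \<open>ec_add_trans\<close>, the step from odd to even \<open>ec_add_trans_trans\<close>. The
  hypothesis on \<open>z\<close> keeps every multiple of P finite, so that these coordinate formulas
  apply.\<close>

lemma trans_pt_pow:
  assumes np: "\<And>n::nat. 1 \<le> n \<Longrightarrow> \<not> period (real n * z)" and n: "1 \<le> n"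
  shows "ec_trans g2 h (pt z) [^]\<^bsub>ec_group g2 g3\<^esub> n =
    (if even n then pt (real n * z) else ec_trans g2 h (pt (real n * z)))"
  using n
proof (induction n rule: nat_induct_at_least)
  case base
  show ?case by (simp add: nat_pow_def ec_group_def)
next
  case (Suc n)
  define w where "w = real n * z"
  have npz: "\<not> period z" using np[of 1] by simp
  have npw: "\<not> period w" using np[OF Suc.hyps(1)] by (simp add: w_def)
  have npwz: "\<not> period (w + z)" using np[of "Suc n"] by (simp add: w_def algebra_simps)
  have add: "ec_add g2 (Aff (X w) (Y w)) (Aff (X z) (Y z)) = Aff (X (w + z)) (Y (w + z))"
    using pt_add[of w z] npw npz npwz by (simp add: pt_def)
  have ne: "\<not> (X w = X z \<and> Y w = - Y z)" using add by auto
  have nh: "X w \<noteq> h" "X z \<noteq> h" "X (w + z) \<noteq> h" using X_ge npw npz npwz roots by force+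
  have nz: "12 * h\<^sup>2 \<noteq> g2" using trans_const trans_const_pos by auto
  have "X w \<noteq> h + (3 * h\<^sup>2 - g2 / 4) / (X z - h)"
    using trans_pt_x_le[OF npz] X_ge[OF npw] roots unfolding trans_const by linarith
  note 1 = ec_add_trans[OF XY_curve[OF npw] XY_curve[OF npz] ne root_h nh(2) this add nh(3)]
  note 2 = ec_add_trans_trans[OF XY_curve[OF npw] XY_curve[OF npz] ne root_h nh(1,2) nz]
  have "real (Suc n) * z = w + z" by (simp add: w_def algebra_simps)
  then show ?case
    using Suc.IH 1 2 add npw npz npwz
    by (simp add: nat_pow_def ec_group_def pt_def flip: w_def split: if_splits)
qed

text \<open>Translation by (h, 0) is an involution: the translate of (x, y) lies to the right of
  \<open>e\<close>, where \<open>XY_surj\<close> provides \<open>z\<close>, and translating it back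
  recovers the point.\<close>

lemma oval_point:
  assumes y: "y\<^sup>2 = ec_rhs g2 g3 x" and x: "x < e" "0 < ec_rhs g2 g3 x"
  obtains z where "\<not> period z" "Aff x y = ec_trans g2 h (pt z)"
proof -
  define k where "k = (e - h) * (f - h)"
  have k0: "0 < k" using trans_const_pos by (simp add: k_def)
  have "(x - h) * (x - f) < 0"
  proof -
    have "0 < 4 * (e - x) * ((x - h) * (f - x))" using x(2) unfolding factor by (simp add: algebra_simps)
    then have "0 < (x - h) * (f - x)" using x(1) by (simp add: zero_less_mult_iff)
    then show ?thesis by (simp add: algebra_simps)
  qed
  then have hx: "h < x" "x < f" using roots by (auto simp: mult_less_0_iff)
  define x' y' where "x' = h + k / (x - h)" and "y' = - k * y / (x - h)\<^sup>2"
  have c': "y'\<^sup>2 = ec_rhs g2 g3 x'"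
    using ec_trans_curve[OF y root_h] hx unfolding trans_const x'_def y'_def k_def by simp
  have "k / (f - h) < k / (x - h)" using hx k0 by (intro divide_strict_left_mono) auto
  then have "e < x'" using hx by (simp add: x'_def k_def)
  then obtain z where z: "\<not> period z" "X z = x'" "Y z = y'" using XY_surj c' by metis
  have "x' - h = k / (x - h)" by (simp add: x'_def)
  then have "ec_trans g2 h (pt z) = Aff x y"
    using z hx k0 unfolding pt_def ec_trans_def trans_const k_def[symmetric]
    by (simp add: y'_def power_divide power2_eq_square)
  then show thesis using that[OF z(1)] by simp
qed

end

section \<open>Null sets of parameters\<close>

lemma negligible_scale_image:
  fixes c :: real
  assumes "negligible B"
  shows "negligible ((\<lambda>\<alpha>. c * \<alpha>) ` B)"
  using assms by (intro negligible_differentiable_image_negligible) (auto intro!: derivative_intros)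

text \<open>On both branches the measure has a density with respect to dx, so null abscissae
  suffice. A Borel hull \<open>N\<close> of \<open>B\<close> yields a Borel superset of
  \<open>S\<close>; the point at infinity and the points with vanishing ordinate can be added to it
  freely, since no branch contains them.\<close>

lemma null_sets_ec_lebesgue:
  assumes B: "negligible B" and S: "S \<subseteq> ec_points g2 g3"
    and SB: "\<And>x y. Aff x y \<in> S \<Longrightarrow> 0 < ec_rhs g2 g3 x \<Longrightarrow> x \<in> B"
  shows "S \<in> null_sets (ec_lebesgue g2 g3)"
proof -
  obtain N where N: "N \<in> null_sets lborel" "B \<subseteq> N"
    using B unfolding negligible_iff_null_sets null_sets_completion_iff2 by blast
  define A' where "A' = {P. case P of Infty \<Rightarrow> True | Aff x y \<Rightarrow> x \<in> N \<or> ec_rhs g2 g3 x \<le> 0}"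
  define A where "A = ec_points g2 g3 \<inter> A'"
  have "{p. Aff (fst p) (snd p) \<in> A'} = {p::real \<times> real. fst p \<in> N} \<union> {p. ec_rhs g2 g3 (fst p) \<le> 0}"
    by (auto simp: A'_def)
  moreover have "{p::real \<times> real. fst p \<in> N} \<in> sets borel"
  proof -
    have "N \<in> sets borel" using N(1) by auto
    then have "fst -` N \<inter> space borel \<in> sets (borel :: (real \<times> real) measure)"
      by (intro measurable_sets[of fst borel borel]) (auto intro: borel_measurable_continuous_onI[OF continuous_on_fst[OF continuous_on_id]])
    then show ?thesis by (simp add: vimage_def)
  qed
  moreover have "{p::real \<times> real. ec_rhs g2 g3 (fst p) \<le> 0} \<in> sets borel"
    unfolding ec_rhs_def by (intro borel_closed closed_Collect_le continuous_intros)
  ultimately have "A \<in> sets (ec_borel g2 g3)"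
    unfolding sets_ec_borel A_def by (intro image_eqI[OF refl]) auto
  moreover from this have "emeasure (ec_lborel g2 g3) A = 0"
  proof -
    have "(\<integral>\<^sup>+x\<in>{x. 0 < ec_rhs g2 g3 x \<and> Aff x (s * sqrt (ec_rhs g2 g3 x)) \<in> A}.
        ennreal (1 / sqrt (ec_rhs g2 g3 x)) \<partial>lborel) = 0" for s
    proof -
      have "(\<integral>\<^sup>+x\<in>{x. 0 < ec_rhs g2 g3 x \<and> Aff x (s * sqrt (ec_rhs g2 g3 x)) \<in> A}.
          ennreal (1 / sqrt (ec_rhs g2 g3 x)) \<partial>lborel) \<le> (\<integral>\<^sup>+x\<in>N. ennreal (1 / sqrt (ec_rhs g2 g3 x)) \<partial>lborel)"
        by (intro nn_integral_mono mult_left_mono) (auto simp: A_def A'_def indicator_def)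
      also have "\<dots> = 0" by (rule nn_integral_null_set[OF N(1)])
      finally show ?thesis by simp
    qed
    with emeasure_ec_lborel[OF \<open>A \<in> sets (ec_borel g2 g3)\<close>] show ?thesis by simp
  qed
  ultimately have "A \<in> null_sets (ec_lborel g2 g3)"
    by (auto simp: null_sets_def ec_lborel_def)
  moreover have "S \<subseteq> A"
  proof
    fix P assume "P \<in> S"
    then show "P \<in> A" using S SB N(2) by (cases P) (auto simp: A_def A'_def not_le[symmetric])
  qed
  ultimately show ?thesis unfolding ec_lebesgue_def null_sets_completion_iff2 by blast
qed

lemma not_summable_inverse_even:
  fixes \<psi> :: "nat \<Rightarrow> real"
  assumes pos: "\<forall>n\<ge>1. 0 < \<psi> n" and mono: "\<forall>m\<ge>1. \<forall>n\<ge>m. \<psi> m \<le> \<psi> n"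
    and div: "\<not> summable (\<lambda>n. 1 / \<psi> (Suc n))"
  shows "\<not> summable (\<lambda>q. 1 / \<psi> (2 * Suc q))"
proof
  assume s: "summable (\<lambda>q. 1 / \<psi> (2 * Suc q))"
  have nonneg: "0 \<le> 1 / \<psi> (Suc n)" for n using pos by (simp add: less_imp_le)
  \<comment> \<open>The index 1 is dropped so that the remaining ones split into pairs
    \<open>2 * Suc q\<close>, \<open>Suc (2 * Suc q)\<close>; in each pair the first term
    dominates.\<close>
  have "summable (\<lambda>n. 1 / \<psi> (Suc (n + 1)))"
  proof (rule summableI_nonneg_bounded)
    fix n
    have "(\<Sum>i<n. 1 / \<psi> (Suc (i + 1))) \<le> (\<Sum>i<n * 2. 1 / \<psi> (Suc (i + 1)))"
      using pos by (intro sum_mono2) (auto simp: less_imp_le)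
    also have "\<dots> = (\<Sum>q<n. \<Sum>i=q * 2..<q * 2 + 2. 1 / \<psi> (Suc (i + 1)))"
      by (rule sum.nat_group[symmetric])
    also have "\<dots> \<le> (\<Sum>q<n. 2 * (1 / \<psi> (2 * Suc q)))"
    proof (rule sum_mono)
      fix q :: nat
      have "{q * 2..<q * 2 + 2} = {q * 2, q * 2 + 1}" by auto
      then have "(\<Sum>i=q * 2..<q * 2 + 2. 1 / \<psi> (Suc (i + 1))) = 1 / \<psi> (2 * Suc q) + 1 / \<psi> (Suc (2 * Suc q))"
        by (simp add: mult.commute)
      moreover have "\<psi> (2 * Suc q) \<le> \<psi> (Suc (2 * Suc q))" "0 < \<psi> (2 * Suc q)" using mono pos by auto
      then have "1 / \<psi> (Suc (2 * Suc q)) \<le> 1 / \<psi> (2 * Suc q)" by (intro divide_left_mono) auto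
      ultimately show "(\<Sum>i=q * 2..<q * 2 + 2. 1 / \<psi> (Suc (i + 1))) \<le> 2 * (1 / \<psi> (2 * Suc q))" by simp
    qed
    also have "\<dots> = 2 * (\<Sum>q<n. 1 / \<psi> (2 * Suc q))" by (simp add: sum_distrib_left)
    also have "\<dots> \<le> 2 * (\<Sum>q. 1 / \<psi> (2 * Suc q))"
      using s pos by (intro mult_left_mono sum_le_suminf) (auto simp: less_imp_le)
    finally show "(\<Sum>i<n. 1 / \<psi> (Suc (i + 1))) \<le> 2 * (\<Sum>q. 1 / \<psi> (2 * Suc q))" .
  qed (use nonneg in blast)
  then show False using div summable_iff_shift[of "\<lambda>n. 1 / \<psi> (Suc n)" 1] by simp
qed

definition ec_good :: "real \<Rightarrow> ec_point \<Rightarrow> bool" where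
  "ec_good t Q \<longleftrightarrow> (\<exists>x y. Q = Aff x y \<and> x > t ^ 2 \<and> y > t ^ 3)"

context real_weierstrass
begin

lemma negligible_divergent:
  fixes \<psi> :: "nat \<Rightarrow> real"
  assumes pos: "\<forall>n\<ge>1. 0 < \<psi> n" and mono: "\<forall>m\<ge>1. \<forall>n\<ge>m. \<psi> m \<le> \<psi> n"
    and div: "\<not> summable (\<lambda>n. 1 / \<psi> (Suc n))"
  shows "negligible {z. finite {n. 1 \<le> n \<and> even n \<and> ec_good (\<psi> n) (pt (real n * z))}}"
proof -
  obtain d k where d: "0 < d" and k: "0 < k"
    and near: "\<And>z. - d < z \<Longrightarrow> z < 0 \<Longrightarrow> \<not> period z \<and> (k / - z) ^ 2 < X z \<and> (k / - z) ^ 3 < Y z"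
    using XY_near_0 by metis
  \<comment> \<open>With \<open>n = 2 * q\<close> and \<open>\<alpha> = - 2 * z / \<omega>\<close>,
    the distance of \<open>n * z\<close> to the left of the period with index \<open>- p\<close> is
    \<open>\<omega> * (q * \<alpha> - p)\<close>, so the one-sided condition of Khinchin's theorem
    is \<open>0 < q * \<alpha> - p < \<delta> q\<close>. The cap \<open>d\<close> is the range of
    \<open>XY_near_0\<close>; as for \<open>r\<close> above, it does not affect divergence.\<close>
  define \<delta> where "\<delta> q = min d (k / \<psi> (2 * q)) / \<omega>" for q
  have \<delta>0: "0 < \<delta> q" if "1 \<le> q" for q using that d k pos \<omega>_pos by (simp add: \<delta>_def)
  have \<delta>mono: "\<delta> n \<le> \<delta> m" if "1 \<le> m" "m \<le> n" for m n
  proof -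
    have "\<psi> (2 * m) \<le> \<psi> (2 * n)" "0 < \<psi> (2 * m)" using that pos mono by auto
    then have "k / \<psi> (2 * n) \<le> k / \<psi> (2 * m)" using k by (intro divide_left_mono) auto
    then show ?thesis unfolding \<delta>_def using \<omega>_pos by (intro divide_right_mono) auto
  qed
  have \<delta>div: "\<not> summable (\<lambda>q. \<delta> (Suc q))"
  proof
    assume s: "summable (\<lambda>q. \<delta> (Suc q))"
    have "(\<lambda>q. \<delta> (Suc q)) \<longlonglongrightarrow> 0" using s by (rule summable_LIMSEQ_zero)
    then have "\<forall>\<^sub>F q in sequentially. \<delta> (Suc q) < d / \<omega>" using d \<omega>_pos by (intro order_tendstoD) auto
    then have "\<forall>\<^sub>F q in sequentially. \<delta> (Suc q) = k / \<omega> * (1 / \<psi> (2 * Suc q))"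
    proof eventually_elim
      case (elim q)
      then have "min d (k / \<psi> (2 * Suc q)) < d" using \<omega>_pos unfolding \<delta>_def by (simp add: divide_less_cancel)
      then have "min d (k / \<psi> (2 * Suc q)) = k / \<psi> (2 * Suc q)" by linarith
      then show ?case unfolding \<delta>_def by simp
    qed
    from s[unfolded summable_cong[OF this]]
    have "summable (\<lambda>q. \<omega> / k * (k / \<omega> * (1 / \<psi> (2 * Suc q))))" by (rule summable_mult)
    moreover have "\<omega> / k * (k / \<omega> * t) = t" for t using k \<omega>_pos by simp
    ultimately have "summable (\<lambda>q. 1 / \<psi> (2 * Suc q))" by (simp only:)
    then show False using not_summable_inverse_even[OF pos mono div] by contradiction
  qed
  define B where "B = {\<alpha>::real. finite {q::nat. 1 \<le> q \<and> (\<exists>p::int. 0 < real q * \<alpha> - of_int p \<and> real q * \<alpha> - of_int p < \<delta> q)}}"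
  have "negligible B"
    unfolding B_def using khinchin_one_sided[of \<delta>] \<delta>0 \<delta>mono \<delta>div by blast
  then have "negligible ((\<lambda>\<alpha>. (- \<omega> / 2) * \<alpha>) ` B)"
    by (rule negligible_scale_image)
  moreover have "{z. finite {n. 1 \<le> n \<and> even n \<and> ec_good (\<psi> n) (pt (real n * z))}} \<subseteq> (\<lambda>\<alpha>. (- \<omega> / 2) * \<alpha>) ` B"
  proof
    fix z assume "z \<in> {z. finite {n. 1 \<le> n \<and> even n \<and> ec_good (\<psi> n) (pt (real n * z))}}"
    then have fin: "finite {n. 1 \<le> n \<and> even n \<and> ec_good (\<psi> n) (pt (real n * z))}" by simp
    define \<alpha> where "\<alpha> = - 2 * z / \<omega>"
    have z: "z = (- \<omega> / 2) * \<alpha>" using \<omega>_pos by (simp add: \<alpha>_def)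
    have "(*) 2 ` {q::nat. 1 \<le> q \<and> (\<exists>p::int. 0 < real q * \<alpha> - of_int p \<and> real q * \<alpha> - of_int p < \<delta> q)}
        \<subseteq> {n. 1 \<le> n \<and> even n \<and> ec_good (\<psi> n) (pt (real n * z))}"
    proof (rule image_subsetI)
      fix q assume "q \<in> {q::nat. 1 \<le> q \<and> (\<exists>p::int. 0 < real q * \<alpha> - of_int p \<and> real q * \<alpha> - of_int p < \<delta> q)}"
      then obtain p :: int where q: "1 \<le> q" and p: "0 < real q * \<alpha> - of_int p" "real q * \<alpha> - of_int p < \<delta> q" by blast
      define w where "w = real (2 * q) * z + of_int p * \<omega>"
      have w: "w = - \<omega> * (real q * \<alpha> - of_int p)" by (simp add: w_def z algebra_simps)
      have "\<omega> * (real q * \<alpha> - of_int p) < \<omega> * \<delta> q" using p(2) \<omega>_pos by simp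
      also have "\<omega> * \<delta> q = min d (k / \<psi> (2 * q))" using \<omega>_pos by (simp add: \<delta>_def)
      finally have "- w < min d (k / \<psi> (2 * q))" by (simp add: w)
      moreover have w0: "w < 0" using p(1) \<omega>_pos by (simp add: w mult_pos_pos)
      ultimately have wd: "- d < w" and wk: "- w < k / \<psi> (2 * q)" by auto
      have \<psi>: "0 < \<psi> (2 * q)" using pos q by simp
      have lt: "\<psi> (2 * q) < k / - w" using wk w0 \<psi> by (simp add: field_simps)
      have "\<psi> (2 * q) ^ 2 < (k / - w) ^ 2" "\<psi> (2 * q) ^ 3 < (k / - w) ^ 3"
        by (rule power_strict_mono[OF lt less_imp_le[OF \<psi>]]; simp)+
      then have "\<not> period w" "\<psi> (2 * q) ^ 2 < X w" "\<psi> (2 * q) ^ 3 < Y w" using near[OF wd w0] by auto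
      then have "ec_good (\<psi> (2 * q)) (pt w)" by (simp add: ec_good_def pt_def)
      moreover have "pt w = pt (real (2 * q) * z)" unfolding w_def by (rule pt_add_int)
      ultimately show "2 * q \<in> {n. 1 \<le> n \<and> even n \<and> ec_good (\<psi> n) (pt (real n * z))}" using q by simp
    qed
    then have "finite ((*) 2 ` {q::nat. 1 \<le> q \<and> (\<exists>p::int. 0 < real q * \<alpha> - of_int p \<and> real q * \<alpha> - of_int p < \<delta> q)})"
      using fin finite_subset by blast
    then have "\<alpha> \<in> B" unfolding B_def by (simp add: finite_image_iff inj_on_def)
    then show "z \<in> (\<lambda>\<alpha>. (- \<omega> / 2) * \<alpha>) ` B" using z by blast
  qed
  ultimately show ?thesis by (rule negligible_subset)
qed

lemma negligible_convergent:
  fixes \<psi> :: "nat \<Rightarrow> real"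
  assumes pos: "\<forall>n\<ge>1. 0 < \<psi> n" and sum: "summable (\<lambda>n. 1 / \<psi> (Suc n))"
  shows "negligible {z. infinite {n. 1 \<le> n \<and> ec_good (\<psi> n) (pt (real n * z))}}"
proof -
  obtain T0 C where C: "0 < C" and T0: "0 < T0"
    and large: "\<And>z T. \<lbrakk>T0 \<le> T; \<not> period z; T\<^sup>2 < X z\<rbrakk> \<Longrightarrow> \<exists>n::int. \<bar>z - of_int n * \<omega>\<bar> \<le> C / T"
    using X_large_imp by metis
  define \<delta> where "\<delta> n = (if n = 0 then 0 else C / \<omega> * (1 / \<psi> n))" for n
  have "summable (\<lambda>n. \<delta> (Suc n))" unfolding \<delta>_def using summable_mult[OF sum, of "C / \<omega>"] by simp
  then have s: "summable \<delta>" by (simp add: summable_Suc_iff)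
  have nn: "0 \<le> \<delta> n" for n using pos C \<omega>_pos by (auto simp: \<delta>_def less_imp_le)
  define B where "B = {\<alpha>::real. infinite {n::nat. 1 \<le> n \<and> (\<exists>p::int. \<bar>real n * \<alpha> - of_int p\<bar> \<le> \<delta> n)}}"
  have "negligible B" unfolding B_def by (rule khinchin_convergence[OF nn s])
  then have "negligible ((\<lambda>\<alpha>. \<omega> * \<alpha>) ` B)"
    by (rule negligible_scale_image)
  moreover have "{z. infinite {n. 1 \<le> n \<and> ec_good (\<psi> n) (pt (real n * z))}} \<subseteq> (\<lambda>\<alpha>. \<omega> * \<alpha>) ` B"
  proof
    fix z assume "z \<in> {z. infinite {n. 1 \<le> n \<and> ec_good (\<psi> n) (pt (real n * z))}}"
    then have inf: "infinite {n. 1 \<le> n \<and> ec_good (\<psi> n) (pt (real n * z))}" by simp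
    define \<alpha> where "\<alpha> = z / \<omega>"
    have z: "z = \<omega> * \<alpha>" using \<omega>_pos by (simp add: \<alpha>_def)
    \<comment> \<open>Convergence of the series forces \<psi> to infinity, so that
      \<open>\<psi> n\<close> eventually exceeds the threshold \<open>T0\<close>.\<close>
    have "(\<lambda>n. 1 / \<psi> (Suc n)) \<longlonglongrightarrow> 0" using sum by (rule summable_LIMSEQ_zero)
    then have "\<forall>\<^sub>F n in sequentially. 1 / \<psi> (Suc n) < 1 / T0" using T0 by (intro order_tendstoD) auto
    then obtain n0 where n0: "\<And>n. n0 \<le> n \<Longrightarrow> 1 / \<psi> (Suc n) < 1 / T0" by (auto simp: eventually_sequentially)
    have "{n. 1 \<le> n \<and> ec_good (\<psi> n) (pt (real n * z))}
        \<subseteq> {..n0} \<union> {n. 1 \<le> n \<and> (\<exists>p::int. \<bar>real n * \<alpha> - of_int p\<bar> \<le> \<delta> n)}"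
    proof
      fix n assume n: "n \<in> {n. 1 \<le> n \<and> ec_good (\<psi> n) (pt (real n * z))}"
      show "n \<in> {..n0} \<union> {n. 1 \<le> n \<and> (\<exists>p::int. \<bar>real n * \<alpha> - of_int p\<bar> \<le> \<delta> n)}"
      proof (cases "n \<le> n0")
        case False
        then have "1 / \<psi> n < 1 / T0" using n0[of "n - 1"] by (cases n) auto
        then have "T0 \<le> \<psi> n" using T0 pos n by (simp add: field_simps)
        moreover have "\<not> period (real n * z)" "\<psi> n ^ 2 < X (real n * z)"
          using n by (auto simp: ec_good_def pt_def split: if_splits)
        ultimately obtain p :: int where p: "\<bar>real n * z - of_int p * \<omega>\<bar> \<le> C / \<psi> n" using large by blast
        have "real n * z - of_int p * \<omega> = (real n * \<alpha> - of_int p) * \<omega>" by (simp add: z algebra_simps)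
        then have "\<bar>real n * \<alpha> - of_int p\<bar> * \<omega> \<le> C / \<psi> n" using p \<omega>_pos by (simp add: abs_mult)
        then have "\<bar>real n * \<alpha> - of_int p\<bar> \<le> C / \<psi> n / \<omega>"
          unfolding pos_le_divide_eq[OF \<omega>_pos] .
        also have "\<dots> = \<delta> n" using n by (simp add: \<delta>_def field_simps)
        finally show ?thesis using n by auto
      qed simp
    qed
    then have "\<alpha> \<in> B" unfolding B_def using inf finite_subset by auto
    then show "z \<in> (\<lambda>\<alpha>. \<omega> * \<alpha>) ` B" using z by blast
  qed
  ultimately show ?thesis by (rule negligible_subset)
qed

end

section \<open>The largest real root and the oval of the cubic\<close>

lemma ec_rhs_pos_large:
  assumes "1 + \<bar>g2\<bar> + \<bar>g3\<bar> \<le> x"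
  shows "0 < ec_rhs g2 g3 x" "ec_rhs g2 g3 (- x) < 0"
proof -
  have x: "1 \<le> x" using assms by linarith
  have "\<bar>g2\<bar> * x \<le> (x - 1 - \<bar>g3\<bar>) * x" using assms x by (intro mult_right_mono) auto
  then have "\<bar>g2\<bar> * x + \<bar>g3\<bar> * x + x \<le> x * x" by (simp add: algebra_simps)
  moreover have "\<bar>g3\<bar> * 1 \<le> \<bar>g3\<bar> * x" using x by (intro mult_left_mono) auto
  moreover have "x * x * 1 \<le> x * x * x" using x by (intro mult_left_mono) auto
  moreover have "0 < x * x" using x by simp
  moreover have "\<bar>g2 * x\<bar> = \<bar>g2\<bar> * x" using x by (simp add: abs_mult)
  ultimately have "\<bar>g2 * x\<bar> + \<bar>g3\<bar> < 4 * (x * x * x)" using x by linarith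
  then show "0 < ec_rhs g2 g3 x" "ec_rhs g2 g3 (- x) < 0"
    by (auto simp: ec_rhs_def power3_eq_cube mult.assoc abs_le_iff)
qed

lemma isCont_ec_rhs: "isCont (ec_rhs g2 g3) x"
  unfolding ec_rhs_def[abs_def] by (intro continuous_intros)

text \<open>The largest root is the supremum of the set where the cubic is not positive. If it were
  a multiple root, then g2 = 12 e^2 and g3 = - 8 e^3, and the discriminant would vanish.\<close>

lemma ex_real_weierstrass:
  assumes "elliptic_curve g2 g3"
  obtains e where "real_weierstrass g2 g3 e"
proof -
  define S where "S = {x. ec_rhs g2 g3 x \<le> 0}"
  define b where "b = 1 + \<bar>g2\<bar> + \<bar>g3\<bar>"
  have ne: "- b \<in> S" using ec_rhs_pos_large(2)[of g2 g3 b] by (simp add: S_def b_def)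
  have bdd: "bdd_above S"
    using ec_rhs_pos_large(1)[of g2 g3] unfolding S_def b_def
    by (intro bdd_aboveI[of _ b]) (metis b_def linorder_not_le mem_Collect_eq nle_le)
  have cl: "closed S"
    unfolding S_def ec_rhs_def by (intro closed_Collect_le continuous_intros)
  define e where "e = Sup S"
  have eS: "ec_rhs g2 g3 e \<le> 0"
    using closed_contains_Sup[OF _ bdd cl] ne by (auto simp: e_def S_def)
  have pos: "0 < ec_rhs g2 g3 x" if "e < x" for x
    using cSup_upper[OF _ bdd, of x] that by (auto simp: e_def S_def not_le[symmetric])
  have root: "ec_rhs g2 g3 e = 0"
  proof -
    obtain x where "e \<le> x" "ec_rhs g2 g3 x = 0"
      using IVT[of "ec_rhs g2 g3" e 0 "e + 1"] eS pos[of "e + 1"] isCont_ec_rhs by (auto simp: less_imp_le)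
    then show ?thesis using pos[of x] by (cases "x = e") auto
  qed
  have "12 * e\<^sup>2 \<noteq> g2"
  proof
    assume "12 * e\<^sup>2 = g2"
    then have g2: "g2 = 12 * e\<^sup>2" by simp
    then have g3: "g3 = - 8 * e ^ 3" using root by (simp add: ec_rhs_def power2_eq_square power3_eq_cube)
    have "g2 ^ 3 - 27 * g3\<^sup>2 = 0" unfolding g2 g3 by (simp add: power_mult_distrib flip: power_mult)
    then show False using assms by (simp add: elliptic_curve_def)
  qed
  then show thesis using that[of e] root pos by (simp add: real_weierstrass_def)
qed

context real_weierstrass
begin

lemma ex_oval:
  assumes x: "x < e" "0 < ec_rhs g2 g3 x"
  obtains h f where "real_weierstrass_oval g2 g3 e h f"
proof -
  define b where "b = max (1 + \<bar>g2\<bar> + \<bar>g3\<bar>) (- x)"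
  have "ec_rhs g2 g3 (- b) < 0" by (rule ec_rhs_pos_large(2)) (simp add: b_def)
  moreover have "- b \<le> x" by (simp add: b_def)
  ultimately obtain h where h: "h \<le> x" "ec_rhs g2 g3 h = 0"
    using IVT[of "ec_rhs g2 g3" "- b" 0 x] x isCont_ec_rhs by (auto simp: less_imp_le)
  have hx: "h < x" using h x by (cases "h = x") auto
  define f where "f = - e - h"
  have g3: "g3 = 4 * e ^ 3 - g2 * e" using root by (simp add: ec_rhs_def)
  have "(h - e) * (4 * (h\<^sup>2 + h * e + e\<^sup>2) - g2) = 0"
    using h(2) root unfolding ec_rhs_def by algebra
  then have g2: "g2 = 4 * (h\<^sup>2 + h * e + e\<^sup>2)" using hx x by auto
  have factor: "ec_rhs g2 g3 t = 4 * (t - e) * (t - h) * (t - f)" for t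
    unfolding ec_rhs_def f_def using g2 g3 by algebra
  have "x < f"
  proof -
    have "0 < 4 * (e - x) * (x - h) * (f - x)" using x(2) unfolding factor by (simp add: algebra_simps)
    moreover have "0 < 4 * (e - x) * (x - h)" using x hx by simp
    ultimately have "0 < f - x" by (rule zero_less_mult_pos)
    then show ?thesis by simp
  qed
  moreover have "f < e"
  proof -
    have "f \<le> e" using pos[of f] factor[of f] by fastforce
    moreover have "f \<noteq> e"
    proof
      assume "f = e"
      then have "h = - 2 * e" by (simp add: f_def)
      then have "12 * e\<^sup>2 = g2" using g2 by algebra
      then show False using simple_root by contradiction
    qed
    ultimately show ?thesis by simp
  qed
  ultimately show thesis
    using that[of h f] factor hx real_weierstrass_axioms
    by (simp add: real_weierstrass_oval_def real_weierstrass_oval_axioms_def)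
qed

text \<open>Differentiable maps preserve null sets, so null sets of parameters give null sets of
  abscissae: through \<open>X\<close> to the right of \<open>e\<close>, and through \<open>X\<close>
  followed by the Moebius map \<open>g\<close> on the oval. Adding the null set of torsion
  parameters to \<open>N\<close> there is what allows \<open>oval\<close> to assume that no multiple
  of \<open>z\<close> is a period.\<close>

lemma null_sets_by_parameter:
  assumes N: "negligible N" and S: "S \<subseteq> ec_points g2 g3"
    and id: "\<And>z. pt z \<in> S \<Longrightarrow> z \<in> N"
    and oval: "\<And>h f z. \<lbrakk>real_weierstrass_oval g2 g3 e h f; \<And>n::nat. 1 \<le> n \<Longrightarrow> \<not> period (real n * z);
      ec_trans g2 h (pt z) \<in> S\<rbrakk> \<Longrightarrow> z \<in> N"
  shows "S \<in> null_sets (ec_lebesgue g2 g3)"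
proof -
  have image: "negligible (X ` (M - {z. period z}))" if "negligible M" for M
    using that X_differentiable_on
    by (intro negligible_differentiable_image_negligible)
      (auto intro: negligible_subset differentiable_on_subset)
  define B1 where "B1 = X ` (N - {z. period z})"
  have B1: "negligible B1" unfolding B1_def by (rule image[OF N])
  have id': "x \<in> B1" if xy: "Aff x y \<in> S" "e < x" for x y
  proof -
    have "y\<^sup>2 = ec_rhs g2 g3 x" using xy S by (auto simp: ec_points_def)
    then obtain z where z: "\<not> period z" "X z = x" "Y z = y" using XY_surj[OF xy(2)] by metis
    then have "pt z \<in> S" using xy by (simp add: pt_def)
    then show ?thesis using id z by (auto simp: B1_def)
  qed
  have ne: "x \<noteq> e" if "0 < ec_rhs g2 g3 x" for x using that root by auto
  show ?thesis
  proof (cases "\<exists>x<e. 0 < ec_rhs g2 g3 x")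
    case False
    then show ?thesis
      using id' ne by (intro null_sets_ec_lebesgue[OF B1 S]) (metis linorder_less_linear)
  next
    case True
    then obtain h f where o: "real_weierstrass_oval g2 g3 e h f" using ex_oval by metis
    then interpret o: real_weierstrass_oval g2 g3 e h f .
    define T where "T = {z. \<exists>n\<ge>(1::nat). period (real n * z)}"
    define g where "g x = h + (3 * h\<^sup>2 - g2 / 4) / (x - h)" for x
    have NT: "negligible (N \<union> T)" using N negligible_torsion by (auto simp: T_def)
    define B2 where "B2 = g ` (X ` ((N \<union> T) - {z. period z}))"
    have "negligible B2" unfolding B2_def
    proof (rule negligible_differentiable_image_negligible)
      show "negligible (X ` ((N \<union> T) - {z. period z}))" by (rule image[OF NT])
      have "x - h \<noteq> 0" if "x \<in> X ` ((N \<union> T) - {z. period z})" for x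
        using that X_ge o.roots by force
      then show "g differentiable_on X ` ((N \<union> T) - {z. period z})"
        unfolding g_def by (auto intro!: derivative_intros simp: differentiable_on_def)
    qed simp
    then have "negligible (B1 \<union> B2)" using B1 by auto
    then show ?thesis
    proof (rule null_sets_ec_lebesgue[OF _ S])
      fix x y assume xy: "Aff x y \<in> S" "0 < ec_rhs g2 g3 x"
      show "x \<in> B1 \<union> B2"
      proof (cases "e < x")
        case True
        then show ?thesis using id' xy by blast
      next
        case False
        then have "x < e" using ne[OF xy(2)] by simp
        moreover have "y\<^sup>2 = ec_rhs g2 g3 x" using xy S by (auto simp: ec_points_def)
        ultimately obtain z where z: "\<not> period z" "Aff x y = ec_trans g2 h (pt z)"
          using o.oval_point xy(2) by metis
        then have "x = g (X z)" by (simp add: pt_def ec_trans_def g_def)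
        moreover have "z \<in> N \<union> T" using oval[OF o, of z] xy(1) z(2) by (auto simp: T_def)
        ultimately show ?thesis using z(1) by (auto simp: B2_def)
      qed
    qed
  qed
qed

end

theorem theorem2:
  fixes g2 g3 :: real and \<psi> :: "nat \<Rightarrow> real"
  assumes "elliptic_curve g2 g3"
    and "\<forall>n\<ge>1. 0 < \<psi> n"
    and "\<forall>m\<ge>1. \<forall>n\<ge>m. \<psi> m \<le> \<psi> n"
  shows
    "(\<not> summable (\<lambda>n. 1 / \<psi> (Suc n)) \<longrightarrow>
       (AE P in ec_lebesgue g2 g3.
          infinite {n::nat. 1 \<le> n \<and>
            (\<exists>x y. P [^]\<^bsub>ec_group g2 g3\<^esub> n = Aff x y \<and> x > \<psi> n ^ 2 \<and> y > \<psi> n ^ 3)})) \<and>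
     (summable (\<lambda>n. 1 / \<psi> (Suc n)) \<longrightarrow>
       {P \<in> carrier (ec_group g2 g3).
          infinite {n::nat. 1 \<le> n \<and>
            (\<exists>x y. P [^]\<^bsub>ec_group g2 g3\<^esub> n = Aff x y \<and> x > \<psi> n ^ 2 \<and> y > \<psi> n ^ 3)}}
         \<in> null_sets (ec_lebesgue g2 g3))"
  unfolding ec_good_def[symmetric]
proof (intro conjI impI)
  obtain e where "real_weierstrass g2 g3 e" using ex_real_weierstrass[OF assms(1)] .
  then interpret real_weierstrass g2 g3 e .
  define G where "G P = {n::nat. 1 \<le> n \<and> ec_good (\<psi> n) (P [^]\<^bsub>ec_group g2 g3\<^esub> n)}" for P
  have G_pt: "G (pt z) = {n. 1 \<le> n \<and> ec_good (\<psi> n) (pt (real n * z))}" for z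
    by (simp add: G_def pt_pow)
  have G_trans: "n \<in> G (ec_trans g2 h (pt z)) \<longleftrightarrow> ec_good (\<psi> n) (if even n then pt (real n * z) else ec_trans g2 h (pt (real n * z)))"
    if "real_weierstrass_oval g2 g3 e h f" "\<And>n::nat. 1 \<le> n \<Longrightarrow> \<not> period (real n * z)" "1 \<le> n" for h f z n
    using real_weierstrass_oval.trans_pt_pow[OF that] that(3) by (simp add: G_def)
  show "AE P in ec_lebesgue g2 g3. infinite {n::nat. 1 \<le> n \<and> ec_good (\<psi> n) (P [^]\<^bsub>ec_group g2 g3\<^esub> n)}"
    if div: "\<not> summable (\<lambda>n. 1 / \<psi> (Suc n))"
    unfolding G_def[symmetric]
  proof (rule AE_I')
    let ?N = "{z. finite {n. 1 \<le> n \<and> even n \<and> ec_good (\<psi> n) (pt (real n * z))}}"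
    show "{P \<in> ec_points g2 g3. finite (G P)} \<in> null_sets (ec_lebesgue g2 g3)"
    proof (rule null_sets_by_parameter)
      show "negligible ?N" by (rule negligible_divergent[OF assms(2,3) div])
      show "z \<in> ?N" if "pt z \<in> {P \<in> ec_points g2 g3. finite (G P)}" for z
        using that by (auto simp: G_pt elim!: rev_finite_subset)
      show "z \<in> ?N" if o: "real_weierstrass_oval g2 g3 e h f" "\<And>n::nat. 1 \<le> n \<Longrightarrow> \<not> period (real n * z)"
        and fin: "ec_trans g2 h (pt z) \<in> {P \<in> ec_points g2 g3. finite (G P)}" for h f z
      proof -
        have "{n. 1 \<le> n \<and> even n \<and> ec_good (\<psi> n) (pt (real n * z))} \<subseteq> G (ec_trans g2 h (pt z))"
          using G_trans[OF o] by auto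
        then show ?thesis using fin finite_subset by auto
      qed
    qed auto
    show "{P \<in> space (ec_lebesgue g2 g3). \<not> infinite (G P)} \<subseteq> {P \<in> ec_points g2 g3. finite (G P)}"
      by (auto simp: space_ec_lebesgue ec_group_def)
  qed
  show "{P \<in> carrier (ec_group g2 g3). infinite {n::nat. 1 \<le> n \<and> ec_good (\<psi> n) (P [^]\<^bsub>ec_group g2 g3\<^esub> n)}}
      \<in> null_sets (ec_lebesgue g2 g3)"
    if sum: "summable (\<lambda>n. 1 / \<psi> (Suc n))"
    unfolding G_def[symmetric]
  proof (rule null_sets_by_parameter)
    let ?N = "{z. infinite {n. 1 \<le> n \<and> ec_good (\<psi> n) (pt (real n * z))}}"
    let ?S = "{P \<in> carrier (ec_group g2 g3). infinite (G P)}"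
    show "negligible ?N" by (rule negligible_convergent[OF assms(2) sum])
    show "?S \<subseteq> ec_points g2 g3" by (auto simp: ec_group_def)
    show "z \<in> ?N" if "pt z \<in> ?S" for z using that by (simp add: G_pt)
    show "z \<in> ?N" if o: "real_weierstrass_oval g2 g3 e h f" and np: "\<And>n::nat. 1 \<le> n \<Longrightarrow> \<not> period (real n * z)"
      and inf: "ec_trans g2 h (pt z) \<in> ?S" for h f z
    proof -
      interpret o: real_weierstrass_oval g2 g3 e h f by (rule o)
      \<comment> \<open>Odd multiples of an oval point remain on the oval, where x is at most
        \<open>f\<close>. As \<psi> tends to infinity, \<open>\<psi> n ^ 2\<close> eventually
        exceeds \<open>f\<close>, so all but finitely many good \<open>n\<close> are even and are
        good for \<open>pt z\<close> as well.\<close>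
      have "(\<lambda>n. 1 / \<psi> (Suc n)) \<longlonglongrightarrow> 0" using sum by (rule summable_LIMSEQ_zero)
      then have "\<forall>\<^sub>F n in sequentially. 1 / \<psi> (Suc n) < 1 / (\<bar>f\<bar> + 1)"
        by (rule order_tendstoD) (simp add: add_nonneg_pos)
      then obtain n0 where n0: "\<And>n. n0 \<le> n \<Longrightarrow> 1 / \<psi> (Suc n) < 1 / (\<bar>f\<bar> + 1)"
        by (auto simp: eventually_sequentially)
      have "G (ec_trans g2 h (pt z)) \<subseteq> {..n0} \<union> {n. 1 \<le> n \<and> ec_good (\<psi> n) (pt (real n * z))}"
      proof
        fix n assume n: "n \<in> G (ec_trans g2 h (pt z))"
        then have n1: "1 \<le> n" by (simp add: G_def)
        show "n \<in> {..n0} \<union> {n. 1 \<le> n \<and> ec_good (\<psi> n) (pt (real n * z))}"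
        proof (cases "even n \<or> n \<le> n0")
          case True
          then show ?thesis using n n1 G_trans[OF o np n1] by auto
        next
          case False
          have "1 / \<psi> n < 1 / (\<bar>f\<bar> + 1)" using n0[of "n - 1"] False n1 by (cases n) auto
          then have \<psi>: "\<bar>f\<bar> + 1 < \<psi> n" using assms(2) n1 by (simp add: divide_less_cancel field_simps)
          then have "\<psi> n * 1 \<le> \<psi> n * \<psi> n" by (intro mult_left_mono) auto
          then have "f < \<psi> n ^ 2" using \<psi> by (simp add: power2_eq_square)
          moreover have "ec_good (\<psi> n) (ec_trans g2 h (pt (real n * z)))"
            using n False G_trans[OF o np n1] by simp
          then have "\<psi> n ^ 2 < h + (e - h) * (f - h) / (X (real n * z) - h)"
            using np[OF n1] by (auto simp: ec_good_def pt_def ec_trans_def o.trans_const)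
          ultimately show ?thesis using o.trans_pt_x_le[OF np[OF n1]] by simp
        qed
      qed
      moreover have "infinite (G (ec_trans g2 h (pt z)))" using inf by simp
      ultimately show ?thesis by (metis (no_types, lifting) finite_Un finite_atMost finite_subset mem_Collect_eq)
    qed
  qed
qed

end
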